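(* Let $X$ be a complete simplicial toric variety of dimension $n$ over an algebraically closed field $\mathbb K$ with torsion-free class group and homogeneous coordinate ring $S$. Let $Y\subseteq\mathbb T^n$ be a reduced closed (zero-dimensional) subscheme of $X$ contained in the dense torus $\mathbb T^n$ of $X$. Then the following hold. (i) If $\alpha\not\succeq\alpha_i$ for all the degrees $\alpha_i$ of minimal generators of $I(Y)$, then $H_Y(\alpha)=|P_\alpha\cap M|$. (ii) $H_Y(\alpha)\le H_Y(\alpha')$ for all $\alpha\preceq\alpha'$ with $\alpha\in\mathbb N\beta$. (iii) If $Y$ is a complete intersection subscheme of $X$ such that $I(Y)$ is generated by homogeneous polynomials with semi-ample degrees $\alpha_1,\dots,\alpha_n$, then $H_Y(\alpha)=|Y|$ for all $\alpha\succeq\alpha_1+\cdots+\alpha_n$.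
   Context: Let $\Sigma\subset N_{\mathbb R}$ be the fan of $X$, $N$ a lattice of rank $n$ with dual lattice $M$, $v_1,\dots,v_r\in N$ the primitive generators of the rays $\rho_1,\dots,\rho_r$ of $\Sigma$, and $D_1,\dots,D_r$ the corresponding torus-invariant prime Weil divisors. Put $\mathcal A=\mathrm{Cl}(X)$. The homogeneous coordinate ring is $S=\mathbb K[x_1,\dots,x_r]=\bigoplus_{\alpha\in\mathcal A}S_\alpha$, graded by $\deg(x_j)=\beta_j:=[D_j]\in\mathcal A$; "homogeneous" refers to this grading. $\mathbb N\beta\subset\mathcal A$ is the semigroup (with $0$) generated by $\beta_1,\dots,\beta_r$, and $\alpha\preceq\alpha'$ means $\alpha'-\alpha\in\mathbb N\beta$. The irrelevant ideal is $B=\langle\prod_{\rho_i\not\subset\sigma}x_i:\sigma\in\Sigma\rangle$, and $\pi:\mathbb K^r\setminus V(B)\to X$ is the geometric quotient map; the dense torus is $\mathbb T^n=\pi((\mathbb K^* )^r)$. For a reduced closed subscheme $Y\subset X$, $I(Y)\subset S$ is the unique radical $B$-saturated homogeneous ideal defining $Y$; minimal generators are taken homogeneous. $Y$ is a complete intersection if $I(Y)$ is generated by a regular sequence of homogeneous polynomials $F_1,\dots,F_k$, $k$ being the codimension of $Y$ in $X$. The multigraded Hilbert function is $H_Y(\alpha)=\dim_{\mathbb K}(S/I(Y))_\alpha$. For $D=\sum_ja_jD_j$ put $P_D=\{m\in M_{\mathbb R}:\langle m,v_j\rangle\ge-a_j,\ 1\le j\le r\}$; up to lattice translation it depends only on $\alpha=[D]$,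 and $P_\alpha$ denotes any such $P_D$. A degree $\alpha$ is semi-ample if it is the class of a Cartier divisor $D$ with $\mathcal O(D)$ generated by global sections. $|Y|$ is the number of points of $Y$. *)

theory Defs
  imports
    "HOL-Analysis.Analysis"
    "HOL-Computational_Algebra.Polynomial"
    "HOL-Library.Poly_Mapping"
    "HOL-Library.Set_Algebras"
begin

text \<open>
  The lattice \<open>N\<close> and its dual \<open>M\<close> are both \<open>int ^ 'n\<close>, embedded in
  \<open>real ^ 'n\<close> by \<open>lat\<close>; the pairing between them is \<open>pairing\<close>.
\<close>

definition lat :: "int ^ 'n \<Rightarrow> real ^ 'n" where
  "lat u = (\<chi> i. of_int (u $ i))"

definition pairing :: "int ^ 'n \<Rightarrow> int ^ 'n \<Rightarrow> int" where
  "pairing m u = (\<Sum>i\<in>UNIV. m $ i * u $ i)"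

definition rational_polyhedral_cone :: "(real ^ 'n) set \<Rightarrow> bool" where
  "rational_polyhedral_cone \<sigma> \<longleftrightarrow>
     (\<exists>V :: (int ^ 'n) set. finite V \<and> \<sigma> = convex_cone hull (lat ` V))"

definition strongly_convex :: "(real ^ 'n) set \<Rightarrow> bool" where
  "strongly_convex \<sigma> \<longleftrightarrow> \<sigma> \<inter> uminus ` \<sigma> = {0}"

text \<open>
  The relation \<open>face_of\<close> counts the empty set as a face; it is not a face of a cone in
  the toric sense and is excluded.  For polyhedral cones the nonempty faces in the sense of
  \<open>face_of\<close> are exactly those cut out by supporting hyperplanes.
\<close>

definition fan :: "(real ^ 'n) set set \<Rightarrow> bool" where
  "fan \<Sigma> \<longleftrightarrow> finite \<Sigma> \<and>
     (\<forall>\<sigma>\<in>\<Sigma>. rational_polyhedral_cone \<sigma> \<and> strongly_convex \<sigma>) \<and>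
     (\<forall>\<sigma>\<in>\<Sigma>. \<forall>\<tau>. \<tau> face_of \<sigma> \<and> \<tau> \<noteq> {} \<longrightarrow> \<tau> \<in> \<Sigma>) \<and>
     (\<forall>\<sigma>\<in>\<Sigma>. \<forall>\<tau>\<in>\<Sigma>. (\<sigma> \<inter> \<tau>) face_of \<sigma> \<and> (\<sigma> \<inter> \<tau>) face_of \<tau>)"

definition complete_fan :: "(real ^ 'n) set set \<Rightarrow> bool" where
  "complete_fan \<Sigma> \<longleftrightarrow> \<Union>\<Sigma> = UNIV"

definition rays :: "(real ^ 'n) set set \<Rightarrow> (real ^ 'n) set set" where
  "rays \<Sigma> = {\<rho> \<in> \<Sigma>. dim \<rho> = 1}"

definition ray :: "('r \<Rightarrow> int ^ 'n) \<Rightarrow> 'r \<Rightarrow> (real ^ 'n) set" where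
  "ray v j = convex_cone hull {lat (v j)}"

text \<open>
  The index type \<open>'r\<close> enumerates the rays without repetition, and \<open>v j\<close> is the
  generator of the semigroup of lattice points of the \<open>j\<close>-th ray.
\<close>

definition primitive_ray_generators ::
    "(real ^ 'n) set set \<Rightarrow> ('r \<Rightarrow> int ^ 'n) \<Rightarrow> bool" where
  "primitive_ray_generators \<Sigma> v \<longleftrightarrow>
     bij_betw (ray v) UNIV (rays \<Sigma>) \<and>
     (\<forall>j. {u. lat u \<in> ray v j} = range (\<lambda>k :: nat. of_nat k *s v j))"

definition simplicial_fan ::
    "(real ^ 'n) set set \<Rightarrow> ('r \<Rightarrow> int ^ 'n) \<Rightarrow> bool" where
  "simplicial_fan \<Sigma> v \<longleftrightarrow>
     (\<forall>\<sigma>\<in>\<Sigma>. independent {lat (v j) | j. ray v j \<subseteq> \<sigma>})"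

text \<open>
  A torus-invariant Weil divisor \<open>\<Sum>\<^sub>j a\<^sub>j D\<^sub>j\<close> is its coefficient vector
  \<open>a :: int ^ 'r\<close>, and the divisor of the character \<open>m\<close> has coefficients
  \<open>pairing m (v j)\<close>.  Classes are cosets of the subgroup of principal divisors, so the
  addition of classes is the elementwise addition of sets.
\<close>

definition principal_divisors :: "('r::finite \<Rightarrow> int ^ 'n) \<Rightarrow> (int ^ 'r) set" where
  "principal_divisors v = range (\<lambda>m. \<chi> j. pairing m (v j))"

definition div_class :: "('r::finite \<Rightarrow> int ^ 'n) \<Rightarrow> int ^ 'r \<Rightarrow> (int ^ 'r) set" where
  "div_class v a = a +o principal_divisors v"

definition class_group :: "('r::finite \<Rightarrow> int ^ 'n) \<Rightarrow> (int ^ 'r) set set" where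
  "class_group v = range (div_class v)"

definition torsion_free_class_group :: "('r::finite \<Rightarrow> int ^ 'n) \<Rightarrow> bool" where
  "torsion_free_class_group v \<longleftrightarrow>
     (\<forall>a. \<forall>k :: nat. k > 0 \<longrightarrow>
        div_class v (of_nat k *s a) = div_class v 0 \<longrightarrow> div_class v a = div_class v 0)"

definition effective_classes :: "('r::finite \<Rightarrow> int ^ 'n) \<Rightarrow> (int ^ 'r) set set" where
  "effective_classes v = range (\<lambda>c :: 'r \<Rightarrow> nat. div_class v (\<chi> j. int (c j)))"

definition class_le ::
    "('r::finite \<Rightarrow> int ^ 'n) \<Rightarrow> (int ^ 'r) set \<Rightarrow> (int ^ 'r) set \<Rightarrow> bool" where
  "class_le v \<alpha> \<alpha>' \<longleftrightarrow> (\<exists>\<gamma>\<in>effective_classes v. \<alpha>' = \<alpha> + \<gamma>)"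

definition divisor_polytope ::
    "('r::finite \<Rightarrow> int ^ 'n) \<Rightarrow> int ^ 'r \<Rightarrow> (real ^ 'n) set" where
  "divisor_polytope v a = {m. \<forall>j. m \<bullet> lat (v j) \<ge> - of_int (a $ j)}"

type_synonym ('r, 'k) cox_ring = "('r \<Rightarrow>\<^sub>0 nat) \<Rightarrow>\<^sub>0 'k"

definition cox_var :: "'r \<Rightarrow> ('r, 'k::field) cox_ring" where
  "cox_var j = Poly_Mapping.single (Poly_Mapping.single j 1) 1"

definition cox_const :: "'k \<Rightarrow> ('r, 'k::field) cox_ring" where
  "cox_const c = Poly_Mapping.single 0 c"

definition cox_eval :: "('r::finite, 'k::field) cox_ring \<Rightarrow> 'k ^ 'r \<Rightarrow> 'k" where
  "cox_eval f x =
     (\<Sum>c\<in>Poly_Mapping.keys f. Poly_Mapping.lookup f c *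
        (\<Prod>j\<in>UNIV. x $ j ^ Poly_Mapping.lookup c j))"

definition graded_part ::
    "('r::finite \<Rightarrow> int ^ 'n) \<Rightarrow> (int ^ 'r) set \<Rightarrow> ('r, 'k::field) cox_ring set" where
  "graded_part v \<alpha> =
     {f. \<forall>c\<in>Poly_Mapping.keys f. div_class v (\<chi> j. int (Poly_Mapping.lookup c j)) = \<alpha>}"

definition homogeneous ::
    "('r::finite \<Rightarrow> int ^ 'n) \<Rightarrow> ('r, 'k::field) cox_ring \<Rightarrow> bool" where
  "homogeneous v f \<longleftrightarrow> (\<exists>\<alpha>\<in>class_group v. f \<in> graded_part v \<alpha>)"

text \<open>Ideals are the submodules of the ring regarded as a module over itself.\<close>

abbreviation is_ideal :: "'a::comm_ring_1 set \<Rightarrow> bool" where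
  "is_ideal \<equiv> module.subspace (*)"

abbreviation ideal_gen :: "'a::comm_ring_1 set \<Rightarrow> 'a set" where
  "ideal_gen \<equiv> module.span (*)"

definition homogeneous_ideal ::
    "('r::finite \<Rightarrow> int ^ 'n) \<Rightarrow> ('r, 'k::field) cox_ring set \<Rightarrow> bool" where
  "homogeneous_ideal v I \<longleftrightarrow> is_ideal I \<and> I = ideal_gen {f \<in> I. homogeneous v f}"

definition radical_ideal :: "'a::comm_ring_1 set \<Rightarrow> bool" where
  "radical_ideal I \<longleftrightarrow> is_ideal I \<and> (\<forall>f k. f ^ k \<in> I \<longrightarrow> f \<in> I)"

definition irrelevant_ideal ::
    "(real ^ 'n) set set \<Rightarrow> ('r::finite \<Rightarrow> int ^ 'n) \<Rightarrow> ('r, 'k::field) cox_ring set" where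
  "irrelevant_ideal \<Sigma> v =
     ideal_gen ((\<lambda>\<sigma>. \<Prod>j | \<not> ray v j \<subseteq> \<sigma>. cox_var j) ` \<Sigma>)"

text \<open>
  \<open>I : B\<^sup>\<infinity> = I\<close>; membership of \<open>f\<close> in \<open>I : B\<^sup>k\<close> is tested on the products of \<open>k\<close> elements
  of \<open>B\<close>, which generate \<open>B\<^sup>k\<close>.
\<close>

definition saturated :: "'a::comm_ring_1 set \<Rightarrow> 'a set \<Rightarrow> bool" where
  "saturated B I \<longleftrightarrow>
     (\<forall>f. (\<exists>k. \<forall>b :: nat \<Rightarrow> 'a. (\<forall>i<k. b i \<in> B) \<longrightarrow> f * (\<Prod>i<k. b i) \<in> I) \<longrightarrow> f \<in> I)"

definition regular_sequence :: "'a::comm_ring_1 list \<Rightarrow> bool" where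
  "regular_sequence fs \<longleftrightarrow>
     (\<forall>i<length fs. \<forall>g. g * fs ! i \<in> ideal_gen (set (take i fs))
        \<longrightarrow> g \<in> ideal_gen (set (take i fs))) \<and>
     ideal_gen (set fs) \<noteq> UNIV"

definition minimal_generators ::
    "('r::finite \<Rightarrow> int ^ 'n) \<Rightarrow> ('r, 'k::field) cox_ring set \<Rightarrow>
     ('r, 'k) cox_ring set \<Rightarrow> bool" where
  "minimal_generators v I G \<longleftrightarrow>
     (\<forall>g\<in>G. homogeneous v g) \<and> ideal_gen G = I \<and> (\<forall>G'. G' \<subset> G \<longrightarrow> ideal_gen G' \<noteq> I)"

definition zero_set :: "('r::finite, 'k::field) cox_ring set \<Rightarrow> ('k ^ 'r) set" where
  "zero_set J = {x. \<forall>f\<in>J. cox_eval f x = 0}"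

definition cox_domain ::
    "(real ^ 'n) set set \<Rightarrow> ('r::finite \<Rightarrow> int ^ 'n) \<Rightarrow> ('k::field ^ 'r) set" where
  "cox_domain \<Sigma> v = UNIV - zero_set (irrelevant_ideal \<Sigma> v)"

text \<open>
  The group \<open>Hom(Cl X, K\<^sup>*)\<close> as a subgroup of \<open>(K\<^sup>*)\<^sup>r\<close>.  For a simplicial fan the geometric
  quotient identifies the (closed) points of \<open>X\<close> with its orbits on \<open>cox_domain\<close>, and
  \<open>quot_map\<close> sends a point to its orbit.
\<close>

definition cox_group :: "('r::finite \<Rightarrow> int ^ 'n) \<Rightarrow> ('k::field ^ 'r) set" where
  "cox_group v =
     {t. (\<forall>j. t $ j \<noteq> 0) \<and> (\<forall>m. (\<Prod>j\<in>UNIV. t $ j powi pairing m (v j)) = 1)}"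

definition quot_map :: "('r::finite \<Rightarrow> int ^ 'n) \<Rightarrow> 'k::field ^ 'r \<Rightarrow> ('k ^ 'r) set" where
  "quot_map v x = (\<lambda>t. \<chi> j. t $ j * x $ j) ` cox_group v"

definition toric_variety ::
    "(real ^ 'n) set set \<Rightarrow> ('r::finite \<Rightarrow> int ^ 'n) \<Rightarrow> ('k::field ^ 'r) set set" where
  "toric_variety \<Sigma> v = quot_map v ` cox_domain \<Sigma> v"

definition dense_torus :: "('r::finite \<Rightarrow> int ^ 'n) \<Rightarrow> ('k::field ^ 'r) set set" where
  "dense_torus v = quot_map v ` {x. \<forall>j. x $ j \<noteq> 0}"

text \<open>
  A reduced closed subscheme is a subset of the closed points that is closed in the quotient
  topology of the Zariski topology of \<open>cox_domain\<close>.
\<close>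

definition closed_subvariety ::
    "(real ^ 'n) set set \<Rightarrow> ('r::finite \<Rightarrow> int ^ 'n) \<Rightarrow> ('k::field ^ 'r) set set \<Rightarrow> bool" where
  "closed_subvariety \<Sigma> v Y \<longleftrightarrow> Y \<subseteq> toric_variety \<Sigma> v \<and>
     (\<exists>J. {x \<in> cox_domain \<Sigma> v. quot_map v x \<in> Y} = cox_domain \<Sigma> v \<inter> zero_set J)"

definition defining_ideal ::
    "(real ^ 'n) set set \<Rightarrow> ('r::finite \<Rightarrow> int ^ 'n) \<Rightarrow> ('k::field ^ 'r) set set \<Rightarrow>
     ('r, 'k) cox_ring set \<Rightarrow> bool" where
  "defining_ideal \<Sigma> v Y I \<longleftrightarrow>
     homogeneous_ideal v I \<and> radical_ideal I \<and> saturated (irrelevant_ideal \<Sigma> v) I \<and>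
     Y = quot_map v ` (cox_domain \<Sigma> v \<inter> zero_set I)"

text \<open>
  \<open>I\<close> is generated by a regular sequence of \<open>k\<close> homogeneous polynomials, \<open>k\<close> standing for the
  codimension of the subscheme defined by \<open>I\<close>.
\<close>

definition complete_intersection ::
    "('r::finite \<Rightarrow> int ^ 'n) \<Rightarrow> ('r, 'k::field) cox_ring set \<Rightarrow> nat \<Rightarrow> bool" where
  "complete_intersection v I k \<longleftrightarrow>
     (\<exists>fs. length fs = k \<and> (\<forall>f\<in>set fs. homogeneous v f) \<and>
           regular_sequence fs \<and> ideal_gen (set fs) = I)"

text \<open>
  The classes of the elements of \<open>E\<close> form a basis of the image of \<open>V\<close> in the quotient of the
  polynomial ring by \<open>W\<close>, without repetition.
\<close>

definition basis_modulo ::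
    "('r, 'k::field) cox_ring set \<Rightarrow> ('r, 'k) cox_ring set \<Rightarrow> ('r, 'k) cox_ring set \<Rightarrow> bool" where
  "basis_modulo W V E \<longleftrightarrow> finite E \<and> E \<subseteq> V \<and>
     (\<forall>f\<in>V. \<exists>c. f - (\<Sum>e\<in>E. cox_const (c e) * e) \<in> W) \<and>
     (\<forall>c. (\<Sum>e\<in>E. cox_const (c e) * e) \<in> W \<longrightarrow> (\<forall>e\<in>E. c e = 0))"

text \<open>
  The dimension of \<open>(S/I)\<^sub>\<alpha>\<close>, the image of \<open>S\<^sub>\<alpha>\<close> in \<open>S/I\<close>.  It is finite because \<open>S\<^sub>\<alpha>\<close> is
  finite-dimensional for a complete fan.
\<close>

definition hilbert_function ::
    "('r::finite \<Rightarrow> int ^ 'n) \<Rightarrow> ('r, 'k::field) cox_ring set \<Rightarrow> (int ^ 'r) set \<Rightarrow> nat" where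
  "hilbert_function v I \<alpha> = (THE d. \<exists>E. basis_modulo I (graded_part v \<alpha>) E \<and> card E = d)"

text \<open>
  On the affine chart of \<open>\<sigma>\<close> a torus-invariant Cartier divisor is the divisor of a character
  \<open>\<chi>\<^sup>-\<^sup>m\<close>.
\<close>

definition cartier ::
    "(real ^ 'n) set set \<Rightarrow> ('r::finite \<Rightarrow> int ^ 'n) \<Rightarrow> int ^ 'r \<Rightarrow> bool" where
  "cartier \<Sigma> v a \<longleftrightarrow>
     (\<forall>\<sigma>\<in>\<Sigma>. \<exists>m. \<forall>j. ray v j \<subseteq> \<sigma> \<longrightarrow> pairing m (v j) = - (a $ j))"

text \<open>
  The global sections of \<open>O(D)\<close> are the elements of \<open>S\<^sub>\<alpha>\<close>, \<open>\<alpha> = [D]\<close>.  For Cartier \<open>D\<close> they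
  generate \<open>O(D)\<close> iff at every point of \<open>X\<close> some section does not vanish; the vanishing can be
  tested at any preimage of the point.  The first argument fixes the base field.
\<close>

definition semi_ample ::
    "'k::field itself \<Rightarrow> (real ^ 'n) set set \<Rightarrow> ('r::finite \<Rightarrow> int ^ 'n) \<Rightarrow>
     (int ^ 'r) set \<Rightarrow> bool" where
  "semi_ample K \<Sigma> v \<alpha> \<longleftrightarrow>
     (\<exists>a. \<alpha> = div_class v a \<and> cartier \<Sigma> v a) \<and>
     (\<forall>x :: 'k ^ 'r \<in> cox_domain \<Sigma> v. \<exists>f\<in>graded_part v \<alpha>. cox_eval f x \<noteq> 0)"

end

theory Submission
  imports Defs
begin

text \<open>
  By the Nullstellensatz and saturation, \<open>I\<close> is the vanishing ideal of the orbits of \<open>Y\<close>, which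
  lie in the torus; hence variables are nonzerodivisors modulo \<open>I\<close>, which gives (ii), and
  (i) holds because \<open>I\<close> vanishes in such degrees.  For (iii), the regular sequence gives
  \<open>H(\<alpha>) = \<Sum>\<^sub>A (-1)\<^bsup>|A|\<^esup> |P(\<alpha> - \<alpha>\<^sub>A) \<inter> M|\<close>, where \<open>A\<close> ranges over the subsets of the
  generators and \<open>\<alpha>\<^sub>A\<close> is the sum of their degrees.  Mixed differences of order \<open>n + 1\<close> of
  \<open>|P \<inter> M|\<close> vanish on semi-ample degrees: a signed decomposition of \<open>P\<close> into half-open cones
  at its vertices expresses the difference through exponential sums with a zero at \<open>s = 0\<close>.  So
  \<open>H\<close> is constant on the positive multiples of \<open>E = \<alpha>\<^sub>1 + \<dots> + \<alpha>\<^sub>n\<close>, and large multiples of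
  \<open>E\<close> dominate a degree in which the points of \<open>Y\<close> are separated, so the constant is \<open>|Y|\<close>.
\<close>

section \<open>Homomorphisms to algebraically closed fields\<close>

text \<open>In (iii) the semi-ample generators are not assumed to form the regular sequence: some
  homogeneous regular sequence of length n generates I, and its degrees are first matched with the
  given ones by a permutation. The order n + 1 arises because E serves as one more semi-ample
  direction besides the n degrees: the vanishing then says that adding E leaves the n-fold
  difference unchanged. The cones at the vertices come from the fan and not from the polytope, so
  degenerate polytopes are covered as well; Cartier divisors have lattice points as vertices, so
  that the degree enters an exponential sum only through one factor per cone. Multiples of E
  dominate every degree because each variable divides some monomial of degree E; otherwise a zero of
  I could be moved out of the torus. Once H(E) is known, monotonicity and the bound |Y| on H settle
  the degrees above E. For the Nullstellensatz, homomorphisms are extended along the generators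
  inside one fixed ring and modulo a prime ideal, so that no quotient ring or fraction field has to
  be formed.\<close>

definition subring :: "'a::comm_ring_1 set \<Rightarrow> bool" where
  "subring A \<longleftrightarrow> 1 \<in> A \<and> (\<forall>a\<in>A. \<forall>b\<in>A. a - b \<in> A \<and> a * b \<in> A)"

lemma subringD:
  assumes "subring A"
  shows subring_1: "1 \<in> A" and subring_0: "0 \<in> A"
    and subring_diff: "\<And>a b. a \<in> A \<Longrightarrow> b \<in> A \<Longrightarrow> a - b \<in> A"
    and subring_add: "\<And>a b. a \<in> A \<Longrightarrow> b \<in> A \<Longrightarrow> a + b \<in> A"
    and subring_mult: "\<And>a b. a \<in> A \<Longrightarrow> b \<in> A \<Longrightarrow> a * b \<in> A"
    and subring_power: "\<And>a k. a \<in> A \<Longrightarrow> a ^ k \<in> A"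
proof -
  have *: "a - b \<in> A" "a * b \<in> A" "1 \<in> A" if "a \<in> A" "b \<in> A" for a b
    using assms that unfolding subring_def by blast+
  show "1 \<in> A" using assms unfolding subring_def by blast
  then have z: "0 \<in> A" using *(1)[of 1 1] by simp
  then show "0 \<in> A" .
  show "a - b \<in> A" if "a \<in> A" "b \<in> A" for a b using *(1) that .
  show "a + b \<in> A" if "a \<in> A" "b \<in> A" for a b
    using *(1)[of a "0 - b"] *(1)[of 0 b] z that by simp
  show "a * b \<in> A" if "a \<in> A" "b \<in> A" for a b using *(2) that .
  show "a ^ k \<in> A" if "a \<in> A" for a k
    by (induction k) (use \<open>1 \<in> A\<close> *(2) that in auto)
qed

lemma subring_sum:
  assumes "subring A" "\<And>i. i \<in> I \<Longrightarrow> f i \<in> A"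
  shows "sum f I \<in> A"
  using assms(2) by (induction I rule: infinite_finite_induct)
    (auto intro: subring_0[OF assms(1)] subring_add[OF assms(1)])

definition prime_ideal :: "'a::comm_ring_1 set \<Rightarrow> bool" where
  "prime_ideal P \<longleftrightarrow> is_ideal P \<and> 1 \<notin> P \<and>
     (\<forall>a b. a * b \<in> P \<longrightarrow> a \<in> P \<or> b \<in> P)"

lemma is_ideal_iff:
  "is_ideal (I :: 'a::comm_ring_1 set) \<longleftrightarrow>
     0 \<in> I \<and> (\<forall>x\<in>I. \<forall>y\<in>I. x + y \<in> I) \<and> (\<forall>c. \<forall>x\<in>I. c * x \<in> I)"
proof -
  interpret module "(*) :: 'a \<Rightarrow> 'a \<Rightarrow> 'a" by unfold_locales (auto simp: algebra_simps)
  show ?thesis by (simp add: subspace_def)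
qed

lemma module_mult: "module ((*) :: 'a::comm_ring_1 \<Rightarrow> 'a \<Rightarrow> 'a)"
  by unfold_locales (auto simp: algebra_simps)

lemma ideal_0: "is_ideal I \<Longrightarrow> 0 \<in> (I :: 'a::comm_ring_1 set)"
  and ideal_add: "is_ideal I \<Longrightarrow> x \<in> I \<Longrightarrow> y \<in> I \<Longrightarrow> x + y \<in> I"
  and ideal_mult_left: "is_ideal I \<Longrightarrow> x \<in> I \<Longrightarrow> c * x \<in> I"
  and ideal_mult_right: "is_ideal I \<Longrightarrow> x \<in> I \<Longrightarrow> x * c \<in> I"
  by (auto simp: is_ideal_iff mult.commute)

lemma ideal_uminus: "is_ideal I \<Longrightarrow> x \<in> I \<Longrightarrow> - x \<in> (I :: 'a::comm_ring_1 set)"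
  using ideal_mult_left[of I x "-1"] by simp

lemma ideal_diff: "is_ideal I \<Longrightarrow> x \<in> I \<Longrightarrow> y \<in> I \<Longrightarrow> x - y \<in> (I :: 'a::comm_ring_1 set)"
  using ideal_add[of I x "-y"] ideal_uminus[of I y] by simp

lemma ideal_sum: "is_ideal I \<Longrightarrow> (\<And>i. i \<in> J \<Longrightarrow> f i \<in> I) \<Longrightarrow> sum f J \<in> (I :: 'a::comm_ring_1 set)"
  by (induction J rule: infinite_finite_induct) (auto intro: ideal_0 ideal_add)

text \<open>An ideal avoiding the powers of \<open>f\<close> and maximal with this property is prime.\<close>

lemma prime_ideal_avoiding:
  fixes I :: "'a::comm_ring_1 set"
  assumes I: "is_ideal I" and f: "\<And>k. f ^ k \<notin> I"
  obtains P where "prime_ideal P" "I \<subseteq> P" "f \<notin> P"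
proof -
  define \<A> where "\<A> = {J :: 'a set. is_ideal J \<and> I \<subseteq> J \<and> (\<forall>k. f ^ k \<notin> J)}"
  have "\<exists>M\<in>\<A>. \<forall>X\<in>\<A>. M \<subseteq> X \<longrightarrow> X = M"
  proof (rule subset_Zorn_nonempty)
    show "\<A> \<noteq> {}" using I f by (auto simp: \<A>_def)
    fix \<C> assume ne: "\<C> \<noteq> {}" and ch: "subset.chain \<A> \<C>"
    have sub: "\<C> \<subseteq> \<A>" and tot: "\<And>X Y. X \<in> \<C> \<Longrightarrow> Y \<in> \<C> \<Longrightarrow> X \<subseteq> Y \<or> Y \<subseteq> X"
      using ch by (auto simp: subset_chain_def)
    have id: "is_ideal X" if "X \<in> \<C>" for X using sub that by (auto simp: \<A>_def)
    have "is_ideal (\<Union>\<C>)"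
      unfolding is_ideal_iff
    proof (intro conjI ballI allI)
      show "0 \<in> \<Union>\<C>" using ne id ideal_0 by blast
      fix x y assume "x \<in> \<Union>\<C>" "y \<in> \<Union>\<C>"
      then obtain X Y where "X \<in> \<C>" "Y \<in> \<C>" "x \<in> X" "y \<in> Y" by blast
      then show "x + y \<in> \<Union>\<C>" using tot[of X Y] id ideal_add by blast
    next
      fix c x assume "x \<in> \<Union>\<C>" then show "c * x \<in> \<Union>\<C>" using id ideal_mult_left by blast
    qed
    then show "\<Union>\<C> \<in> \<A>" using sub ne unfolding \<A>_def by blast
  qed
  then obtain P where P: "P \<in> \<A>" and max: "\<And>X. X \<in> \<A> \<Longrightarrow> P \<subseteq> X \<Longrightarrow> X = P" by blast
  have idP: "is_ideal P" and IP: "I \<subseteq> P" and fP: "\<And>k. f ^ k \<notin> P"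
    using P by (auto simp: \<A>_def)
  \<comment> \<open>By maximality of \<open>P\<close>, the ideal \<open>Q\<close> generated by
    \<open>P\<close> and an element \<open>a\<close> outside it contains a power of
    \<open>f\<close>. Two such relations, multiplied, would put a power of \<open>f\<close> into
    \<open>P\<close> if \<open>a * b\<close> were in \<open>P\<close>.\<close>
  have step: "\<exists>k c p. p \<in> P \<and> f ^ k = p + c * a" if a: "a \<notin> P" for a
  proof -
    define Q where "Q = {p + c * a |p c. p \<in> P}"
    have "is_ideal Q"
      unfolding is_ideal_iff
    proof (intro conjI ballI allI)
      show "0 \<in> Q" unfolding Q_def using ideal_0[OF idP] by (auto intro!: exI[of _ 0])
      fix x y assume "x \<in> Q" "y \<in> Q"
      then obtain p c q d where "p \<in> P" "q \<in> P" "x = p + c * a" "y = q + d * a"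
        by (auto simp: Q_def)
      then have "x + y = (p + q) + (c + d) * a" "p + q \<in> P"
        using ideal_add[OF idP] by (auto simp: algebra_simps)
      then show "x + y \<in> Q" unfolding Q_def by blast
    next
      fix e x assume "x \<in> Q"
      then obtain p c where "p \<in> P" "x = p + c * a" by (auto simp: Q_def)
      moreover have "e * p \<in> P" using \<open>p \<in> P\<close> by (rule ideal_mult_left[OF idP])
      ultimately have "e * x = e * p + (e * c) * a" "e * p \<in> P"
        by (auto simp: algebra_simps)
      then show "e * x \<in> Q" unfolding Q_def by blast
    qed
    moreover have "P \<subseteq> Q" unfolding Q_def by (force intro: exI[of _ 0])
    moreover have "a = 0 + 1 * a" by simp
    then have "a \<in> Q" unfolding Q_def using ideal_0[OF idP] by blast
    ultimately have "Q \<notin> \<A>" using max[of Q] a by blast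
    then show ?thesis using \<open>is_ideal Q\<close> \<open>P \<subseteq> Q\<close> IP unfolding \<A>_def Q_def by blast
  qed
  have "prime_ideal P"
    unfolding prime_ideal_def
  proof (intro conjI allI impI)
    show "1 \<notin> P" using fP[of 0] by simp
    show "a \<in> P \<or> b \<in> P" if ab: "a * b \<in> P" for a b
    proof (rule ccontr)
      assume "\<not> (a \<in> P \<or> b \<in> P)"
      then obtain k c p l d q where "p \<in> P" "f ^ k = p + c * a" "q \<in> P" "f ^ l = q + d * b"
        using step[of a] step[of b] by blast
      then have "f ^ (k + l) = p * (q + d * b) + (c * a) * q + (c * d) * (a * b)"
        by (simp add: power_add algebra_simps)
      also have "\<dots> \<in> P" by (intro ideal_add[OF idP] ideal_mult_right[OF idP] ideal_mult_left[OF idP]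
            \<open>p \<in> P\<close> \<open>q \<in> P\<close> ab)
      finally show False using fP by blast
    qed
  qed (rule idP)
  then show thesis using that IP fP[of 1] by simp
qed

section \<open>Polynomials with coefficients in a subring, and degrees modulo an ideal\<close>

definition polys_over :: "'a::comm_ring_1 set \<Rightarrow> 'a poly set" where
  "polys_over A = {p. \<forall>i. coeff p i \<in> A}"

lemma polys_over_coeff: "p \<in> polys_over A \<Longrightarrow> coeff p i \<in> A"
  by (simp add: polys_over_def)

lemma polys_over_closed:
  assumes "subring A"
  shows polys_over_0: "0 \<in> polys_over A"
    and polys_over_monom: "\<And>a n. a \<in> A \<Longrightarrow> monom a n \<in> polys_over A"
    and polys_over_diff: "\<And>p q. p \<in> polys_over A \<Longrightarrow> q \<in> polys_over A \<Longrightarrow> p - q \<in> polys_over A"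
    and polys_over_add: "\<And>p q. p \<in> polys_over A \<Longrightarrow> q \<in> polys_over A \<Longrightarrow> p + q \<in> polys_over A"
    and polys_over_mult: "\<And>p q. p \<in> polys_over A \<Longrightarrow> q \<in> polys_over A \<Longrightarrow> p * q \<in> polys_over A"
    and polys_over_smult: "\<And>a q. a \<in> A \<Longrightarrow> q \<in> polys_over A \<Longrightarrow> smult a q \<in> polys_over A"
    and polys_over_cutoff: "\<And>n q. q \<in> polys_over A \<Longrightarrow> poly_cutoff n q \<in> polys_over A"
    and polys_over_const: "\<And>a. a \<in> A \<Longrightarrow> [:a:] \<in> polys_over A"
  using subring_0[OF assms] subring_diff[OF assms] subring_add[OF assms] subring_mult[OF assms]
  by (auto simp: polys_over_def coeff_mult coeff_monom coeff_poly_cutoff coeff_pCons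
        intro!: subring_sum[OF assms] split: nat.split)

lemma poly_in_ideal:
  assumes "is_ideal P" "\<And>i. coeff p i \<in> P"
  shows "poly p x \<in> P"
  unfolding poly_altdef using assms(2) by (intro ideal_sum[OF assms(1)] ideal_mult_right[OF assms(1)])

text \<open>The coefficient of index \<open>d\<close> of \<open>g\<close> need not be invertible, so
  each reduction step costs one factor of it; in return the quotient stays over
  \<open>A\<close>.\<close>

lemma pseudo_division_over:
  assumes A: "subring A" and g: "g \<in> polys_over A" "\<And>i. i > d \<Longrightarrow> coeff g i = 0"
    and p: "p \<in> polys_over A"
  obtains k q r where "q \<in> polys_over A" "r \<in> polys_over A"
    "smult (coeff g d ^ k) p = g * q + r" "\<And>i. i \<ge> d \<Longrightarrow> coeff r i = 0"
proof -
  note cl = polys_over_closed[OF A]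
  define c where "c = coeff g d"
  have cA: "c \<in> A" using g(1) by (simp add: c_def polys_over_coeff)
  have "\<exists>k q r. q \<in> polys_over A \<and> r \<in> polys_over A \<and>
    smult (c ^ k) p = g * q + r \<and> (\<forall>i\<ge>d. coeff r i = 0)"
    if "p \<in> polys_over A" "\<And>i. i \<ge> n \<Longrightarrow> coeff p i = 0" for n p
    using that
  proof (induction n arbitrary: p)
    case 0
    then show ?case by (intro exI[of _ 0] exI[of _ p]) (auto simp: cl)
  next
    case (Suc n)
    show ?case
    proof (cases "n < d")
      case True
      then show ?thesis using Suc.prems by (intro exI[of _ 0] exI[of _ p]) (auto simp: cl)
    next
      case False
      define p' where "p' = smult c p - monom (coeff p n) (n - d) * g"
      have p': "p' \<in> polys_over A"
        using Suc.prems(1) unfolding p'_def by (intro cl cA polys_over_coeff g)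
      have "coeff p' i = 0" if "i \<ge> n" for i
      proof (cases "i = n")
        case True
        then show ?thesis using False by (auto simp: p'_def coeff_monom_mult c_def)
      next
        case ne: False
        then have "coeff p i = 0" "i - (n - d) > d" using that False Suc.prems(2)[of i] by auto
        then show ?thesis using g(2) that by (simp add: p'_def coeff_monom_mult)
      qed
      from Suc.IH[OF p' this] obtain k q r where qr: "q \<in> polys_over A" "r \<in> polys_over A"
        "smult (c ^ k) p' = g * q + r" "\<forall>i\<ge>d. coeff r i = 0" by blast
      have "smult (c ^ Suc k) p = smult (c ^ k) p' + smult (c ^ k) (monom (coeff p n) (n - d) * g)"
        by (simp add: p'_def smult_diff_right mult.commute)
      also have "\<dots> = g * (q + smult (c ^ k) (monom (coeff p n) (n - d))) + r"
        by (simp add: qr(3) algebra_simps)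
      finally have eq: "smult (c ^ Suc k) p = g * (q + smult (c ^ k) (monom (coeff p n) (n - d))) + r" .
      have "q + smult (c ^ k) (monom (coeff p n) (n - d)) \<in> polys_over A"
        using Suc.prems(1) qr(1) by (intro cl cA polys_over_coeff subring_power[OF A])
      then show ?thesis using qr eq by blast
    qed
  qed
  from this[of p "Suc (degree p)"] p show thesis using that unfolding c_def
    by (metis Suc_le_lessD coeff_eq_0)
qed

text \<open>Replaces the degree of a polynomial over the quotient by \<open>P\<close>:
  \<open>d\<close> is the last index with a coefficient outside \<open>P\<close>, and cutting off
  above \<open>d\<close> changes \<open>p\<close> only by coefficients in \<open>P\<close>.\<close>

lemma cutoff_modulo_ideal:
  fixes P :: "'a::comm_ring_1 set"
  assumes P: "is_ideal P" and p: "\<not> (\<forall>i. coeff p i \<in> P)"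
  obtains d where "coeff p d \<notin> P" "\<And>i. i > d \<Longrightarrow> coeff p i \<in> P"
    "\<And>i. i > d \<Longrightarrow> coeff (poly_cutoff (Suc d) p) i = 0"
    "coeff (poly_cutoff (Suc d) p) d = coeff p d"
    "\<And>i. coeff (p - poly_cutoff (Suc d) p) i \<in> P"
proof -
  define D where "D = {i. coeff p i \<notin> P}"
  have "D \<subseteq> {..degree p}" using ideal_0[OF P] by (auto simp: D_def intro!: le_degree)
  then have fin: "finite D" by (rule finite_subset) simp
  have ne: "D \<noteq> {}" using p by (auto simp: D_def)
  define d where "d = Max D"
  have 1: "coeff p d \<notin> P" using Max_in[OF fin ne] by (simp add: d_def D_def)
  have 2: "coeff p i \<in> P" if "i > d" for i
    using Max_ge[OF fin, of i] that by (auto simp: d_def D_def)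
  show thesis
    by (rule that[of d]) (use 1 2 ideal_0[OF P] in \<open>auto simp: coeff_poly_cutoff\<close>)
qed

section \<open>Homomorphisms on a subring and their extension to one more generator\<close>

definition hom_on :: "'a::comm_ring_1 set \<Rightarrow> ('a \<Rightarrow> 'b::comm_ring_1) \<Rightarrow> bool" where
  "hom_on A \<phi> \<longleftrightarrow> \<phi> 1 = 1 \<and> \<phi> 0 = 0 \<and> (\<forall>a\<in>A. \<forall>b\<in>A. \<phi> (a + b) = \<phi> a + \<phi> b \<and> \<phi> (a * b) = \<phi> a * \<phi> b)"

lemma hom_on_sum:
  assumes "subring A" "hom_on A \<phi>" "\<And>i. i \<in> I \<Longrightarrow> f i \<in> A"
  shows "\<phi> (sum f I) = (\<Sum>i\<in>I. \<phi> (f i))"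
  using assms(3)
proof (induction I rule: infinite_finite_induct)
  case (insert x F)
  then show ?case using assms(2) subring_sum[OF assms(1), of F f] by (auto simp: hom_on_def)
qed (use assms(2) in \<open>auto simp: hom_on_def\<close>)

lemma map_poly_hom_on:
  assumes A: "subring A" and hom: "hom_on A \<phi>" and p: "p \<in> polys_over A" and q: "q \<in> polys_over A"
  shows "map_poly \<phi> (p + q) = map_poly \<phi> p + map_poly \<phi> q"
    and "map_poly \<phi> (p * q) = map_poly \<phi> p * map_poly \<phi> q"
proof -
  have 0: "\<phi> 0 = 0" using hom by (simp add: hom_on_def)
  have h: "\<phi> (a + b) = \<phi> a + \<phi> b" "\<phi> (a * b) = \<phi> a * \<phi> b" if "a \<in> A" "b \<in> A" for a b
    using hom that by (auto simp: hom_on_def)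
  show "map_poly \<phi> (p + q) = map_poly \<phi> p + map_poly \<phi> q"
    using p q by (intro poly_eqI) (simp add: coeff_map_poly 0 h polys_over_coeff)
  show "map_poly \<phi> (p * q) = map_poly \<phi> p * map_poly \<phi> q"
    using p q by (intro poly_eqI)
      (simp add: coeff_map_poly 0 coeff_mult hom_on_sum[OF A hom] h polys_over_coeff subring_mult[OF A])
qed

definition adjoin :: "'a::comm_ring_1 set \<Rightarrow> 'a \<Rightarrow> 'a set" where
  "adjoin A x = (\<lambda>p. poly p x) ` polys_over A"

lemma subring_adjoin:
  assumes "subring A"
  shows "subring (adjoin A x)"
  unfolding subring_def
proof (intro conjI ballI)
  have "poly [:1:] x \<in> adjoin A x"
    unfolding adjoin_def by (intro imageI polys_over_const[OF assms] subring_1[OF assms])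
  then show "1 \<in> adjoin A x" by simp
  fix a b assume "a \<in> adjoin A x" "b \<in> adjoin A x"
  then obtain p q where "p \<in> polys_over A" "q \<in> polys_over A" "a = poly p x" "b = poly q x"
    by (auto simp: adjoin_def)
  then have "a - b = poly (p - q) x" "a * b = poly (p * q) x" "p - q \<in> polys_over A" "p * q \<in> polys_over A"
    by (auto intro: polys_over_closed[OF assms])
  then show "a - b \<in> adjoin A x" "a * b \<in> adjoin A x" unfolding adjoin_def by blast+
qed

lemma adjoin_superset: "subring A \<Longrightarrow> A \<subseteq> adjoin A x"
  unfolding adjoin_def using polys_over_const by force

lemma adjoin_self: "subring A \<Longrightarrow> x \<in> adjoin A x"
  unfolding adjoin_def by (rule image_eqI[of _ _ "[:0,1:]"])
    (auto simp: polys_over_def coeff_pCons subring_0 subring_1 split: nat.split)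

text \<open>Sending \<open>x\<close> to \<open>s\<close> is well defined: two polynomials with the
  same value at \<open>x\<close> have a difference with value 0, which lies in \<open>P\<close>, and
  \<open>kill\<close> makes the image of that difference vanish at \<open>s\<close>. For the same
  reason elements of \<open>P\<close> go to 0.\<close>

lemma extend_hom:
  fixes \<phi> :: "'a::comm_ring_1 \<Rightarrow> 'k::comm_ring_1"
  assumes A: "subring A" and P: "is_ideal P" and hom: "hom_on A \<phi>"
    and kill: "\<And>q. q \<in> polys_over A \<Longrightarrow> poly q x \<in> P \<Longrightarrow> poly (map_poly \<phi> q) s = 0"
  obtains \<phi>' where "hom_on (adjoin A x) \<phi>'" "\<And>y. y \<in> adjoin A x \<Longrightarrow> y \<in> P \<Longrightarrow> \<phi>' y = 0"
    "\<And>q. q \<in> polys_over A \<Longrightarrow> \<phi>' (poly q x) = poly (map_poly \<phi> q) s" "\<And>a. a \<in> A \<Longrightarrow> \<phi>' a = \<phi> a"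
proof -
  note cl = polys_over_closed[OF A]
  have \<phi>0: "\<phi> 0 = 0" and \<phi>1: "\<phi> 1 = 1" using hom by (auto simp: hom_on_def)
  define ev where "ev q = poly (map_poly \<phi> q) s" for q
  note map_poly_hom = map_poly_hom_on[OF A hom]
  have ev_add: "ev (p + q) = ev p + ev q" and ev_mult: "ev (p * q) = ev p * ev q"
    if "p \<in> polys_over A" "q \<in> polys_over A" for p q
    using that by (simp_all add: ev_def map_poly_hom)
  have wd: "ev p = ev q" if "p \<in> polys_over A" "q \<in> polys_over A" "poly p x = poly q x" for p q
  proof -
    have "ev (p - q) = 0" using that kill[of "p - q"] cl ideal_0[OF P] by (simp add: ev_def)
    moreover have "ev p = ev (p - q) + ev q" using ev_add[of "p - q" q] that cl by simp
    ultimately show ?thesis by simp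
  qed
  \<comment> \<open>The choice of the polynomial representing \<open>y\<close> is immaterial by
    \<open>wd\<close>; outside \<open>adjoin A x\<close> the value is arbitrary.\<close>
  define \<phi>' where "\<phi>' y = ev (SOME q. q \<in> polys_over A \<and> poly q x = y)" for y
  have \<phi>': "\<phi>' (poly q x) = ev q" if "q \<in> polys_over A" for q
    using someI_ex[of "\<lambda>r. r \<in> polys_over A \<and> poly r x = poly q x"] that wd unfolding \<phi>'_def by blast
  have \<phi>'A: "\<phi>' a = \<phi> a" if "a \<in> A" for a
    using \<phi>'[of "[:a:]"] that cl by (simp add: ev_def map_poly_pCons \<phi>0)
  show thesis
  proof (rule that[of \<phi>'])
    show "hom_on (adjoin A x) \<phi>'"
      unfolding hom_on_def
    proof (intro conjI ballI)
      show "\<phi>' 1 = 1" "\<phi>' 0 = 0" using \<phi>'A \<phi>1 \<phi>0 subring_1[OF A] subring_0[OF A] by auto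
      fix a b assume "a \<in> adjoin A x" "b \<in> adjoin A x"
      then obtain p q where pq: "p \<in> polys_over A" "q \<in> polys_over A" "a = poly p x" "b = poly q x"
        by (auto simp: adjoin_def)
      show "\<phi>' (a + b) = \<phi>' a + \<phi>' b"
        using \<phi>'[of "p + q"] \<phi>'[of p] \<phi>'[of q] pq cl by (simp add: ev_add)
      show "\<phi>' (a * b) = \<phi>' a * \<phi>' b"
        using \<phi>'[of "p * q"] \<phi>'[of p] \<phi>'[of q] pq cl by (simp add: ev_mult)
    qed
    show "\<phi>' y = 0" if "y \<in> adjoin A x" "y \<in> P" for y
      using that \<phi>' kill unfolding adjoin_def ev_def by auto
  qed (use \<phi>' \<phi>'A in \<open>auto simp: ev_def\<close>)
qed

text \<open>Takes the place of the generator of an ideal of polynomials over a field. The degree is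
  measured modulo \<open>P\<close>; closure of \<open>J\<close> under truncation, the assumption
  \<open>cut\<close>, turns a degree modulo \<open>P\<close> into an honest vanishing of the higher
  coefficients.\<close>

lemma minimal_degree_element:
  fixes P :: "'a::comm_ring_1 set"
  assumes A: "subring A" and P: "is_ideal P"
    and J: "J \<subseteq> polys_over A" "g \<in> J" "\<not> (\<forall>i. coeff g i \<in> P)"
    and cut: "\<And>p n. p \<in> J \<Longrightarrow> (\<And>i. i > n \<Longrightarrow> coeff p i \<in> P) \<Longrightarrow> poly_cutoff (Suc n) p \<in> J"
  obtains h e where "h \<in> J" "coeff h e \<notin> P" "\<And>i. i > e \<Longrightarrow> coeff h i = 0"
    "\<And>p. p \<in> J \<Longrightarrow> (\<And>i. i \<ge> e \<Longrightarrow> coeff p i \<in> P) \<Longrightarrow> \<forall>i. coeff p i \<in> P"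
proof -
  define Q where "Q e \<longleftrightarrow> (\<exists>h\<in>J. coeff h e \<notin> P \<and> (\<forall>i>e. coeff h i = 0))" for e
  have ex: "\<exists>d. Q d \<and> coeff p d \<notin> P" if p: "p \<in> J" "\<not> (\<forall>i. coeff p i \<in> P)" for p
  proof -
    obtain d where d: "coeff p d \<notin> P" "\<And>i. i > d \<Longrightarrow> coeff p i \<in> P"
      "\<And>i. i > d \<Longrightarrow> coeff (poly_cutoff (Suc d) p) i = 0"
      "coeff (poly_cutoff (Suc d) p) d = coeff p d"
      by (rule cutoff_modulo_ideal[OF P p(2)]) blast
    then show ?thesis using cut[of p d] p unfolding Q_def by metis
  qed
  define e where "e = (LEAST e. Q e)"
  have "Q e" unfolding e_def using ex[OF J(2,3)] LeastI by metis
  then obtain h where h: "h \<in> J" "coeff h e \<notin> P" "\<And>i. i > e \<Longrightarrow> coeff h i = 0"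
    unfolding Q_def by blast
  show thesis
  proof (rule that[OF h], assumption)
    fix p assume p: "p \<in> J" "\<And>i. i \<ge> e \<Longrightarrow> coeff p i \<in> P"
    show "\<forall>i. coeff p i \<in> P"
    proof (rule ccontr)
      assume "\<not> ?thesis"
      then obtain d where "Q d" "coeff p d \<notin> P" using ex p(1) by blast
      then show False using p(2)[of d] Least_le[of Q d] unfolding e_def by auto
    qed
  qed
qed

text \<open>
  The case of the extension step in which \<open>x\<close> is algebraic over \<open>A\<close> modulo \<open>P\<close>, with a
  witness \<open>p\<close> of minimal degree \<open>d\<close>: inverting \<open>c\<close> keeps \<open>poly q x\<close> from vanishing.
\<close>

lemma algebraic_denominator:
  fixes P :: "'a::comm_ring_1 set"
  assumes A: "subring A" and P: "prime_ideal P"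
    and p: "p \<in> polys_over A" "poly p x \<in> P" "coeff p d \<notin> P" "\<And>i. i > d \<Longrightarrow> coeff p i = 0"
    and min: "\<And>u. u \<in> polys_over A \<Longrightarrow> poly u x \<in> P \<Longrightarrow> (\<And>i. i \<ge> d \<Longrightarrow> coeff u i \<in> P) \<Longrightarrow>
        \<forall>i. coeff u i \<in> P"
    and q: "q \<in> polys_over A" "poly q x \<notin> P"
  obtains c w where "c \<in> A" "c \<notin> P" "w \<in> adjoin A x" "c - w * poly q x \<in> P"
proof -
  note cl = polys_over_closed[OF A]
  have idP: "is_ideal P" and pr: "\<And>a b. a * b \<in> P \<Longrightarrow> a \<in> P \<or> b \<in> P" and P1: "1 \<notin> P"
    using P by (auto simp: prime_ideal_def)
  note idl = ideal_0[OF idP] ideal_add[OF idP] ideal_diff[OF idP] ideal_mult_left[OF idP]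
    ideal_mult_right[OF idP] ideal_uminus[OF idP]
  have prpow: "a \<in> P" if "a ^ k * b \<in> P" "b \<notin> P" for a b k
    using that by (induction k) (use pr in \<open>auto simp: mult.assoc\<close>)
  \<comment> \<open>Up to coefficients in \<open>P\<close>, \<open>J\<close> is the ideal generated
    by \<open>p\<close> and \<open>q\<close>. Its element \<open>h\<close> of least degree acts as
    their greatest common divisor, and the aim is to show that it is a constant.\<close>
  define J where "J = {h \<in> polys_over A. \<exists>u\<in>polys_over A. \<exists>w\<in>polys_over A.
     \<forall>i. coeff (h - (u * p + w * q)) i \<in> P}"
  have qJ: "q \<in> J" and pJ: "p \<in> J"
  proof -
    have one: "[:1:] \<in> polys_over A" and zero: "0 \<in> polys_over A"
      using cl(1) cl(8)[OF subring_1[OF A]] by auto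
    have "\<forall>i. coeff (q - (0 * p + [:1:] * q)) i \<in> P" using idl(1) by simp
    then show "q \<in> J" unfolding J_def mem_Collect_eq by (intro conjI q(1) bexI[OF _ zero] bexI[OF _ one])
    have "\<forall>i. coeff (p - ([:1:] * p + 0 * q)) i \<in> P" using idl(1) by simp
    then show "p \<in> J" unfolding J_def mem_Collect_eq by (intro conjI p(1) bexI[OF _ zero] bexI[OF _ one])
  qed
  have Jdiff: "smult a g - h * t \<in> J" if gh: "g \<in> J" "h \<in> J" and "a \<in> A" "t \<in> polys_over A" for a g h t
  proof -
    obtain u w u' w' where uw: "u \<in> polys_over A" "w \<in> polys_over A" "u' \<in> polys_over A" "w' \<in> polys_over A"
      "\<And>i. coeff (g - (u * p + w * q)) i \<in> P" "\<And>i. coeff (h - (u' * p + w' * q)) i \<in> P"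
      using gh by (auto simp: J_def)
    define z z' where "z = g - (u * p + w * q)" and "z' = h - (u' * p + w' * q)"
    have "smult a g - h * t - ((smult a u - u' * t) * p + (smult a w - w' * t) * q) = smult a z - z' * t"
      unfolding z_def z'_def by (simp add: algebra_simps smult_add_right smult_diff_right)
    moreover have "coeff (smult a z - z' * t) i \<in> P" for i
      using uw(5,6) unfolding z_def[symmetric] z'_def[symmetric]
      unfolding coeff_diff coeff_smult coeff_mult by (intro idl(3,4,5) ideal_sum[OF idP])
    moreover have "smult a g - h * t \<in> polys_over A" "smult a u - u' * t \<in> polys_over A"
      "smult a w - w' * t \<in> polys_over A"
      using uw gh that by (auto intro!: cl simp: J_def)
    ultimately show ?thesis unfolding J_def mem_Collect_eq
      by (intro conjI bexI[of _ "smult a u - u' * t"] bexI[of _ "smult a w - w' * t"]) auto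
  qed
  have Jcut: "poly_cutoff (Suc n) g \<in> J" if g: "g \<in> J" "\<And>i. i > n \<Longrightarrow> coeff g i \<in> P" for g n
  proof -
    obtain u w where uw: "u \<in> polys_over A" "w \<in> polys_over A" "\<And>i. coeff (g - (u * p + w * q)) i \<in> P"
      using g by (auto simp: J_def)
    have "coeff (poly_cutoff (Suc n) g - (u * p + w * q)) i
       = coeff (g - (u * p + w * q)) i - (if i < Suc n then 0 else coeff g i)" for i
      by (simp add: coeff_poly_cutoff)
    moreover have "coeff (g - (u * p + w * q)) i - (if i < Suc n then 0 else coeff g i) \<in> P" for i
      using g(2)[of i] idl(1) by (intro idl(3) uw) simp
    ultimately have "\<forall>i. coeff (poly_cutoff (Suc n) g - (u * p + w * q)) i \<in> P" by presburger
    moreover have "poly_cutoff (Suc n) g \<in> polys_over A" using g(1) cl(7) by (simp add: J_def)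
    ultimately show ?thesis unfolding J_def mem_Collect_eq using uw(1,2) by blast
  qed
  have JA: "J \<subseteq> polys_over A" by (auto simp: J_def)
  have qP: "\<not> (\<forall>i. coeff q i \<in> P)" using poly_in_ideal[OF idP] q(2) by blast
  obtain h e where h: "h \<in> J" "coeff h e \<notin> P" "\<And>i. i > e \<Longrightarrow> coeff h i = 0"
    "\<And>p. p \<in> J \<Longrightarrow> (\<And>i. i \<ge> e \<Longrightarrow> coeff p i \<in> P) \<Longrightarrow> \<forall>i. coeff p i \<in> P"
    using minimal_degree_element[OF A idP JA qJ qP Jcut] by blast
  have hA: "h \<in> polys_over A" using h(1) JA by blast
  \<comment> \<open>The pseudo-remainder of an element of \<open>J\<close> by \<open>h\<close> lies
    again in \<open>J\<close> and has degree below \<open>e\<close>, so minimality leaves it zero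
    modulo \<open>P\<close>.\<close>
  have rem: "\<exists>k t r. t \<in> polys_over A \<and> smult (coeff h e ^ k) g = h * t + r \<and> (\<forall>i. coeff r i \<in> P)"
    if g: "g \<in> J" for g
  proof -
    obtain k t r where tr: "t \<in> polys_over A" "r \<in> polys_over A" "smult (coeff h e ^ k) g = h * t + r"
       "\<And>i. i \<ge> e \<Longrightarrow> coeff r i = 0"
      by (rule pseudo_division_over[OF A hA h(3), of e g]) (assumption, use g JA in blast, rule that)
    have "r = smult (coeff h e ^ k) g - h * t" using tr by simp
    then have "r \<in> J" using Jdiff[OF g h(1), of "coeff h e ^ k" t] tr(1) subring_power[OF A] hA
      by (simp add: polys_over_coeff)
    then show ?thesis using h(4)[of r] tr idl(1) by auto
  qed
  obtain k t r where tr: "t \<in> polys_over A" "smult (coeff h e ^ k) p = h * t + r" "\<And>i. coeff r i \<in> P"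
    using rem[OF pJ] by blast
  have hx: "poly h x \<notin> P"
  proof
    assume hx: "poly h x \<in> P"
    obtain k t r where tr: "smult (coeff h e ^ k) q = h * t + r" "\<And>i. coeff r i \<in> P"
      using rem[OF qJ] by blast
    have "coeff h e ^ k * poly q x = poly h x * poly t x + poly r x"
      using arg_cong[OF tr(1), of "\<lambda>p. poly p x"] by simp
    also have "\<dots> \<in> P" by (intro idl(2,5) hx poly_in_ideal[OF idP tr(2)])
    finally show False using prpow h(2) q(2) by blast
  qed
  have "coeff h e ^ k * poly p x = poly h x * poly t x + poly r x"
    using arg_cong[OF tr(2), of "\<lambda>p. poly p x"] by simp
  then have "poly h x * poly t x = coeff h e ^ k * poly p x - poly r x" by simp
  then have "poly h x * poly t x \<in> P" using p(2) poly_in_ideal[OF idP tr(3)] idl(3)[OF idl(4)] by simp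
  then have tx: "poly t x \<in> P" using pr hx by blast
  \<comment> \<open>Modulo \<open>P\<close> the product of \<open>h\<close> and \<open>t\<close> is
    a nonzero multiple of \<open>p\<close>, and \<open>t\<close> vanishes at \<open>x\<close> modulo
    \<open>P\<close>. Hence \<open>t\<close> already has degree at least \<open>d\<close>, which
    leaves degree 0 for \<open>h\<close>.\<close>
  have "e = 0"
  proof (rule ccontr)
    assume e: "e \<noteq> 0"
    have nz: "\<not> (\<forall>i. coeff t i \<in> P)"
    proof
      assume "\<forall>i. coeff t i \<in> P"
      then have "coeff (h * t + r) d \<in> P"
        unfolding coeff_add coeff_mult using tr(3) by (intro idl(2) idl(4) ideal_sum[OF idP]) auto
      then have "coeff h e ^ k * coeff p d \<in> P" using tr(2) by (metis coeff_smult)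
      then show False using prpow h(2) p(3) by blast
    qed
    obtain i0 where i0: "coeff t i0 \<notin> P" "\<And>i. i > i0 \<Longrightarrow> coeff t i \<in> P"
      by (rule cutoff_modulo_ideal[OF idP nz]) blast
    have "i0 \<ge> d" using min[OF tr(1) tx] nz i0 by (meson linorder_not_less order_less_le_trans)
    have "coeff (h * t) (e + i0) \<in> P"
    proof -
      have "coeff p (e + i0) = 0" using p(4) e \<open>i0 \<ge> d\<close> by simp
      then have "coeff (h * t) (e + i0) = - coeff r (e + i0)"
        using arg_cong[OF tr(2), of "\<lambda>p. coeff p (e + i0)"] by (simp add: add_eq_0_iff)
      then show ?thesis using idl(6) tr(3) by simp
    qed
    moreover have "coeff (h * t) (e + i0) = coeff h e * coeff t i0 + (\<Sum>i\<in>{..e+i0} - {e}. coeff h i * coeff t (e + i0 - i))"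
      by (simp add: coeff_mult sum.remove[of _ e])
    moreover have "coeff h i * coeff t (e + i0 - i) \<in> P" if "i \<in> {..e+i0} - {e}" for i
    proof (cases "i < e")
      case True
      then show ?thesis using idl(4) i0(2)[of "e + i0 - i"] by simp
    next
      case False
      then show ?thesis using that h(3)[of i] idl(1) by simp
    qed
    then have "(\<Sum>i\<in>{..e+i0} - {e}. coeff h i * coeff t (e + i0 - i)) \<in> P" by (intro ideal_sum[OF idP])
    ultimately have "coeff h e * coeff t i0 \<in> P" using idl(3) by (metis add_diff_cancel_right')
    then show False using pr h(2) i0 by blast
  qed
  define c where "c = coeff h 0"
  have "c \<in> A" "c \<notin> P" using h(2) hA \<open>e = 0\<close> by (auto simp: c_def polys_over_coeff)
  have hc: "h = [:c:]" using h(3) \<open>e = 0\<close> by (intro poly_eqI) (auto simp: c_def coeff_pCons split: nat.split)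
  obtain u w where uw: "u \<in> polys_over A" "w \<in> polys_over A" "\<And>i. coeff (h - (u * p + w * q)) i \<in> P"
    using h(1) by (auto simp: J_def)
  \<comment> \<open>Evaluating the Bezout relation at \<open>x\<close> removes \<open>p\<close>,
    whose value lies in \<open>P\<close>, and shows \<open>c\<close> to be a multiple of
    \<open>poly q x\<close> modulo \<open>P\<close>.\<close>
  have "poly (h - (u * p + w * q)) x \<in> P" using poly_in_ideal[OF idP uw(3)] .
  then have "c - (poly u x * poly p x + poly w x * poly q x) \<in> P" by (simp add: hc)
  then have "c - (poly u x * poly p x + poly w x * poly q x) + poly u x * poly p x \<in> P"
    using idl(2)[OF _ idl(4)[OF p(2)]] by blast
  then have "c - poly w x * poly q x \<in> P" by (simp add: algebra_simps)
  then show thesis using that \<open>c \<in> A\<close> \<open>c \<notin> P\<close> uw(2) unfolding adjoin_def by blast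
qed

text \<open>Says that the points with values in the field are dense in the spectrum of
  \<open>A\<close> modulo \<open>P\<close>. Keeping an arbitrary \<open>b\<close> outside
  \<open>P\<close> nonzero, instead of merely finding one homomorphism, is what lets the induction
  pass from \<open>A\<close> to \<open>adjoin A x\<close>.\<close>

definition separates :: "'a::comm_ring_1 set \<Rightarrow> 'a set \<Rightarrow> ('k \<Rightarrow> 'a) \<Rightarrow> 'k::field itself \<Rightarrow> bool" where
  "separates P A \<iota> K \<longleftrightarrow> (\<forall>b\<in>A - P. \<exists>\<phi> :: 'a \<Rightarrow> 'k.
     hom_on A \<phi> \<and> (\<forall>y\<in>A \<inter> P. \<phi> y = 0) \<and> (\<forall>c. \<phi> (\<iota> c) = c) \<and> \<phi> b \<noteq> 0)"

text \<open>If \<open>x\<close> is transcendental over \<open>A\<close> modulo \<open>P\<close>, it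
  may be sent to any value that is not a root of the image of \<open>q\<close>. If it is algebraic,
  it must be sent to a root of the image of \<open>p\<close>; a nonzero value of the denominator
  \<open>c\<close> from \<open>algebraic_denominator\<close> then prevents \<open>poly q x\<close>
  from going to 0.\<close>

lemma separates_adjoin:
  fixes \<iota> :: "'k::alg_closed_field \<Rightarrow> 'a::comm_ring_1"
  assumes A: "subring A" and P: "prime_ideal P" and \<iota>: "range \<iota> \<subseteq> A"
    and sep: "separates P A \<iota> TYPE('k)"
  shows "separates P (adjoin A x) \<iota> TYPE('k)"
  unfolding separates_def
proof
  note cl = polys_over_closed[OF A]
  have idP: "is_ideal P" and pr: "\<And>a b. a * b \<in> P \<Longrightarrow> a \<in> P \<or> b \<in> P" and P1: "1 \<notin> P"
    using P by (auto simp: prime_ideal_def)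
  fix b assume b: "b \<in> adjoin A x - P"
  then obtain q where q: "q \<in> polys_over A" "b = poly q x" "poly q x \<notin> P" by (auto simp: adjoin_def)
  have main: "\<exists>\<phi> :: 'a \<Rightarrow> 'k. \<exists>s. hom_on A \<phi> \<and> (\<forall>c. \<phi> (\<iota> c) = c) \<and>
     (\<forall>q. q \<in> polys_over A \<longrightarrow> poly q x \<in> P \<longrightarrow> poly (map_poly \<phi> q) s = 0) \<and>
     poly (map_poly \<phi> q) s \<noteq> 0"
  proof (cases "\<forall>p\<in>polys_over A. poly p x \<in> P \<longrightarrow> (\<forall>i. coeff p i \<in> P)")
    case True
    obtain i where i: "coeff q i \<notin> P" using poly_in_ideal[OF idP] q(3) by blast
    then obtain \<phi> :: "'a \<Rightarrow> 'k" where \<phi>: "hom_on A \<phi>" "\<forall>y\<in>A \<inter> P. \<phi> y = 0" "\<forall>c. \<phi> (\<iota> c) = c"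
      "\<phi> (coeff q i) \<noteq> 0"
      using sep polys_over_coeff[OF q(1), of i] unfolding separates_def by blast
    have \<phi>0: "\<phi> 0 = 0" using \<phi>(1) by (simp add: hom_on_def)
    have "map_poly \<phi> q \<noteq> 0" using \<phi>(4) coeff_map_poly[of \<phi> q i] \<phi>0 by force
    then have "finite {s. poly (map_poly \<phi> q) s = 0}" by (rule poly_roots_finite)
    \<comment> \<open>An algebraically closed field is infinite: otherwise the product of all linear
      factors, plus 1, would have no root.\<close>
    moreover have "infinite (UNIV :: 'k set)"
    proof
      assume fin: "finite (UNIV :: 'k set)"
      define g :: "'k poly" where "g = (\<Prod>a\<in>UNIV. [:- a, 1:]) + 1"
      have "degree (\<Prod>a\<in>UNIV. [:- a, 1 :: 'k:]) = card (UNIV :: 'k set)"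
        by (subst degree_prod_eq_sum_degree) auto
      then have "degree g > 0" unfolding g_def using fin
        by (simp add: degree_add_eq_left card_gt_0_iff)
      then obtain a where "poly g a = 0" using alg_closed_imp_poly_has_root by blast
      moreover have "poly g a = 1" unfolding g_def using fin by (auto simp: poly_prod prod_zero_iff)
      ultimately show False by simp
    qed
    ultimately obtain s where s: "poly (map_poly \<phi> q) s \<noteq> 0"
      using ex_new_if_finite by blast
    have "poly (map_poly \<phi> p) s = 0" if "p \<in> polys_over A" "poly p x \<in> P" for p
    proof -
      have "map_poly \<phi> p = 0" using True that \<phi>(2) polys_over_coeff[OF that(1)]
        by (intro poly_eqI) (auto simp: coeff_map_poly \<phi>0)
      then show ?thesis by simp
    qed
    then show ?thesis using \<phi> s by blast
  next
    case False
    define J where "J = {p \<in> polys_over A. poly p x \<in> P}"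
    from False obtain g where g: "g \<in> J" "\<not> (\<forall>i. coeff g i \<in> P)" by (auto simp: J_def)
    have Jcut: "poly_cutoff (Suc n) p \<in> J" if p: "p \<in> J" "\<And>i. i > n \<Longrightarrow> coeff p i \<in> P" for p n
    proof -
      have "poly (p - poly_cutoff (Suc n) p) x \<in> P"
        using p(2) by (intro poly_in_ideal[OF idP]) (auto simp: coeff_poly_cutoff ideal_0[OF idP])
      moreover have "p \<in> polys_over A" "poly p x \<in> P" using p(1) by (auto simp: J_def)
      ultimately have "poly p x - poly (p - poly_cutoff (Suc n) p) x \<in> P"
        using ideal_diff[OF idP] by blast
      then show ?thesis using \<open>p \<in> polys_over A\<close> cl(7) by (simp add: J_def)
    qed
    have JA: "J \<subseteq> polys_over A" by (auto simp: J_def)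
    obtain p d where p: "p \<in> J" "coeff p d \<notin> P" "\<And>i. i > d \<Longrightarrow> coeff p i = 0"
      and min: "\<And>u. u \<in> J \<Longrightarrow> (\<And>i. i \<ge> d \<Longrightarrow> coeff u i \<in> P) \<Longrightarrow> \<forall>i. coeff u i \<in> P"
      using minimal_degree_element[OF A idP JA g Jcut] by blast
    have pA: "p \<in> polys_over A" "poly p x \<in> P" using p(1) by (auto simp: J_def)
    obtain c w where c: "c \<in> A" "c \<notin> P" "w \<in> adjoin A x" "c - w * poly q x \<in> P"
      using algebraic_denominator[OF A P pA p(2,3) _ q(1,3)] min unfolding J_def by blast
    \<comment> \<open>Both factors must survive: the leading coefficient keeps the image of
      \<open>p\<close> nonconstant and can be cancelled after pseudo-division, and \<open>c\<close>
      keeps the value of \<open>q\<close> nonzero.\<close>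
    have "c * coeff p d \<in> A - P" using c p(2) pr subring_mult[OF A] polys_over_coeff[OF pA(1)] by blast
    then obtain \<phi> :: "'a \<Rightarrow> 'k" where \<phi>: "hom_on A \<phi>" "\<forall>y\<in>A \<inter> P. \<phi> y = 0" "\<forall>c. \<phi> (\<iota> c) = c"
      "\<phi> (c * coeff p d) \<noteq> 0"
      using sep unfolding separates_def by blast
    have "\<phi> (c * coeff p d) = \<phi> c * \<phi> (coeff p d)"
      using \<phi>(1) c(1) polys_over_coeff[OF pA(1), of d] unfolding hom_on_def by blast
    then have \<phi>c: "\<phi> c \<noteq> 0" "\<phi> (coeff p d) \<noteq> 0" using \<phi>(4) by auto
    have \<phi>0: "\<phi> 0 = 0" using \<phi>(1) by (simp add: hom_on_def)
    have "d > 0"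
    proof (rule ccontr)
      assume "\<not> d > 0"
      then have "p = [:coeff p d:]" using p(3) by (intro poly_eqI) (auto simp: coeff_pCons split: nat.split)
      then have "poly p x = coeff p d" by (metis mult_zero_right poly_0 poly_pCons add_0_right)
      then show False using pA(2) p(2) by simp
    qed
    have "coeff (map_poly \<phi> p) d \<noteq> 0" using \<phi>c \<phi>0 by (simp add: coeff_map_poly)
    then have "degree (map_poly \<phi> p) > 0" using \<open>d > 0\<close> le_degree by fastforce
    then obtain s where s: "poly (map_poly \<phi> p) s = 0" using alg_closed_imp_poly_has_root by blast
    note map_poly_hom = map_poly_hom_on[OF A \<phi>(1)]
    \<comment> \<open>Pseudo-division by \<open>p\<close> leaves a remainder with value in
      \<open>P\<close> and degree below \<open>d\<close>, hence with all coefficients in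
      \<open>P\<close>, which \<open>\<phi>\<close> sends to 0. So up to a power of the leading
      coefficient the image of \<open>u\<close> is a multiple of the image of
      \<open>p\<close>.\<close>
    have kill: "poly (map_poly \<phi> u) s = 0" if u: "u \<in> polys_over A" "poly u x \<in> P" for u
    proof -
      obtain k t r where tr: "t \<in> polys_over A" "r \<in> polys_over A" "smult (coeff p d ^ k) u = p * t + r"
         "\<And>i. i \<ge> d \<Longrightarrow> coeff r i = 0"
        by (rule pseudo_division_over[OF A pA(1) p(3) u(1), of d]) (assumption, rule that)
      have "coeff p d ^ k * poly u x = poly p x * poly t x + poly r x"
        using arg_cong[OF tr(3), of "\<lambda>p. poly p x"] by simp
      then have "poly r x = coeff p d ^ k * poly u x - poly p x * poly t x" by simp
      then have "poly r x \<in> P"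
        using u(2) pA(2) ideal_diff[OF idP] ideal_mult_left[OF idP] ideal_mult_right[OF idP] by simp
      then have rP: "\<forall>i. coeff r i \<in> P" using min[of r] tr ideal_0[OF idP] by (auto simp: J_def)
      have r0: "map_poly \<phi> r = 0" using rP \<phi>(2) polys_over_coeff[OF tr(2)]
        by (intro poly_eqI) (auto simp: coeff_map_poly \<phi>0)
      have pk: "coeff p d ^ k \<in> A" using subring_power[OF A] polys_over_coeff[OF pA(1)] by blast
      have \<phi>pow: "\<phi> (coeff p d ^ k) = \<phi> (coeff p d) ^ k"
      proof (induction k)
        case (Suc k)
        then show ?case using \<phi>(1) subring_power[OF A] polys_over_coeff[OF pA(1)] by (simp add: hom_on_def)
      qed (use \<phi>(1) in \<open>simp add: hom_on_def\<close>)
      have "map_poly \<phi> ([:coeff p d ^ k:] * u) = map_poly \<phi> (p * t + r)" using tr(3) by simp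
      also have "\<dots> = map_poly \<phi> p * map_poly \<phi> t" using tr pA cl by (simp add: map_poly_hom r0)
      finally have "map_poly \<phi> [:coeff p d ^ k:] * map_poly \<phi> u = map_poly \<phi> p * map_poly \<phi> t"
        using map_poly_hom(2)[OF cl(8)[OF pk] u(1)] by simp
      then have "poly (map_poly \<phi> [:coeff p d ^ k:]) s * poly (map_poly \<phi> u) s = 0"
        using s by (metis mult_zero_left poly_mult)
      then show ?thesis using \<phi>c(2) by (simp add: map_poly_pCons \<phi>0 \<phi>pow)
    qed
    obtain \<phi>' where \<phi>': "hom_on (adjoin A x) \<phi>'" "\<And>y. y \<in> adjoin A x \<Longrightarrow> y \<in> P \<Longrightarrow> \<phi>' y = 0"
      "\<And>q. q \<in> polys_over A \<Longrightarrow> \<phi>' (poly q x) = poly (map_poly \<phi> q) s" "\<And>a. a \<in> A \<Longrightarrow> \<phi>' a = \<phi> a"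
      using extend_hom[OF A idP \<phi>(1) kill] by blast
    have B: "subring (adjoin A x)" by (rule subring_adjoin[OF A])
    have inB: "c \<in> adjoin A x" "poly q x \<in> adjoin A x" using c(1) adjoin_superset[OF A] q(1) by (auto simp: adjoin_def)
    then have wq: "w * poly q x \<in> adjoin A x" using c(3) subring_mult[OF B] by blast
    then have in2: "c - w * poly q x \<in> adjoin A x" using inB subring_diff[OF B] by blast
    have "\<phi>' c = \<phi>' ((c - w * poly q x) + w * poly q x)" by simp
    also have "\<dots> = \<phi>' w * \<phi>' (poly q x)"
      using \<phi>'(1) wq in2 inB c(3) \<phi>'(2)[OF in2 c(4)] unfolding hom_on_def by (metis add_0)
    finally have "poly (map_poly \<phi> q) s \<noteq> 0" using \<phi>c(1) \<phi>'(3)[OF q(1)] \<phi>'(4)[OF c(1)] by auto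
    then show ?thesis using \<phi> kill by blast
  qed
  then obtain \<phi> :: "'a \<Rightarrow> 'k" and s where \<phi>: "hom_on A \<phi>" "\<And>c. \<phi> (\<iota> c) = c"
     "\<And>q. q \<in> polys_over A \<Longrightarrow> poly q x \<in> P \<Longrightarrow> poly (map_poly \<phi> q) s = 0"
     "poly (map_poly \<phi> q) s \<noteq> 0" by blast
  show "\<exists>\<phi> :: 'a \<Rightarrow> 'k. hom_on (adjoin A x) \<phi> \<and> (\<forall>y\<in>adjoin A x \<inter> P. \<phi> y = 0) \<and> (\<forall>c. \<phi> (\<iota> c) = c) \<and> \<phi> b \<noteq> 0"
  proof (rule extend_hom[OF A idP \<phi>(1,3)])
    fix \<phi>' assume \<phi>': "hom_on (adjoin A x) \<phi>'" "\<And>y. y \<in> adjoin A x \<Longrightarrow> y \<in> P \<Longrightarrow> \<phi>' y = 0"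
      "\<And>q. q \<in> polys_over A \<Longrightarrow> \<phi>' (poly q x) = poly (map_poly \<phi> q) s" "\<And>a. a \<in> A \<Longrightarrow> \<phi>' a = \<phi> a"
    have "\<phi>' (\<iota> c) = c" for c using \<phi>'(4) \<phi>(2) \<iota> by (metis rangeI subsetD)
    then show ?thesis using \<phi>' \<phi>(4) q(1,2) by (intro exI[of _ \<phi>']) auto
  qed
qed

text \<open>Start of the induction: nonzero constants are units and therefore avoid
  \<open>P\<close>, so the inverse of \<open>\<iota>\<close> is the required homomorphism.\<close>

lemma separates_range:
  fixes \<iota> :: "'k::field \<Rightarrow> 'a::comm_ring_1"
  assumes P: "prime_ideal P" and \<iota>: "\<iota> 1 = 1" "\<And>a b. \<iota> (a + b) = \<iota> a + \<iota> b" "\<And>a b. \<iota> (a * b) = \<iota> a * \<iota> b"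
  shows "subring (range \<iota>)" "separates P (range \<iota>) \<iota> TYPE('k)"
proof -
  have P1: "1 \<notin> P" and idP: "is_ideal P" using P by (auto simp: prime_ideal_def)
  have \<iota>0: "\<iota> 0 = 0" using \<iota>(2)[of 0 0] by simp
  have \<iota>d: "\<iota> (a - b) = \<iota> a - \<iota> b" for a b using \<iota>(2)[of "a - b" b] by simp
  have kern: "c = 0" if "\<iota> c \<in> P" for c
  proof (rule ccontr)
    assume "c \<noteq> 0"
    then have "\<iota> (inverse c) * \<iota> c = 1" by (simp flip: \<iota>(3) add: \<iota>(1))
    then show False using ideal_mult_left[OF idP that, of "\<iota> (inverse c)"] P1 by simp
  qed
  have inj: "inj \<iota>"
  proof (rule injI)
    fix c d assume "\<iota> c = \<iota> d"
    then have "\<iota> (c - d) \<in> P" using ideal_0[OF idP] by (simp add: \<iota>d)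
    then show "c = d" using kern by fastforce
  qed
  show "subring (range \<iota>)" unfolding subring_def
  proof (intro conjI ballI)
    show "1 \<in> range \<iota>" by (rule range_eqI[of _ _ 1]) (simp add: \<iota>(1))
    fix a b assume "a \<in> range \<iota>" "b \<in> range \<iota>"
    then obtain c d where "a = \<iota> c" "b = \<iota> d" by blast
    then have "a - b = \<iota> (c - d)" "a * b = \<iota> (c * d)" by (simp_all add: \<iota> \<iota>d)
    then show "a - b \<in> range \<iota>" "a * b \<in> range \<iota>" by blast+
  qed
  define \<phi> where "\<phi> = inv \<iota>"
  have \<phi>: "\<phi> (\<iota> c) = c" for c using inj by (simp add: \<phi>_def)
  have "hom_on (range \<iota>) \<phi>" unfolding hom_on_def
  proof (intro conjI ballI)
    show "\<phi> 1 = 1" "\<phi> 0 = 0" using \<phi>[of 1] \<phi>[of 0] \<iota>(1) \<iota>0 by simp_all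
    fix a b assume "a \<in> range \<iota>" "b \<in> range \<iota>"
    then obtain c d where cd: "a = \<iota> c" "b = \<iota> d" by blast
    show "\<phi> (a + b) = \<phi> a + \<phi> b" "\<phi> (a * b) = \<phi> a * \<phi> b"
      by (simp_all add: cd \<phi> \<iota>(2,3)[symmetric])
  qed
  moreover have "\<forall>y\<in>range \<iota> \<inter> P. \<phi> y = 0" using kern \<phi> by auto
  ultimately show "separates P (range \<iota>) \<iota> TYPE('k)" unfolding separates_def
  proof (intro ballI exI[of _ \<phi>] conjI allI)
    fix b assume "b \<in> range \<iota> - P"
    then obtain c where c: "b = \<iota> c" "\<iota> c \<notin> P" by blast
    then have "c \<noteq> 0" using ideal_0[OF idP] \<iota>0 by auto
    then show "\<phi> b \<noteq> 0" by (simp add: c \<phi>)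
  qed (simp_all add: \<phi>)
qed

text \<open>Adjoins the elements of \<open>X\<close> one by one; \<open>gen\<close> expresses that
  they generate the whole ring over the constants.\<close>

lemma hom_to_alg_closed_field:
  fixes \<iota> :: "'k::alg_closed_field \<Rightarrow> 'a::comm_ring_1"
  assumes P: "prime_ideal P" and \<iota>: "\<iota> 1 = 1" "\<And>a b. \<iota> (a + b) = \<iota> a + \<iota> b" "\<And>a b. \<iota> (a * b) = \<iota> a * \<iota> b"
    and X: "finite X" and gen: "\<And>A. subring A \<Longrightarrow> range \<iota> \<subseteq> A \<Longrightarrow> X \<subseteq> A \<Longrightarrow> A = UNIV"
    and b: "b \<notin> P"
  obtains \<phi> :: "'a \<Rightarrow> 'k" where "hom_on UNIV \<phi>" "\<And>y. y \<in> P \<Longrightarrow> \<phi> y = 0" "\<And>c. \<phi> (\<iota> c) = c" "\<phi> b \<noteq> 0"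
proof -
  have "\<exists>A. subring A \<and> range \<iota> \<subseteq> A \<and> X \<subseteq> A \<and> separates P A \<iota> TYPE('k)"
    using X
  proof (induction X rule: finite_induct)
    case empty
    then show ?case using separates_range[OF P \<iota>] by auto
  next
    case (insert x F)
    then obtain A where A: "subring A" "range \<iota> \<subseteq> A" "F \<subseteq> A" "separates P A \<iota> TYPE('k)" by blast
    have "range \<iota> \<subseteq> adjoin A x" "insert x F \<subseteq> adjoin A x"
      using A adjoin_superset[OF A(1), of x] adjoin_self[OF A(1), of x] by blast+
    then show ?case using subring_adjoin[OF A(1), of x] separates_adjoin[OF A(1) P A(2,4), of x] by blast
  qed
  then have "separates P UNIV \<iota> TYPE('k)" using gen by metis
  then show thesis using b that unfolding separates_def by (metis DiffI IntI UNIV_I)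
qed

section \<open>The polynomial ring: evaluation and bases modulo a subspace\<close>

lemma cox_ring_expand:
  "f = (\<Sum>c\<in>Poly_Mapping.keys f. Poly_Mapping.single c (Poly_Mapping.lookup f c))"
proof (rule poly_mapping_eqI)
  fix d
  show "Poly_Mapping.lookup f d =
    Poly_Mapping.lookup (\<Sum>c\<in>Poly_Mapping.keys f. Poly_Mapping.single c (Poly_Mapping.lookup f c)) d"
    by (simp add: lookup_sum lookup_single when_def sum.delta in_keys_iff)
qed

lemma cox_ring_induct [case_names zero single add]:
  assumes "P 0" "\<And>c a. P (Poly_Mapping.single c a)" "\<And>f g. P f \<Longrightarrow> P g \<Longrightarrow> P (f + g)"
  shows "P (f :: ('r, 'k::field) cox_ring)"
proof -
  have "P (\<Sum>c\<in>C. Poly_Mapping.single c (h c))" for C :: "('r \<Rightarrow>\<^sub>0 nat) set" and h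
    by (induction C rule: infinite_finite_induct) (auto intro: assms)
  then show ?thesis using cox_ring_expand[of f] by metis
qed

definition monom_eval :: "('r::finite \<Rightarrow>\<^sub>0 nat) \<Rightarrow> 'k::field ^ 'r \<Rightarrow> 'k" where
  "monom_eval c x = (\<Prod>j\<in>UNIV. x $ j ^ Poly_Mapping.lookup c j)"

lemma cox_eval_superset:
  assumes "finite C" "Poly_Mapping.keys f \<subseteq> C"
  shows "cox_eval f x = (\<Sum>c\<in>C. Poly_Mapping.lookup f c * monom_eval c x)"
  unfolding cox_eval_def monom_eval_def using assms
  by (intro sum.mono_neutral_left) (auto simp: in_keys_iff)

lemma cox_eval_single [simp]: "cox_eval (Poly_Mapping.single c a) x = a * monom_eval c x"
  by (subst cox_eval_superset[of "{c}"]) auto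

lemma cox_eval_0 [simp]: "cox_eval 0 x = 0"
  by (simp add: cox_eval_def)

lemma cox_eval_add [simp]: "cox_eval (f + g) x = cox_eval f x + cox_eval g x"
proof -
  define C where "C = Poly_Mapping.keys f \<union> Poly_Mapping.keys g"
  have "finite C" "Poly_Mapping.keys f \<subseteq> C" "Poly_Mapping.keys g \<subseteq> C" "Poly_Mapping.keys (f + g) \<subseteq> C"
    using keys_add[of f g] by (auto simp: C_def)
  then show ?thesis
    by (simp add: cox_eval_superset[of C] lookup_add sum.distrib distrib_right)
qed

lemma monom_eval_add: "monom_eval (c + d) x = monom_eval c x * monom_eval d x"
  by (simp add: monom_eval_def lookup_add power_add prod.distrib)

lemma monom_eval_0 [simp]: "monom_eval 0 x = 1"
  by (simp add: monom_eval_def)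

lemma cox_eval_mult [simp]: "cox_eval (f * g) x = cox_eval f x * cox_eval g x"
proof (induction f rule: cox_ring_induct)
  case (single c a)
  show ?case
    by (induction g rule: cox_ring_induct)
      (simp_all add: mult_single monom_eval_add distrib_left)
qed (simp_all add: distrib_right)

lemma cox_eval_1 [simp]: "cox_eval 1 x = 1"
  by (simp flip: single_one)

lemma cox_eval_const [simp]: "cox_eval (cox_const a) x = a"
  by (simp add: cox_const_def)

lemma cox_eval_var [simp]: "cox_eval (cox_var j) x = x $ j"
  by (simp add: cox_var_def monom_eval_def lookup_single when_def prod.delta if_distrib[of "\<lambda>n. _ ^ n"] cong: if_cong)

lemma cox_eval_sum [simp]: "cox_eval (sum f A) x = (\<Sum>a\<in>A. cox_eval (f a) x)"
  by (induction A rule: infinite_finite_induct) auto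

lemma cox_eval_prod [simp]: "cox_eval (prod f A) x = (\<Prod>a\<in>A. cox_eval (f a) x)"
  by (induction A rule: infinite_finite_induct) auto

lemma cox_eval_diff [simp]: "cox_eval (f - g) x = cox_eval f x - cox_eval g x"
  using cox_eval_add[of "f - g" g x] by simp

lemma cox_const_hom:
  "cox_const 1 = 1" "cox_const 0 = 0" "cox_const (a + b) = cox_const a + cox_const b"
  "cox_const (a * b) = cox_const a * cox_const b"
  by (simp_all add: cox_const_def single_add mult_single)

lemma single_in_subring:
  fixes A :: "('r::finite, 'k::field) cox_ring set"
  assumes A: "subring A" and "range cox_const \<subseteq> A" "range cox_var \<subseteq> A"
  shows "Poly_Mapping.single c a \<in> A"
proof -
  have pw: "cox_var j ^ n = Poly_Mapping.single (Poly_Mapping.single j n) (1::'k)" for j :: 'r and n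
    by (induction n) (simp_all add: cox_var_def mult_single flip: single_add)
  have pr: "(\<Prod>j\<in>J. cox_var j ^ n j) = Poly_Mapping.single (\<Sum>j\<in>J. Poly_Mapping.single j (n j)) (1::'k)"
    for J :: "'r set" and n
    by (induction J rule: infinite_finite_induct) (simp_all add: pw mult_single)
  have "c = (\<Sum>j\<in>UNIV. Poly_Mapping.single j (Poly_Mapping.lookup c j))"
    by (rule poly_mapping_eqI) (simp add: lookup_sum lookup_single when_def sum.delta)
  then have "Poly_Mapping.single c (1::'k) = (\<Prod>j\<in>UNIV. cox_var j ^ Poly_Mapping.lookup c j)"
    using pr[of "Poly_Mapping.lookup c" UNIV] by simp
  moreover have "(\<Prod>j\<in>J. cox_var j ^ n j) \<in> A" for J :: "'r set" and n
    using assms(3) by (induction J rule: infinite_finite_induct)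
      (auto intro!: subring_1[OF A] subring_mult[OF A] subring_power[OF A])
  ultimately have "Poly_Mapping.single c (1::'k) \<in> A" by simp
  then have "cox_const a * Poly_Mapping.single c (1::'k) \<in> A" using assms by (intro subring_mult[OF A]) auto
  then show ?thesis by (simp add: cox_const_def mult_single)
qed

lemma cox_ring_generated:
  fixes A :: "('r::finite, 'k::field) cox_ring set"
  assumes A: "subring A" and "range cox_const \<subseteq> A" "range cox_var \<subseteq> A"
  shows "A = UNIV"
proof -
  have "f \<in> A" for f
    by (induction f rule: cox_ring_induct)
      (auto intro: subring_0[OF A] subring_add[OF A] single_in_subring[OF assms])
  then show ?thesis by blast
qed

text \<open>A homomorphism to the field that fixes the constants is evaluation at the point formed
  by its values on the variables. Applied to a prime ideal over \<open>I\<close> that avoids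
  \<open>f\<close>, this yields a zero of \<open>I\<close> at which \<open>f\<close> does not
  vanish.\<close>

theorem nullstellensatz:
  fixes I :: "('r::finite, 'k::alg_closed_field) cox_ring set"
  assumes I: "radical_ideal I" and f: "\<And>x. x \<in> zero_set I \<Longrightarrow> cox_eval f x = 0"
  shows "f \<in> I"
proof (rule ccontr)
  assume "f \<notin> I"
  then have "f ^ k \<notin> I" for k using I by (auto simp: radical_ideal_def)
  then obtain P where P: "prime_ideal P" "I \<subseteq> P" "f \<notin> P"
    using prime_ideal_avoiding[of I f] I by (auto simp: radical_ideal_def)
  obtain \<phi> :: "('r, 'k) cox_ring \<Rightarrow> 'k" where \<phi>: "hom_on UNIV \<phi>" "\<And>y. y \<in> P \<Longrightarrow> \<phi> y = 0"
    "\<And>c. \<phi> (cox_const c) = c" "\<phi> f \<noteq> 0"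
    using hom_to_alg_closed_field[OF P(1) cox_const_hom(1,3,4), of "range cox_var" f]
      cox_ring_generated P(3) by (metis finite finite_imageI)
  define x :: "'k ^ 'r" where "x = (\<chi> j. \<phi> (cox_var j))"
  define A where "A = {g. \<phi> g = cox_eval g x}"
  have hom: "\<phi> (a + b) = \<phi> a + \<phi> b" "\<phi> (a * b) = \<phi> a * \<phi> b" "\<phi> 1 = 1" for a b
    using \<phi>(1) by (auto simp: hom_on_def)
  have "\<phi> (a - b) = \<phi> a - \<phi> b" for a b using hom(1)[of "a - b" b] by simp
  then have "subring A" by (simp add: subring_def A_def hom)
  moreover have "range cox_const \<subseteq> A" "range cox_var \<subseteq> A" by (auto simp: A_def \<phi>(3) x_def)
  ultimately have "A = UNIV" by (rule cox_ring_generated)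
  then have ev: "\<phi> g = cox_eval g x" for g by (auto simp: A_def)
  have "x \<in> zero_set I" unfolding zero_set_def using P(2) \<phi>(2) by (auto simp flip: ev)
  then show False using f \<phi>(4) ev by simp
qed

section \<open>Linear algebra modulo a subspace\<close>

interpretation cox: vector_space "\<lambda>c f. cox_const c * f :: ('r, 'k::field) cox_ring"
  by unfold_locales (simp_all add: cox_const_hom algebra_simps)

definition indep_modulo :: "('r, 'k::field) cox_ring set \<Rightarrow> ('r, 'k) cox_ring set \<Rightarrow> bool" where
  "indep_modulo W E \<longleftrightarrow>
     (\<forall>c. (\<Sum>e\<in>E. cox_const (c e) * e) \<in> W \<longrightarrow> (\<forall>e\<in>E. c e = 0))"

text \<open>Steinitz exchange modulo \<open>W\<close>: the errors \<open>w e\<close> of the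
  approximations lie in \<open>W\<close>. For a basis \<open>B\<close> of their span,
  \<open>E \<union> B\<close> is independent and lies in the span of \<open>G \<union> B\<close>,
  and the cardinality of \<open>B\<close> cancels.\<close>

lemma card_le_if_indep_modulo:
  assumes W: "cox.subspace W" and fin: "finite E" "finite G" and ind: "indep_modulo W E"
    and sp: "\<And>e. e \<in> E \<Longrightarrow> \<exists>c. e - (\<Sum>g\<in>G. cox_const (c g) * g) \<in> W"
  shows "card E \<le> card G"
proof -
  have "\<exists>c. \<forall>e\<in>E. e - (\<Sum>g\<in>G. cox_const (c e g) * g) \<in> W" using sp by (intro bchoice) blast
  then obtain c where c: "\<And>e. e \<in> E \<Longrightarrow> e - (\<Sum>g\<in>G. cox_const (c e g) * g) \<in> W" by blast
  define w where "w e = e - (\<Sum>g\<in>G. cox_const (c e g) * g)" for e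
  obtain B where B: "B \<subseteq> w ` E" "cox.independent B" "w ` E \<subseteq> cox.span B"
    using cox.maximal_independent_subset by metis
  have finB: "finite B" using B(1) fin(1) by (metis finite_imageI finite_subset)
  have BW: "cox.span B \<subseteq> W" using B(1) c W by (intro cox.span_minimal) (auto simp: w_def)
  have "cox.independent (E \<union> B) \<and> E \<inter> B = {}"
  proof
    show disj: "E \<inter> B = {}"
    proof (rule ccontr)
      assume "E \<inter> B \<noteq> {}"
      then obtain e where e: "e \<in> E" "e \<in> W" using BW cox.span_base by blast
      have "(\<Sum>x\<in>E. cox_const (if x = e then 1 else 0) * x) = (\<Sum>x\<in>E. if x = e then x else 0)"
        by (rule sum.cong) (auto simp: cox_const_hom)
      then have "(\<Sum>x\<in>E. cox_const (if x = e then 1 else 0) * x) \<in> W" using e fin by (simp add: sum.delta')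
      from ind[unfolded indep_modulo_def, rule_format, OF this e(1)] show False by simp
    qed
    show "cox.independent (E \<union> B)"
    proof (rule cox.independent_if_scalars_zero)
      show "finite (E \<union> B)" using fin finB by simp
      fix u x assume u: "(\<Sum>x\<in>E \<union> B. cox_const (u x) * x) = 0" and x: "x \<in> E \<union> B"
      have "(\<Sum>x\<in>E. cox_const (u x) * x) + (\<Sum>x\<in>B. cox_const (u x) * x) = 0"
        using u by (simp add: sum.union_disjoint[OF fin(1) finB disj])
      then have eq: "(\<Sum>x\<in>E. cox_const (u x) * x) = - (\<Sum>x\<in>B. cox_const (u x) * x)"
        by (simp add: add_eq_0_iff2)
      have "(\<Sum>x\<in>B. cox_const (u x) * x) \<in> W"
        using BW cox.span_base by (intro cox.subspace_sum[OF W] cox.subspace_scale[OF W]) blast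
      then have "(\<Sum>x\<in>E. cox_const (u x) * x) \<in> W" unfolding eq by (rule cox.subspace_neg[OF W])
      then have uE: "\<forall>e\<in>E. u e = 0" using ind by (simp add: indep_modulo_def)
      then have "(\<Sum>x\<in>B. cox_const (u x) * x) = 0" using eq by (simp add: cox_const_hom)
      then have "\<forall>x\<in>B. u x = 0" using B(2) finB cox.independentD by blast
      then show "u x = 0" using x uE by blast
    qed
  qed
  moreover have "E \<union> B \<subseteq> cox.span (G \<union> B)"
  proof
    fix x assume "x \<in> E \<union> B"
    then show "x \<in> cox.span (G \<union> B)"
    proof
      assume x: "x \<in> E"
      have "w x \<in> cox.span (G \<union> B)" using x B(3) cox.span_mono[of B "G \<union> B"] by blast
      moreover have "(\<Sum>g\<in>G. cox_const (c x g) * g) \<in> cox.span (G \<union> B)"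
        by (intro cox.span_sum cox.span_scale cox.span_base) blast
      ultimately have "w x + (\<Sum>g\<in>G. cox_const (c x g) * g) \<in> cox.span (G \<union> B)" by (rule cox.span_add)
      then show ?thesis by (simp add: w_def)
    qed (simp add: cox.span_base)
  qed
  ultimately have "card (E \<union> B) \<le> card (G \<union> B)"
    using cox.independent_span_bound[of "G \<union> B" "E \<union> B"] fin finB by simp
  then show ?thesis
    using \<open>cox.independent (E \<union> B) \<and> E \<inter> B = {}\<close> card_Un_disjoint[OF fin(1) finB] card_Un_le[of G B] by simp
qed

lemma basis_modulo_iff:
  "basis_modulo W V E \<longleftrightarrow> finite E \<and> E \<subseteq> V \<and>
     (\<forall>f\<in>V. \<exists>c. f - (\<Sum>e\<in>E. cox_const (c e) * e) \<in> W) \<and> indep_modulo W E"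
  by (simp add: basis_modulo_def indep_modulo_def)

lemma basis_modulo_card_unique:
  assumes "cox.subspace W" "basis_modulo W V E" "basis_modulo W V G"
  shows "card E = card G"
  using card_le_if_indep_modulo[OF assms(1), of E G] card_le_if_indep_modulo[OF assms(1), of G E] assms(2,3)
  by (auto simp: basis_modulo_iff subset_eq intro!: antisym)

lemma combination_add:
  "(\<Sum>e\<in>E. cox_const (c e + d e) * e) = (\<Sum>e\<in>E. cox_const (c e) * e) + (\<Sum>e\<in>E. cox_const (d e) * e)"
  by (simp add: cox_const_hom distrib_right sum.distrib)

lemma combination_scale:
  "(\<Sum>e\<in>E. cox_const (a * c e) * e) = cox_const a * (\<Sum>e\<in>E. cox_const (c e) * e)"
  by (simp add: sum_distrib_left)

lemma subspace_spanned_modulo: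
  assumes W: "cox.subspace W"
  shows "cox.subspace {f. \<exists>c. f - (\<Sum>e\<in>E. cox_const (c e) * e) \<in> W}" (is "cox.subspace ?U")
proof (rule cox.subspaceI)
  show "0 \<in> ?U" using cox.subspace_0[OF W] by (auto simp: cox_const_hom intro!: exI[of _ "\<lambda>_. 0"])
  fix x y assume "x \<in> ?U" "y \<in> ?U"
  then obtain c d where "x - (\<Sum>e\<in>E. cox_const (c e) * e) \<in> W" "y - (\<Sum>e\<in>E. cox_const (d e) * e) \<in> W"
    by blast
  from cox.subspace_add[OF W this] have "x + y - (\<Sum>e\<in>E. cox_const (c e + d e) * e) \<in> W"
    by (simp only: combination_add add_diff_add)
  then show "x + y \<in> ?U" by (auto intro!: exI[of _ "\<lambda>e. c e + d e"])
next
  fix a x assume "x \<in> ?U"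
  then obtain c where "x - (\<Sum>e\<in>E. cox_const (c e) * e) \<in> W" by blast
  from cox.subspace_scale[OF W this, of a] have "cox_const a * x - (\<Sum>e\<in>E. cox_const (a * c e) * e) \<in> W"
    by (simp add: combination_scale right_diff_distrib)
  then show "cox_const a * x \<in> ?U" by (auto intro!: exI[of _ "\<lambda>e. a * c e"])
qed

lemma basis_modulo_exists:
  assumes W: "cox.subspace W" and M: "finite M" "M \<subseteq> V" "V \<subseteq> cox.span M"
  obtains E where "basis_modulo W V E" "E \<subseteq> M"
proof -
  define F where "F = {E. E \<subseteq> M \<and> indep_modulo W E}"
  have finF: "finite F" using M(1) by (simp add: F_def)
  have "{} \<in> F" by (simp add: F_def indep_modulo_def)
  then have "Max (card ` F) \<in> card ` F" using finF by (intro Max_in) auto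
  then obtain E where E: "E \<in> F" and "card E = Max (card ` F)" by auto
  then have max: "card G \<le> card E" if "G \<in> F" for G using that finF by simp
  have EM: "E \<subseteq> M" "indep_modulo W E" "finite E" using E M(1) by (auto simp: F_def intro: finite_subset)
  define U where "U = {f. \<exists>c. f - (\<Sum>e\<in>E. cox_const (c e) * e) \<in> W}"
  have U: "cox.subspace U" unfolding U_def by (rule subspace_spanned_modulo[OF W])
  have "m \<in> U" if m: "m \<in> M" for m
  proof (cases "m \<in> E")
    case True
    have "(\<Sum>x\<in>E. cox_const (if x = m then 1 else 0) * x) = (\<Sum>x\<in>E. if x = m then x else 0)"
      by (rule sum.cong) (auto simp: cox_const_hom)
    then have "m - (\<Sum>x\<in>E. cox_const (if x = m then 1 else 0) * x) \<in> W"
      using True EM(3) cox.subspace_0[OF W] by (simp add: sum.delta')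
    then show ?thesis unfolding U_def mem_Collect_eq by (rule exI[of _ "\<lambda>x. if x = m then 1 else 0"])
  next
    case False
    have "insert m E \<notin> F" using max[of "insert m E"] False EM(3) by auto
    then have "\<not> indep_modulo W (insert m E)" using m EM(1) by (auto simp: F_def)
    then obtain c where c: "(\<Sum>e\<in>insert m E. cox_const (c e) * e) \<in> W" "\<exists>e\<in>insert m E. c e \<noteq> 0"
      unfolding indep_modulo_def by blast
    have c': "cox_const (c m) * m + (\<Sum>e\<in>E. cox_const (c e) * e) \<in> W" using c(1) False EM(3) by simp
    have cm: "c m \<noteq> 0"
    proof
      assume z: "c m = 0"
      then have "(\<Sum>e\<in>E. cox_const (c e) * e) \<in> W" using c' by (simp add: cox_const_hom)
      then show False using EM(2) c(2) z unfolding indep_modulo_def by blast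
    qed
    have inv: "cox_const (inverse (c m)) * (cox_const (c m) * m) = m" using cm by (simp add: cox_const_hom(1))
    have neg: "cox_const (- a) = - cox_const a" for a by (simp add: cox_const_def single_uminus)
    have "cox_const (inverse (c m)) * (cox_const (c m) * m + (\<Sum>e\<in>E. cox_const (c e) * e))
       = m - (\<Sum>e\<in>E. cox_const (- inverse (c m) * c e) * e)"
      unfolding combination_scale distrib_left inv neg by simp
    then have "m - (\<Sum>e\<in>E. cox_const (- inverse (c m) * c e) * e) \<in> W"
      using cox.subspace_scale[OF W c', of "inverse (c m)"] by simp
    then show ?thesis unfolding U_def mem_Collect_eq by (rule exI[of _ "\<lambda>e. - inverse (c m) * c e"])
  qed
  then have "V \<subseteq> U" using cox.span_minimal[of M U] U M(3) by blast
  then have "basis_modulo W V E" using EM M(2) unfolding basis_modulo_iff U_def by blast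
  then show thesis using that EM(1) by blast
qed

section \<open>Grading and Hilbert functions\<close>

lemma sum_Pow_insert:
  assumes "finite A" "x \<notin> A"
  shows "(\<Sum>B\<in>Pow (insert x A). f B) = (\<Sum>B\<in>Pow A. f B) + (\<Sum>B\<in>Pow A. f (insert x B))"
proof -
  have inj: "inj_on (insert x) (Pow A)" using assms(2) by (intro inj_onI) (auto simp: insert_ident)
  have "(\<Sum>B\<in>Pow (insert x A). f B) = (\<Sum>B\<in>Pow A \<union> insert x ` Pow A. f B)" by (simp add: Pow_insert)
  also have "\<dots> = (\<Sum>B\<in>Pow A. f B) + (\<Sum>B\<in>insert x ` Pow A. f B)"
    using assms by (intro sum.union_disjoint) auto
  finally show ?thesis by (simp add: sum.reindex[OF inj])
qed

lemma combination_single: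
  assumes "finite E" "e \<in> E"
  shows "(\<Sum>x\<in>E. cox_const (if x = e then a else 0) * x) = cox_const a * (e :: ('r, 'k::field) cox_ring)"
proof -
  have "(\<Sum>x\<in>E. cox_const (if x = e then a else 0) * x) = (\<Sum>x\<in>E. if x = e then cox_const a * x else 0)"
    by (rule sum.cong) (auto simp: cox_const_hom)
  then show ?thesis using assms by (simp add: sum.delta')
qed

lemma indep_moduloD:
  "indep_modulo W E \<Longrightarrow> (\<Sum>e\<in>E. cox_const (c e) * e) \<in> W \<Longrightarrow> e \<in> E \<Longrightarrow> c e = 0"
  by (simp add: indep_modulo_def)

lemma indep_modulo_not_mem:
  assumes "indep_modulo W E" "finite E" "e \<in> E"
  shows "e \<notin> W"
proof
  assume "e \<in> W"
  then have "(\<Sum>x\<in>E. cox_const (if x = e then 1 else 0) * x) \<in> W"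
    by (simp add: combination_single[OF assms(2,3)] cox_const_hom)
  from assms(1)[unfolded indep_modulo_def, rule_format, OF this assms(3)] show False by simp
qed

lemma indep_modulo_diff_mem:
  assumes "indep_modulo W E" "finite E" "e \<in> E" "e' \<in> E" "e - e' \<in> W"
  shows "e = e'"
proof (rule ccontr)
  assume ne: "e \<noteq> e'"
  have "(\<Sum>x\<in>E. cox_const ((if x = e then 1 else 0) + (if x = e' then - 1 else 0)) * x) = e - e'"
    by (simp only: combination_add combination_single[OF assms(2,3)] combination_single[OF assms(2,4)])
       (simp add: cox_const_def single_uminus)
  then have "(\<Sum>x\<in>E. cox_const ((if x = e then 1 else 0) + (if x = e' then - 1 else 0)) * x) \<in> W"
    using assms(5) by simp
  from assms(1)[unfolded indep_modulo_def, rule_format, OF this assms(3)] ne show False by simp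
qed

lemma ideal_subspace: "is_ideal I \<Longrightarrow> cox.subspace I"
  by (auto simp: is_ideal_iff cox.subspace_def)

section \<open>Exponent vectors, principal divisors and divisor classes\<close>

definition expo :: "('r::finite \<Rightarrow>\<^sub>0 nat) \<Rightarrow> int ^ 'r" where
  "expo c = (\<chi> j. int (Poly_Mapping.lookup c j))"

lemma expo_add: "expo (c + d) = expo c + expo d"
  by (simp add: expo_def vec_eq_iff lookup_add)

lemma expo_0 [simp]: "expo 0 = 0"
  by (simp add: expo_def vec_eq_iff)

lemma expo_nth [simp]: "expo c $ j = int (Poly_Mapping.lookup c j)"
  by (simp add: expo_def)

lemma expo_inj: "expo c = expo d \<longleftrightarrow> c = d"
  by (auto simp: expo_def vec_eq_iff intro!: poly_mapping_eqI)

lemma expo_surj: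
  assumes "\<And>j. 0 \<le> a $ j"
  obtains c where "expo c = a"
proof -
  have "Poly_Mapping.lookup (Abs_poly_mapping (\<lambda>j. nat (a $ j))) j = nat (a $ j)" for j
    by (subst lookup_Abs_poly_mapping) auto
  then have "expo (Abs_poly_mapping (\<lambda>j. nat (a $ j))) = a"
    using assms by (simp add: expo_def vec_eq_iff)
  then show thesis using that by blast
qed

definition char_div :: "('r::finite \<Rightarrow> int ^ 'n) \<Rightarrow> int ^ 'n \<Rightarrow> int ^ 'r" where
  "char_div v m = (\<chi> j. pairing m (v j))"

lemma char_div_nth [simp]: "char_div v m $ j = pairing m (v j)"
  by (simp add: char_div_def)

lemma pairing_add: "pairing (m + m') u = pairing m u + pairing m' u"
  and pairing_diff: "pairing (m - m') u = pairing m u - pairing m' u"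
  and pairing_0 [simp]: "pairing 0 u = 0"
  by (simp_all add: pairing_def algebra_simps sum.distrib sum_subtractf sum_negf)

lemma char_div_diff: "char_div v (m - m') = char_div v m - char_div v m'"
  and char_div_0: "char_div v 0 = 0"
  by (simp_all add: vec_eq_iff pairing_diff pairing_add)

lemma principal_divisors_eq: "principal_divisors v = range (char_div v)"
  by (simp add: principal_divisors_def char_div_def[abs_def])

lemma principal_0 [simp]: "0 \<in> principal_divisors v"
  unfolding principal_divisors_eq by (rule range_eqI[of _ _ 0]) (simp add: char_div_0)

lemma principal_diff: "a \<in> principal_divisors v \<Longrightarrow> b \<in> principal_divisors v \<Longrightarrow> a - b \<in> principal_divisors v"
  unfolding principal_divisors_eq by (metis (no_types) char_div_diff rangeE rangeI)

lemma principal_uminus: "a \<in> principal_divisors v \<Longrightarrow> - a \<in> principal_divisors v"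
  using principal_diff[of 0 v a] by simp

lemma principal_add: "a \<in> principal_divisors v \<Longrightarrow> b \<in> principal_divisors v \<Longrightarrow> a + b \<in> principal_divisors v"
  using principal_diff[of a v "- b"] principal_uminus[of b v] by simp

lemma mem_div_class: "x \<in> div_class v a \<longleftrightarrow> x - a \<in> principal_divisors v"
  by (auto simp: div_class_def elt_set_plus_def algebra_simps intro!: bexI[of _ "x - a"])

lemma div_class_eq_iff: "div_class v a = div_class v b \<longleftrightarrow> a - b \<in> principal_divisors v"
proof
  assume "div_class v a = div_class v b"
  then have "a \<in> div_class v b" by (metis mem_div_class diff_self principal_0)
  then show "a - b \<in> principal_divisors v" by (simp add: mem_div_class)
next
  assume ab: "a - b \<in> principal_divisors v"
  have "x - a \<in> principal_divisors v \<longleftrightarrow> x - b \<in> principal_divisors v" for x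
    using principal_add[OF _ ab, of "x - a"] principal_diff[OF _ ab, of "x - b"] by auto
  then show "div_class v a = div_class v b" by (auto simp: mem_div_class)
qed

lemma div_class_mem: "x \<in> div_class v a \<Longrightarrow> div_class v x = div_class v a"
  by (simp add: mem_div_class div_class_eq_iff)

lemma div_class_plus: "div_class v a + div_class v b = div_class v (a + b)"
proof (rule set_eqI)
  fix x
  show "x \<in> div_class v a + div_class v b \<longleftrightarrow> x \<in> div_class v (a + b)"
  proof
    assume "x \<in> div_class v a + div_class v b"
    then obtain p q where "x = p + q" "p - a \<in> principal_divisors v" "q - b \<in> principal_divisors v"
      by (auto simp: set_plus_def mem_div_class)
    then show "x \<in> div_class v (a + b)"
      using principal_add[of "p - a" v "q - b"] by (simp add: mem_div_class algebra_simps)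
  next
    assume "x \<in> div_class v (a + b)"
    then have "x - b \<in> div_class v a" by (simp add: mem_div_class algebra_simps)
    moreover have "b \<in> div_class v b" by (simp add: mem_div_class)
    ultimately show "x \<in> div_class v a + div_class v b" by (metis diff_add_cancel set_plus_intro)
  qed
qed

text \<open>Degrees are handled through representing divisors, because these can be subtracted as
  vectors, whereas on classes, which are sets, the minus sign means set difference.\<close>

abbreviation forms :: "('r::finite \<Rightarrow> int ^ 'n) \<Rightarrow> int ^ 'r \<Rightarrow> ('r, 'k::field) cox_ring set" where
  "forms v a \<equiv> graded_part v (div_class v a)"

lemma mem_forms: "f \<in> forms v a \<longleftrightarrow> (\<forall>c\<in>Poly_Mapping.keys f. expo c - a \<in> principal_divisors v)"
  by (simp add: graded_part_def div_class_eq_iff flip: expo_def)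

lemma forms_subspace:
  fixes v :: "'r::finite \<Rightarrow> int ^ 'n"
  shows "cox.subspace (forms v a :: ('r, 'k::field) cox_ring set)"
proof (rule cox.subspaceI)
  show "0 \<in> (forms v a :: ('r, 'k) cox_ring set)" by (simp add: mem_forms)
  fix f g :: "('r, 'k) cox_ring" assume "f \<in> forms v a" "g \<in> forms v a"
  then show "f + g \<in> forms v a" using keys_add[of f g] by (auto simp: mem_forms)
next
  fix k and f :: "('r, 'k) cox_ring" assume "f \<in> forms v a"
  moreover have "Poly_Mapping.keys (cox_const k * f) \<subseteq> Poly_Mapping.keys f"
    using keys_mult[of "cox_const k" f] by (auto simp: cox_const_def split: if_splits)
  ultimately show "cox_const k * f \<in> forms v a" by (auto simp: mem_forms)
qed

lemma forms_mult: "f \<in> forms v a \<Longrightarrow> g \<in> forms v b \<Longrightarrow> f * g \<in> forms v (a + b)"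
  unfolding mem_forms
proof
  fix c assume f: "\<forall>c\<in>Poly_Mapping.keys f. expo c - a \<in> principal_divisors v"
    and g: "\<forall>c\<in>Poly_Mapping.keys g. expo c - b \<in> principal_divisors v"
    and "c \<in> Poly_Mapping.keys (f * g)"
  then obtain d e where de: "c = d + e" "d \<in> Poly_Mapping.keys f" "e \<in> Poly_Mapping.keys g"
    using keys_mult[of f g] by blast
  then have "(expo d - a) + (expo e - b) \<in> principal_divisors v" using f g principal_add by blast
  then show "expo c - (a + b) \<in> principal_divisors v" by (simp add: de(1) expo_add algebra_simps)
qed

lemma forms_single [simp]: "expo c - a \<in> principal_divisors v \<Longrightarrow> Poly_Mapping.single c k \<in> forms v a"
  by (simp add: mem_forms)

lemma forms_1: "1 \<in> forms v 0"
  using forms_single[of 0 0 v 1] by simp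

lemma forms_prod: "(\<And>i. i \<in> A \<Longrightarrow> f i \<in> forms v (a i)) \<Longrightarrow> prod f A \<in> forms v (sum a A)"
  by (induction A rule: infinite_finite_induct) (auto intro: forms_1 forms_mult)

section \<open>Homogeneous components\<close>

definition homog_part :: "('r::finite \<Rightarrow> int ^ 'n) \<Rightarrow> int ^ 'r \<Rightarrow> ('r, 'k::field) cox_ring \<Rightarrow> ('r, 'k) cox_ring" where
  "homog_part v a f = (\<Sum>c\<in>{c \<in> Poly_Mapping.keys f. expo c - a \<in> principal_divisors v}.
     Poly_Mapping.single c (Poly_Mapping.lookup f c))"

lemma lookup_homog_part:
  "Poly_Mapping.lookup (homog_part v a f) c = (if expo c - a \<in> principal_divisors v then Poly_Mapping.lookup f c else 0)"
  by (simp add: homog_part_def lookup_sum lookup_single when_def sum.delta' in_keys_iff)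

lemma homog_part_forms: "homog_part v a f \<in> forms v a"
  by (auto simp: mem_forms in_keys_iff lookup_homog_part split: if_splits)

lemma homog_part_add: "homog_part v a (f + g) = homog_part v a f + homog_part v a g"
  and homog_part_diff: "homog_part v a (f - g) = homog_part v a f - homog_part v a g"
  and homog_part_0 [simp]: "homog_part v a 0 = 0"
  by (auto intro!: poly_mapping_eqI simp: lookup_homog_part lookup_add lookup_minus)

lemma homog_part_sum: "homog_part v a (sum f A) = (\<Sum>i\<in>A. homog_part v a (f i))"
  by (induction A rule: infinite_finite_induct) (auto simp: homog_part_add)

lemma homog_part_id: "f \<in> forms v a \<Longrightarrow> homog_part v a f = f"
  by (rule poly_mapping_eqI) (auto simp: lookup_homog_part mem_forms in_keys_iff)

lemma homog_part_other:
  assumes "f \<in> forms v b" "a - b \<notin> principal_divisors v"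
  shows "homog_part v a f = 0"
proof (rule poly_mapping_eqI)
  fix c
  have "Poly_Mapping.lookup f c = 0" if "expo c - a \<in> principal_divisors v"
  proof (rule ccontr)
    assume "Poly_Mapping.lookup f c \<noteq> 0"
    then have "expo c - b \<in> principal_divisors v" using assms(1) by (simp add: mem_forms in_keys_iff)
    from principal_diff[OF this that] assms(2) show False by simp
  qed
  then show "Poly_Mapping.lookup (homog_part v a f) c = Poly_Mapping.lookup 0 c" by (simp add: lookup_homog_part)
qed

lemma homog_part_mult:
  assumes g: "g \<in> forms v d"
  shows "homog_part v a (s * g) = homog_part v (a - d) s * g"
proof (induction s rule: cox_ring_induct)
  case (single c k)
  have s: "Poly_Mapping.single c k \<in> forms v (expo c)" by simp
  have sg: "Poly_Mapping.single c k * g \<in> forms v (expo c + d)" by (rule forms_mult[OF s g])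
  show ?case
  proof (cases "expo c - (a - d) \<in> principal_divisors v")
    case True
    then have cl: "div_class v (expo c + d) = div_class v a" "div_class v (expo c) = div_class v (a - d)"
      by (simp_all add: div_class_eq_iff algebra_simps)
    then have "Poly_Mapping.single c k \<in> forms v (a - d)" "Poly_Mapping.single c k * g \<in> forms v a"
      using s sg by auto
    then show ?thesis by (simp only: homog_part_id)
  next
    case False
    then have "a - (expo c + d) \<notin> principal_divisors v" "a - d - expo c \<notin> principal_divisors v"
      using principal_uminus by (force simp: algebra_simps)+
    then show ?thesis using homog_part_other[OF s] homog_part_other[OF sg] by simp
  qed
qed (simp_all add: homog_part_add distrib_right)

lemma homog_part_ideal_gen:
  assumes "\<And>g. g \<in> G \<Longrightarrow> \<exists>d. g \<in> forms v d" "f \<in> ideal_gen G"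
  shows "homog_part v a f \<in> ideal_gen G"
proof (rule module.span_induct_alt[OF module_mult assms(2), where h = "\<lambda>f. homog_part v a f \<in> ideal_gen G"])
  show "homog_part v a 0 \<in> ideal_gen G" by (simp add: module.span_zero[OF module_mult])
next
  fix c g y assume *: "g \<in> G" "homog_part v a y \<in> ideal_gen G"
  then obtain d where "g \<in> forms v d" using assms(1) by blast
  then have "homog_part v a (c * g + y) = homog_part v (a - d) c * g + homog_part v a y" by (simp add: homog_part_add homog_part_mult)
  then show "homog_part v a (c * g + y) \<in> ideal_gen G" using *
    by (simp add: module.span_add[OF module_mult] module.span_scale[OF module_mult] module.span_base[OF module_mult])
qed

lemma ideal_gen_is_ideal: "is_ideal (ideal_gen G)"
  by (rule module.subspace_span[OF module_mult])

definition monoms :: "('r::finite \<Rightarrow> int ^ 'n) \<Rightarrow> int ^ 'r \<Rightarrow> ('r \<Rightarrow>\<^sub>0 nat) set" where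
  "monoms v a = {c. expo c - a \<in> principal_divisors v}"

lemma monoms_cong: "div_class v a = div_class v b \<Longrightarrow> monoms v a = monoms v b"
proof -
  assume ab: "div_class v a = div_class v b"
  have "c \<in> monoms v x \<longleftrightarrow> div_class v (expo c) = div_class v x" for c x
    by (simp add: monoms_def div_class_eq_iff)
  then show ?thesis using ab by blast
qed

text \<open>Isolates what the Hilbert functions need from the fan, namely that every degree has
  finitely many monomials. Bases modulo a subspace then exist, and the description in
  \<open>hilbert_function\<close> denotes their common cardinality.\<close>

locale cox_grading =
  fixes v :: "'r::finite \<Rightarrow> int ^ 'n"
  assumes finite_monoms: "finite (monoms v a)"
begin

lemma forms_span:
  "(forms v a :: ('r, 'k::field) cox_ring set) \<subseteq> cox.span ((\<lambda>c. Poly_Mapping.single c 1) ` monoms v a)"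
proof
  fix f :: "('r, 'k) cox_ring" assume f: "f \<in> forms v a"
  have "f = (\<Sum>c\<in>Poly_Mapping.keys f. cox_const (Poly_Mapping.lookup f c) * Poly_Mapping.single c 1)"
    using cox_ring_expand[of f] by (simp add: cox_const_def mult_single)
  also have "\<dots> \<in> cox.span ((\<lambda>c. Poly_Mapping.single c 1) ` monoms v a)"
    using f by (intro cox.span_sum cox.span_scale cox.span_base) (auto simp: mem_forms monoms_def)
  finally show "f \<in> cox.span ((\<lambda>c. Poly_Mapping.single c 1) ` monoms v a)" .
qed

lemma obtain_basis:
  assumes "cox.subspace (W :: ('r, 'k::field) cox_ring set)"
  obtains E where "basis_modulo W (forms v a) E" "card E = hilbert_function v W (div_class v a)"
proof -
  obtain E where E: "basis_modulo W (forms v a) E"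
    using basis_modulo_exists[OF assms, of "(\<lambda>c. Poly_Mapping.single c 1) ` monoms v a" "forms v a"]
      forms_span finite_monoms by (metis finite_imageI forms_single image_subsetI mem_Collect_eq monoms_def)
  have "hilbert_function v W (div_class v a) = card E"
    unfolding hilbert_function_def
    using E basis_modulo_card_unique[OF assms] by (intro the_equality) blast+
  then show thesis using that E by simp
qed

lemma hilbert_function_eq:
  assumes "cox.subspace W" "basis_modulo W (forms v a) E"
  shows "hilbert_function v W (div_class v a) = card E"
  using obtain_basis[OF assms(1), of a] basis_modulo_card_unique[OF assms] by metis

lemma hilbert_function_ge:
  assumes W: "cox.subspace (W :: ('r, 'k::field) cox_ring set)" and E: "finite E" "E \<subseteq> forms v a" "indep_modulo W E"
  shows "card E \<le> hilbert_function v W (div_class v a)"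
proof -
  obtain B where B: "basis_modulo W (forms v a) B" "card B = hilbert_function v W (div_class v a)"
    using obtain_basis[OF W] by blast
  have "card E \<le> card B"
    using E B(1) by (intro card_le_if_indep_modulo[OF W]) (auto simp: basis_modulo_iff)
  then show ?thesis using B(2) by simp
qed

text \<open>Multiplication by \<open>g\<close> is injective modulo \<open>W\<close>, so it carries a
  basis in degree \<open>a\<close> to an independent family in degree \<open>a + d\<close>.\<close>

lemma hilbert_function_mono:
  assumes W: "cox.subspace (W :: ('r, 'k::field) cox_ring set)"
    and g: "g \<in> forms v d" and inj: "\<And>f. g * f \<in> W \<Longrightarrow> f \<in> W"
  shows "hilbert_function v W (div_class v a) \<le> hilbert_function v W (div_class v (a + d))"
proof -
  obtain E where E: "basis_modulo W (forms v a) E" "card E = hilbert_function v W (div_class v a)"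
    using obtain_basis[OF W] by blast
  have fin: "finite E" and sub: "E \<subseteq> forms v a" and ind: "indep_modulo W E" using E(1) by (auto simp: basis_modulo_iff)
  have inj_on: "inj_on ((*) g) E"
  proof (rule inj_onI)
    fix x y assume xy: "x \<in> E" "y \<in> E" "g * x = g * y"
    then have "g * (x - y) \<in> W" using cox.subspace_0[OF W] by (simp add: right_diff_distrib)
    then show "x = y" using inj indep_modulo_diff_mem[OF ind fin xy(1,2)] by blast
  qed
  have "indep_modulo W ((*) g ` E)"
    unfolding indep_modulo_def
  proof (intro allI impI ballI)
    fix c x assume c: "(\<Sum>e\<in>(*) g ` E. cox_const (c e) * e) \<in> W" and x: "x \<in> (*) g ` E"
    have "(\<Sum>e\<in>(*) g ` E. cox_const (c e) * e) = g * (\<Sum>e\<in>E. cox_const (c (g * e)) * e)"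
      by (simp add: sum.reindex[OF inj_on] sum_distrib_left mult.left_commute)
    then have "(\<Sum>e\<in>E. cox_const (c (g * e)) * e) \<in> W" using c inj by simp
    then have "c (g * e) = 0" if "e \<in> E" for e using indep_moduloD[OF ind, of "\<lambda>e. c (g * e)"] that by simp
    then show "c x = 0" using x by blast
  qed
  moreover have "(*) g ` E \<subseteq> forms v (a + d)" using forms_mult[OF g] sub by (auto simp: add.commute)
  ultimately have "card ((*) g ` E) \<le> hilbert_function v W (div_class v (a + d))"
    using fin by (intro hilbert_function_ge[OF W]) auto
  then show ?thesis using E(2) card_image[OF inj_on] by simp
qed

text \<open>Serves twice: for the zero ideal at the start of a regular sequence, and for the degrees
  in which \<open>I\<close> has no nonzero element.\<close>

lemma hilbert_function_free:
  assumes W: "cox.subspace (W :: ('r, 'k::field) cox_ring set)" and "W \<inter> forms v a \<subseteq> {0}"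
  shows "hilbert_function v W (div_class v a) = card (monoms v a)"
proof -
  define s where "s c = (Poly_Mapping.single c 1 :: ('r, 'k) cox_ring)" for c :: "'r \<Rightarrow>\<^sub>0 nat"
  have inj: "inj_on s C" for C by (auto simp: inj_on_def s_def)
      (metis lookup_single_eq lookup_single_not_eq one_neq_zero)
  have sum: "(\<Sum>e\<in>s ` C. cox_const (h e) * e) = (\<Sum>c\<in>C. Poly_Mapping.single c (h (s c)))" for C h
    by (simp add: sum.reindex[OF inj]) (simp add: s_def cox_const_def mult_single)
  have "basis_modulo W (forms v a) (s ` monoms v a)"
    unfolding basis_modulo_iff indep_modulo_def
  proof (intro conjI ballI allI impI)
    show "finite (s ` monoms v a)" using finite_monoms by simp
    show sub: "s ` monoms v a \<subseteq> forms v a" by (auto simp: s_def monoms_def)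
    fix f :: "('r, 'k) cox_ring" assume f: "f \<in> forms v a"
    have "f = (\<Sum>c\<in>Poly_Mapping.keys f. Poly_Mapping.single c (Poly_Mapping.lookup f c))" by (rule cox_ring_expand)
    also have "\<dots> = (\<Sum>c\<in>monoms v a. Poly_Mapping.single c (Poly_Mapping.lookup f c))"
      using f finite_monoms by (intro sum.mono_neutral_left) (auto simp: mem_forms monoms_def in_keys_iff)
    also have "\<dots> = (\<Sum>e\<in>s ` monoms v a. cox_const (Poly_Mapping.lookup f (the_inv s e)) * e)"
      unfolding sum by (simp add: the_inv_f_f[OF inj])
    finally have "f - (\<Sum>e\<in>s ` monoms v a. cox_const (Poly_Mapping.lookup f (the_inv s e)) * e) \<in> W"
      using cox.subspace_0[OF W] by simp
    then show "\<exists>c. f - (\<Sum>e\<in>s ` monoms v a. cox_const (c e) * e) \<in> W"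
      by (rule exI[of _ "\<lambda>e. Poly_Mapping.lookup f (the_inv s e)"])
  next
    fix h e assume h: "(\<Sum>e\<in>s ` monoms v a. cox_const (h e) * e) \<in> W" and e: "e \<in> s ` monoms v a"
    then obtain c where c: "c \<in> monoms v a" "e = s c" by blast
    have "(\<Sum>e\<in>s ` monoms v a. cox_const (h e) * e) \<in> forms v a"
      unfolding sum by (intro cox.subspace_sum[OF forms_subspace]) (auto simp: monoms_def)
    then have "(\<Sum>c\<in>monoms v a. Poly_Mapping.single c (h (s c))) = 0" using h assms(2) unfolding sum by blast
    then have "Poly_Mapping.lookup (\<Sum>c\<in>monoms v a. Poly_Mapping.single c (h (s c))) c = 0" by simp
    then show "h e = 0" using c finite_monoms by (simp add: lookup_sum lookup_single when_def sum.delta)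
  qed
  then show ?thesis using hilbert_function_eq[OF W] card_image[OF inj] by metis
qed

text \<open>Additivity of the dimension along the exact sequence given by multiplication with the
  nonzerodivisor \<open>g\<close>, from degree \<open>a - d\<close> to degree \<open>a\<close>. A
  basis of the middle term consists of lifts \<open>E\<close> of a basis of the cokernel and of the
  products of \<open>B\<close> with \<open>g\<close>.\<close>

lemma hilbert_function_step:
  fixes G :: "('r, 'k::field) cox_ring set"
  assumes hom: "\<And>g. g \<in> G \<Longrightarrow> \<exists>d. g \<in> forms v d" and g: "g \<in> forms v d"
    and nzd: "\<And>h. h * g \<in> ideal_gen G \<Longrightarrow> h \<in> ideal_gen G"
  shows "hilbert_function v (ideal_gen G) (div_class v a) =
     hilbert_function v (ideal_gen (insert g G)) (div_class v a) + hilbert_function v (ideal_gen G) (div_class v (a - d))"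
proof -
  define I J where "I = ideal_gen G" and "J = ideal_gen (insert g G)"
  have idI: "is_ideal I" and idJ: "is_ideal J" unfolding I_def J_def by (rule ideal_gen_is_ideal)+
  note WI = ideal_subspace[OF idI] and WJ = ideal_subspace[OF idJ]
  have IJ: "I \<subseteq> J" unfolding I_def J_def by (intro module.span_mono[OF module_mult]) auto
  have gJ: "g \<in> J" unfolding J_def by (intro module.span_base[OF module_mult]) auto
  obtain E where E: "basis_modulo J (forms v a) E" "card E = hilbert_function v J (div_class v a)"
    using obtain_basis[OF WJ] by blast
  obtain B where B: "basis_modulo I (forms v (a - d)) B" "card B = hilbert_function v I (div_class v (a - d))"
    using obtain_basis[OF WI] by blast
  have E': "finite E" "E \<subseteq> forms v a" "indep_modulo J E" using E(1) by (auto simp: basis_modulo_iff)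
  have B': "finite B" "B \<subseteq> forms v (a - d)" "indep_modulo I B" using B(1) by (auto simp: basis_modulo_iff)
  define \<mu> where "\<mu> x = x * g" for x
  have inj: "inj_on \<mu> B"
  proof (rule inj_onI)
    fix x y assume xy: "x \<in> B" "y \<in> B" "\<mu> x = \<mu> y"
    then have "(x - y) * g \<in> I" using ideal_0[OF idI] by (simp add: \<mu>_def left_diff_distrib)
    then show "x = y" using nzd[of "x - y"] indep_modulo_diff_mem[OF B'(3,1) xy(1,2)] by (simp add: I_def)
  qed
  have disj: "E \<inter> \<mu> ` B = {}"
    using indep_modulo_not_mem[OF E'(3,1)] ideal_mult_left[OF idJ gJ] by (auto simp: \<mu>_def)
  have fin: "finite (\<mu> ` B)" using B' by simp
  have split: "(\<Sum>e\<in>E \<union> \<mu> ` B. cox_const (c e) * e) =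
     (\<Sum>e\<in>E. cox_const (c e) * e) + (\<Sum>b\<in>B. cox_const (c (\<mu> b)) * b) * g" for c
    by (simp add: sum.union_disjoint[OF E'(1) fin disj] sum.reindex[OF inj] sum_distrib_right)
      (simp add: \<mu>_def mult.assoc)
  have "basis_modulo I (forms v a) (E \<union> \<mu> ` B)"
    unfolding basis_modulo_iff indep_modulo_def
  proof (intro conjI ballI allI impI)
    show "finite (E \<union> \<mu> ` B)" using E' fin by simp
    have "\<mu> b \<in> forms v a" if "b \<in> B" for b
      using forms_mult[OF _ g, of b "a - d"] B'(2) that by (auto simp: \<mu>_def)
    then show "E \<union> \<mu> ` B \<subseteq> forms v a" using E'(2) by blast
    fix f :: "('r, 'k) cox_ring" assume f: "f \<in> forms v a"
    then obtain c where "f - (\<Sum>e\<in>E. cox_const (c e) * e) \<in> J" using E(1) by (auto simp: basis_modulo_iff)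
    then obtain h where h: "f - (\<Sum>e\<in>E. cox_const (c e) * e) - h * g \<in> I"
      unfolding J_def I_def module.span_insert[OF module_mult] by blast
    define f' where "f' = f - (\<Sum>e\<in>E. cox_const (c e) * e)"
    have f': "f' \<in> forms v a" unfolding f'_def
      using E'(2) f by (intro cox.subspace_diff[OF forms_subspace] cox.subspace_sum[OF forms_subspace]
          cox.subspace_scale[OF forms_subspace]) auto
    \<comment> \<open>The cofactor \<open>h\<close> need not be homogeneous; as \<open>f'\<close> is
      a form, \<open>h\<close> can be replaced by its component of degree
      \<open>a - d\<close>.\<close>
    have "homog_part v a (f' - h * g) \<in> I"
      unfolding I_def by (rule homog_part_ideal_gen) (use hom h in \<open>auto simp: I_def f'_def\<close>)
    then have 1: "f' - homog_part v (a - d) h * g \<in> I" by (simp add: homog_part_diff homog_part_mult[OF g] homog_part_id[OF f'])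
    obtain c' where c': "homog_part v (a - d) h - (\<Sum>b\<in>B. cox_const (c' b) * b) \<in> I"
      using B(1) homog_part_forms unfolding basis_modulo_iff by blast
    define C where "C e = (if e \<in> E then c e else c' (the_inv_into B \<mu> e))" for e
    have CE: "(\<Sum>e\<in>E. cox_const (C e) * e) = (\<Sum>e\<in>E. cox_const (c e) * e)" by (simp add: C_def)
    have CB: "(\<Sum>b\<in>B. cox_const (C (\<mu> b)) * b) = (\<Sum>b\<in>B. cox_const (c' b) * b)"
      using disj by (intro sum.cong) (auto simp: C_def the_inv_into_f_f[OF inj])
    have "f - (\<Sum>e\<in>E \<union> \<mu> ` B. cox_const (C e) * e) =
      (f' - homog_part v (a - d) h * g) + (homog_part v (a - d) h - (\<Sum>b\<in>B. cox_const (c' b) * b)) * g"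
      unfolding split CE CB f'_def by (simp add: algebra_simps)
    also have "\<dots> \<in> I" by (intro ideal_add[OF idI] ideal_mult_right[OF idI] 1 c')
    finally show "\<exists>c. f - (\<Sum>e\<in>E \<union> \<mu> ` B. cox_const (c e) * e) \<in> I" by (rule exI[of _ C])
  next
    fix c x assume c: "(\<Sum>e\<in>E \<union> \<mu> ` B. cox_const (c e) * e) \<in> I" and x: "x \<in> E \<union> \<mu> ` B"
    define h where "h = (\<Sum>b\<in>B. cox_const (c (\<mu> b)) * b)"
    have 1: "(\<Sum>e\<in>E. cox_const (c e) * e) + h * g \<in> I" using c unfolding split h_def .
    then have "(\<Sum>e\<in>E. cox_const (c e) * e) + h * g - h * g \<in> J"
      using IJ by (intro ideal_diff[OF idJ] ideal_mult_left[OF idJ] gJ) blast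
    then have "(\<Sum>e\<in>E. cox_const (c e) * e) \<in> J" by simp
    then have cE: "\<forall>e\<in>E. c e = 0" using E'(3) by (simp add: indep_modulo_def)
    then have "h * g \<in> I" using 1 by (simp add: cox_const_hom)
    then have "h \<in> I" using nzd by (simp add: I_def)
    then have "\<forall>b\<in>B. c (\<mu> b) = 0" using indep_moduloD[OF B'(3), of "\<lambda>b. c (\<mu> b)"] by (simp add: h_def)
    then show "c x = 0" using x cE by blast
  qed
  then have "hilbert_function v I (div_class v a) = card (E \<union> \<mu> ` B)" by (rule hilbert_function_eq[OF WI])
  also have "\<dots> = card E + card B" using card_Un_disjoint[OF E'(1) fin disj] card_image[OF inj] by simp
  finally show ?thesis using E(2) B(2) by (simp add: I_def J_def)
qed

text \<open>Each further member of the sequence subtracts a copy of the formula shifted by its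
  degree, which doubles the set of subsets: this is the Koszul complex on the level of
  dimensions.\<close>

lemma hilbert_function_regular_sequence:
  fixes fs :: "('r, 'k::field) cox_ring list"
  assumes reg: "regular_sequence fs" and deg: "\<And>i. i < length fs \<Longrightarrow> fs ! i \<in> forms v (d i)" and k: "k \<le> length fs"
  shows "int (hilbert_function v (ideal_gen (set (take k fs))) (div_class v a)) =
    (\<Sum>A\<in>Pow {..<k}. (-1) ^ card A * int (card (monoms v (a - sum d A))))"
  using k
proof (induction k arbitrary: a)
  case 0
  have "hilbert_function v (ideal_gen ({} :: ('r, 'k) cox_ring set)) (div_class v a) = card (monoms v a)"
    by (rule hilbert_function_free) (auto simp: module.span_empty[OF module_mult])
  then show ?case by simp
next
  case (Suc k)
  then have k: "k < length fs" by simp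
  have tk: "set (take (Suc k) fs) = insert (fs ! k) (set (take k fs))" using k by (simp add: take_Suc_conv_app_nth)
  have hom: "\<exists>d. g \<in> forms v d" if "g \<in> set (take k fs)" for g
    using that deg k by (metis in_set_conv_nth in_set_takeD)
  have "h \<in> ideal_gen (set (take k fs))" if "h * fs ! k \<in> ideal_gen (set (take k fs))" for h
    using reg k that unfolding regular_sequence_def by blast
  from hilbert_function_step[OF hom deg[OF k] this, of a]
  have step: "int (hilbert_function v (ideal_gen (set (take (Suc k) fs))) (div_class v a)) =
     int (hilbert_function v (ideal_gen (set (take k fs))) (div_class v a)) -
     int (hilbert_function v (ideal_gen (set (take k fs))) (div_class v (a - d k)))"
    unfolding tk by linarith
  define F where "F A = (-1) ^ card A * int (card (monoms v (a - sum d A)))" for A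
  have "(\<Sum>A\<in>Pow {..<Suc k}. F A) = (\<Sum>A\<in>Pow {..<k}. F A) + (\<Sum>A\<in>Pow {..<k}. F (insert k A))"
    unfolding lessThan_Suc by (rule sum_Pow_insert) auto
  also have "(\<Sum>A\<in>Pow {..<k}. F (insert k A)) =
     - (\<Sum>A\<in>Pow {..<k}. (-1) ^ card A * int (card (monoms v (a - d k - sum d A))))"
    unfolding sum_negf[symmetric]
  proof (rule sum.cong)
    fix A assume "A \<in> Pow {..<k}"
    then have "finite A" "k \<notin> A" by (auto intro: finite_subset)
    then show "F (insert k A) = - ((-1) ^ card A * int (card (monoms v (a - d k - sum d A))))"
      by (simp add: F_def algebra_simps)
  qed simp
  finally show ?case unfolding step using Suc.IH k by (simp add: F_def)
qed

end

section \<open>Signed decomposition of polytopes into cones\<close>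

definition coord :: "('r \<Rightarrow> real ^ 'n) \<Rightarrow> 'r set \<Rightarrow> real ^ 'n \<Rightarrow> 'r \<Rightarrow> real" where
  "coord w S x i = representation (w ` S) x (w i)"

text \<open>A set \<open>S\<close> in \<open>C\<close> stands for the full-dimensional simplicial
  cone spanned by the \<open>w i\<close> with \<open>i\<close> in \<open>S\<close>.\<close>

locale cone_bases =
  fixes w :: "'r::finite \<Rightarrow> real ^ 'n" and C :: "'r set set"
  assumes indep: "S \<in> C \<Longrightarrow> independent (w ` S)"
    and inj: "S \<in> C \<Longrightarrow> inj_on w S"
    and span: "S \<in> C \<Longrightarrow> span (w ` S) = UNIV"
begin

lemma finite_C: "finite C"
  by (rule finite_subset[of _ UNIV]) auto

lemma coord_sum:
  assumes "S \<in> C"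
  shows "(\<Sum>i\<in>S. coord w S x i *\<^sub>R w i) = x"
proof -
  have "(\<Sum>b\<in>w ` S. representation (w ` S) x b *\<^sub>R b) = x"
    using indep[OF assms] span[OF assms] by (intro real_vector.sum_representation_eq) auto
  then show ?thesis by (simp add: sum.reindex[OF inj[OF assms]] coord_def)
qed

lemma coord_add: "S \<in> C \<Longrightarrow> coord w S (x + y) i = coord w S x i + coord w S y i"
  unfolding coord_def using indep[of S] span[of S] by (simp add: real_vector.representation_add)

lemma coord_scale: "S \<in> C \<Longrightarrow> coord w S (c *\<^sub>R x) i = c * coord w S x i"
  unfolding coord_def using indep[of S] span[of S] by (simp add: real_vector.representation_scale)

lemma coord_0: "S \<in> C \<Longrightarrow> coord w S 0 i = 0"
  using coord_scale[of S 0 0 i] by simp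

lemma coord_setsum: "S \<in> C \<Longrightarrow> coord w S (\<Sum>k\<in>A. f k) i = (\<Sum>k\<in>A. coord w S (f k) i)"
  by (induction A rule: infinite_finite_induct) (auto simp: coord_0 coord_add)

lemma coord_basis: "S \<in> C \<Longrightarrow> i \<in> S \<Longrightarrow> j \<in> S \<Longrightarrow> coord w S (w j) i = (if i = j then 1 else 0)"
  unfolding coord_def using indep[of S] inj[of S] by (auto simp: real_vector.representation_basis inj_on_eq_iff)

lemma coord_sum_subset:
  assumes "S \<in> C" "T \<subseteq> S" "i \<in> S"
  shows "coord w S (\<Sum>j\<in>T. w j) i = (if i \<in> T then 1 else 0)"
proof -
  have "coord w S (\<Sum>j\<in>T. w j) i = (\<Sum>j\<in>T. if i = j then 1 else 0)"
    unfolding coord_setsum[OF assms(1)] using assms by (intro sum.cong) (auto simp: coord_basis)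
  then show ?thesis by (simp add: sum.delta)
qed

lemma coord_eqI:
  assumes "S \<in> C" "i \<in> S" "x = (\<Sum>j\<in>S. c j *\<^sub>R w j)"
  shows "coord w S x i = c i"
proof -
  have "coord w S x i = (\<Sum>j\<in>S. c j * (if i = j then 1 else 0))"
    unfolding assms(3) coord_setsum[OF assms(1)] using assms(1,2) by (intro sum.cong) (auto simp: coord_scale coord_basis)
  then show ?thesis using assms(2) by (simp add: if_distrib[of "\<lambda>x. _ * x"] sum.delta cong: if_cong)
qed

end

text \<open>Combinatorial form of a complete simplicial fan: by \<open>inter\<close> a common point
  of two cones lies in the face over their common generators, and by \<open>cover\<close> the cones
  exhaust the space.\<close>

locale simplicial_cones = cone_bases w C
  for w :: "'r::finite \<Rightarrow> real ^ 'n" and C :: "'r set set" +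
  assumes inter: "S \<in> C \<Longrightarrow> S' \<in> C \<Longrightarrow> (\<And>i. i \<in> S \<Longrightarrow> 0 \<le> coord w S x i) \<Longrightarrow>
       (\<And>i. i \<in> S' \<Longrightarrow> 0 \<le> coord w S' x i) \<Longrightarrow> i \<in> S - S' \<Longrightarrow> coord w S x i = 0"
    and cover: "\<exists>S\<in>C. \<forall>i\<in>S. 0 \<le> coord w S x i"
begin

definition generic :: "real ^ 'n \<Rightarrow> bool" where
  "generic \<xi> \<longleftrightarrow> (\<forall>S\<in>C. \<forall>i\<in>S. coord w S \<xi> i \<noteq> 0)"

text \<open>The vectors that are not generic lie in finitely many proper subspaces, and a nonempty
  open set is not negligible.\<close>

lemma generic_exists:
  assumes "open K" "K \<noteq> {}"
  obtains \<xi> where "\<xi> \<in> K" "generic \<xi>"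
proof -
  define Z where "Z = (\<Union>S\<in>C. \<Union>i\<in>S. {x. coord w S x i = 0})"
  have "negligible {x. coord w S x i = 0}" if S: "S \<in> C" "i \<in> S" for S i
  proof (rule negligible_lowdim)
    have "{x. coord w S x i = 0} \<subseteq> span (w ` (S - {i}))"
    proof
      fix x assume "x \<in> {x. coord w S x i = 0}"
      then have "x = (\<Sum>j\<in>S - {i}. coord w S x j *\<^sub>R w j)"
        using coord_sum[OF S(1), of x] S(2) by (simp add: sum.remove[of S i])
      then show "x \<in> span (w ` (S - {i}))"
        by (metis (no_types, lifting) imageI span_base span_scale span_sum)
    qed
    then have "dim {x. coord w S x i = 0} \<le> card (w ` (S - {i}))"
      by (meson dim_le_card finite finite_imageI)
    also have "\<dots> \<le> card (S - {i})" by (rule card_image_le) simp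
    also have "\<dots> < card S" using S(2) by (intro psubset_card_mono) auto
    also have "card S = dim (w ` S)"
      using indep[OF S(1)] inj[OF S(1)] by (simp add: dim_eq_card_independent card_image)
    also have "\<dots> = DIM(real ^ 'n)" using span[OF S(1)] by (metis dim_UNIV dim_span)
    finally show "dim {x. coord w S x i = 0} < DIM(real ^ 'n)" .
  qed
  then have "negligible Z" unfolding Z_def using finite_C by (intro negligible_Union) auto
  moreover have "\<not> negligible K" using assms open_not_negligible by blast
  ultimately have "\<not> K \<subseteq> Z" using negligible_subset by blast
  then obtain \<xi> where "\<xi> \<in> K" "\<xi> \<notin> Z" by blast
  then show thesis using that unfolding Z_def generic_def by blast
qed

text \<open>Modulo the span of \<open>T\<close> the cones over \<open>T\<close> form a complete fan,
  and a generic vector lies in exactly one of its cones. It comes from the cone that contains the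
  points obtained by moving slightly from \<open>p\<close>, the sum of the generators in
  \<open>T\<close>, in the direction \<open>\<xi>\<close>.\<close>

lemma exactly_one_cone_containing:
  assumes \<xi>: "generic \<xi>" and S0: "S0 \<in> C" "T \<subseteq> S0"
  shows "card {S \<in> C. T \<subseteq> S \<and> (\<forall>i\<in>S - T. coord w S \<xi> i > 0)} = 1"
proof -
  define p where "p = (\<Sum>j\<in>T. w j)"
  \<comment> \<open>Pigeonhole: finitely many cones cover these points approaching \<open>p\<close>,
    so one cone \<open>S\<close> contains infinitely many of them and, in the limit,
    \<open>p\<close> itself.\<close>
  have "\<exists>S\<in>C. infinite {k :: nat. k \<in> UNIV \<and> (\<forall>i\<in>S. 0 \<le> coord w S (p + (1 / real (Suc k)) *\<^sub>R \<xi>) i)}"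
    using cover by (intro pigeonhole_infinite_rel finite_C) auto
  then obtain S where S: "S \<in> C"
    and inf: "infinite {k :: nat. \<forall>i\<in>S. 0 \<le> coord w S (p + (1 / real (Suc k)) *\<^sub>R \<xi>) i}" by auto
  have ineq: "\<exists>k\<ge>K. \<forall>i\<in>S. 0 \<le> coord w S p i + coord w S \<xi> i / real (Suc k)" for K
    using inf S unfolding infinite_nat_iff_unbounded_le by (auto simp: coord_add coord_scale)
  have p0: "0 \<le> coord w S p i" if i: "i \<in> S" for i
  proof (rule ccontr)
    assume "\<not> 0 \<le> coord w S p i"
    then have neg: "- coord w S p i > 0" by simp
    obtain K :: nat where K: "coord w S \<xi> i / (- coord w S p i) < real K" using reals_Archimedean2 by blast
    obtain k where k: "k \<ge> K" "0 \<le> coord w S p i + coord w S \<xi> i / real (Suc k)" using ineq[of K] i by blast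
    have "coord w S \<xi> i < real K * (- coord w S p i)" using K neg by (simp add: pos_divide_less_eq del: divide_minus_right)
    also have "\<dots> \<le> real (Suc k) * (- coord w S p i)" using k(1) neg by (intro mult_right_mono) auto
    finally have "coord w S \<xi> i / real (Suc k) < - coord w S p i" by (simp add: pos_divide_less_eq mult.commute)
    then show False using k(2) by simp
  qed
  have pS0: "coord w S0 p i = (if i \<in> T then 1 else 0)" if "i \<in> S0" for i
    using coord_sum_subset[OF S0 that] by (simp add: p_def)
  have TS: "T \<subseteq> S"
  proof
    fix i assume i: "i \<in> T"
    show "i \<in> S"
    proof (rule ccontr)
      assume "i \<notin> S"
      then have "coord w S0 p i = 0" using i S0 by (intro inter[OF S0(1) S, of p i] p0) (auto simp: pS0)
      then show False using pS0 i S0(2) by auto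
    qed
  qed
  have posS: "coord w S \<xi> i > 0" if i: "i \<in> S - T" for i
  proof -
    obtain k where "0 \<le> coord w S p i + coord w S \<xi> i / real (Suc k)" using ineq[of 0] i by blast
    moreover have "coord w S p i = 0" using coord_sum_subset[OF S TS, of i] i by (simp add: p_def)
    ultimately have "coord w S \<xi> i \<ge> 0" by (simp add: zero_le_divide_iff)
    then show ?thesis using \<xi> S i unfolding generic_def by force
  qed
  have sub: "A \<subseteq> B" if A: "A \<in> C" "T \<subseteq> A" "\<forall>i\<in>A - T. coord w A \<xi> i > 0"
    and B: "B \<in> C" "T \<subseteq> B" "\<forall>i\<in>B - T. coord w B \<xi> i > 0" for A B
  proof
    \<comment> \<open>A large multiple of \<open>p\<close> makes the coordinates with index in
      \<open>T\<close> positive too, so that \<open>x\<close> is interior to both cones; then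
      \<open>inter\<close> leaves no generator of \<open>A\<close> outside \<open>B\<close>.\<close>
    define \<Lambda> where "\<Lambda> = (\<Sum>i\<in>UNIV. \<bar>coord w A \<xi> i\<bar> + \<bar>coord w B \<xi> i\<bar>) + 1"
    have \<Lambda>: "\<bar>coord w A \<xi> i\<bar> + \<bar>coord w B \<xi> i\<bar> < \<Lambda>" for i
      unfolding \<Lambda>_def using member_le_sum[of i UNIV "\<lambda>i. \<bar>coord w A \<xi> i\<bar> + \<bar>coord w B \<xi> i\<bar>"] by simp
    define x where "x = \<Lambda> *\<^sub>R p + \<xi>"
    have pos: "coord w S' x i > 0"
      if S': "S' \<in> C" "T \<subseteq> S'" "\<forall>i\<in>S' - T. coord w S' \<xi> i > 0" "\<bar>coord w S' \<xi> i\<bar> < \<Lambda>" and i: "i \<in> S'" for S' i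
      using S'(3,4) coord_sum_subset[OF S'(1,2) i] S'(1) i
      by (cases "i \<in> T") (auto simp: x_def coord_add coord_scale p_def)
    have xA: "coord w A x i > 0" if "i \<in> A" for i using pos[OF A _ that] \<Lambda>[of i] by simp
    have xB: "coord w B x i > 0" if "i \<in> B" for i using pos[OF B _ that] \<Lambda>[of i] by simp
    fix i assume i: "i \<in> A"
    show "i \<in> B"
    proof (rule ccontr)
      assume "i \<notin> B"
      then have "coord w A x i = 0" using i xA xB by (intro inter[OF A(1) B(1), of x i]) (auto intro: less_imp_le)
      then show False using xA[OF i] by simp
    qed
  qed
  have "{S \<in> C. T \<subseteq> S \<and> (\<forall>i\<in>S - T. coord w S \<xi> i > 0)} = {S}"
    using sub S TS posS by blast
  then show ?thesis by simp
qed

text \<open>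
  For a sign vector (\<open>U\<close> is the set of flipped indices), \<open>signed_count\<close> counts with sign the
  cones of the star of \<open>T\<close> that contain \<open>\<xi>\<close> modulo the span of \<open>T\<close> after the generators with
  index in \<open>U\<close> have been reflected.
\<close>

definition flip :: "'r set \<Rightarrow> ('r \<Rightarrow> real) \<Rightarrow> 'r \<Rightarrow> real" where
  "flip U c i = (if i \<in> U then - of_bool (c i < 0) else of_bool (c i > 0))"

definition signed_count :: "'r set \<Rightarrow> 'r set \<Rightarrow> real ^ 'n \<Rightarrow> real" where
  "signed_count T U \<xi> = (\<Sum>S\<in>{S \<in> C. T \<subseteq> S}. \<Prod>i\<in>S - T. flip U (coord w S \<xi>) i)"

text \<open>Without reflections every product is an indicator, and the star of \<open>T\<close>
  covers a generic vector exactly once.\<close>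

lemma signed_count_no_flip:
  assumes "generic \<xi>"
  shows "signed_count T {} \<xi> = of_bool (\<exists>S\<in>C. T \<subseteq> S)"
proof -
  have "(\<Prod>i\<in>S - T. flip {} (coord w S \<xi>) i) = of_bool (\<forall>i\<in>S - T. coord w S \<xi> i > 0)" for S
  proof (cases "\<forall>i\<in>S - T. coord w S \<xi> i > 0")
    case True
    then show ?thesis by (simp add: flip_def)
  next
    case False
    then have "\<exists>i\<in>S - T. flip {} (coord w S \<xi>) i = 0" by (auto simp: flip_def)
    then have "(\<Prod>i\<in>S - T. flip {} (coord w S \<xi>) i) = 0" by (intro prod_zero) auto
    then show ?thesis using False by auto
  qed
  then have "signed_count T {} \<xi> = (\<Sum>S\<in>{S \<in> C. T \<subseteq> S}. of_bool (\<forall>i\<in>S - T. coord w S \<xi> i > 0))"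
    by (simp add: signed_count_def)
  also have "\<dots> = real (card {S \<in> C. T \<subseteq> S \<and> (\<forall>i\<in>S - T. coord w S \<xi> i > 0)})"
    using finite_C by (simp add: sum.If_cases of_bool_def Int_def conj_assoc)
  also have "\<dots> = of_bool (\<exists>S\<in>C. T \<subseteq> S)"
  proof (cases "\<exists>S\<in>C. T \<subseteq> S")
    case True
    then obtain S0 where "S0 \<in> C" "T \<subseteq> S0" by blast
    then show ?thesis using True exactly_one_cone_containing[OF assms] by simp
  next
    case False
    then have e: "{S \<in> C. T \<subseteq> S \<and> (\<forall>i\<in>S - T. coord w S \<xi> i > 0)} = {}" by blast
    show ?thesis unfolding e using False by simp
  qed
  finally show ?thesis .
qed

text \<open>For a nonzero coordinate c, reflecting the generator replaces [c > 0] by - [c < 0] =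
  [c > 0] - 1. The subtracted 1 leaves the count of the cones over
  \<open>insert j T\<close>.\<close>

lemma signed_count_flip_insert:
  assumes \<xi>: "generic \<xi>" and j: "j \<notin> U"
  shows "signed_count T (insert j U) \<xi> =
    (if j \<in> T then signed_count T U \<xi> else signed_count T U \<xi> - signed_count (insert j T) U \<xi>)"
proof (cases "j \<in> T")
  case True
  then have "(\<Prod>i\<in>S - T. flip (insert j U) (coord w S \<xi>) i) = (\<Prod>i\<in>S - T. flip U (coord w S \<xi>) i)" for S
    by (intro prod.cong) (auto simp: flip_def)
  then show ?thesis using True by (simp add: signed_count_def)
next
  case False
  have *: "(\<Prod>i\<in>S - T. flip (insert j U) (coord w S \<xi>) i) = (\<Prod>i\<in>S - T. flip U (coord w S \<xi>) i)
    - (if j \<in> S then \<Prod>i\<in>S - insert j T. flip U (coord w S \<xi>) i else 0)" if S: "S \<in> C" for S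
  proof (cases "j \<in> S")
    case True
    have e: "S - T = insert j (S - insert j T)" using True False by auto
    have 1: "flip (insert j U) (coord w S \<xi>) j = flip U (coord w S \<xi>) j - 1"
      using \<xi> S True j unfolding generic_def flip_def by (auto simp: not_less order.order_iff_strict)
    have 2: "(\<Prod>i\<in>S - insert j T. flip (insert j U) (coord w S \<xi>) i) = (\<Prod>i\<in>S - insert j T. flip U (coord w S \<xi>) i)"
      by (intro prod.cong) (auto simp: flip_def)
    show ?thesis using True unfolding e by (simp add: 1 2 left_diff_distrib)
  next
    case False
    then have "(\<Prod>i\<in>S - T. flip (insert j U) (coord w S \<xi>) i) = (\<Prod>i\<in>S - T. flip U (coord w S \<xi>) i)"
      by (intro prod.cong) (auto simp: flip_def)
    then show ?thesis using False by simp
  qed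
  have "(\<Sum>S\<in>{S \<in> C. T \<subseteq> S}. if j \<in> S then \<Prod>i\<in>S - insert j T. flip U (coord w S \<xi>) i else 0) =
    (\<Sum>S\<in>{S \<in> {S \<in> C. T \<subseteq> S}. j \<in> S}. \<Prod>i\<in>S - insert j T. flip U (coord w S \<xi>) i)"
    using finite_C by (intro sum.inter_filter[symmetric]) auto
  also have "{S \<in> {S \<in> C. T \<subseteq> S}. j \<in> S} = {S \<in> C. insert j T \<subseteq> S}" by auto
  finally show ?thesis using False
    by (simp add: signed_count_def * sum_subtractf)
qed

text \<open>The recursion on the flipped indices reduces every count to counts without reflections,
  which are the same for all generic vectors.\<close>

lemma signed_count_invariant:
  assumes "generic \<xi>" "generic \<xi>'"
  shows "signed_count T U \<xi> = signed_count T U \<xi>'"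
proof -
  have "finite U" by simp
  then show ?thesis
  proof (induction U arbitrary: T rule: finite_induct)
    case empty
    then show ?case using assms by (simp add: signed_count_no_flip)
  next
    case (insert j U)
    then show ?case using assms by (simp add: signed_count_flip_insert)
  qed
qed

lemma inner_eq_coord_sum:
  assumes "S \<in> C"
  shows "x \<bullet> \<xi> = (\<Sum>i\<in>S. coord w S \<xi> i * (x \<bullet> w i))"
  using arg_cong[OF coord_sum[OF assms, of \<xi>], of "\<lambda>y. x \<bullet> y"] by (simp add: inner_sum_right)

text \<open>
  By convexity of the support function, a direction in which \<open>x\<close> violates all inequalities
  lies in none of the reflected cones.
\<close>

lemma signed_count_nef:
  assumes \<xi>: "generic \<xi>"
    and vertex: "\<And>S j. S \<in> C \<Longrightarrow> j \<in> S \<Longrightarrow> \<mu> S \<bullet> w j = - a j"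
    and nef: "\<And>S j. S \<in> C \<Longrightarrow> \<mu> S \<bullet> w j \<ge> - a j"
  shows "signed_count {} {j. x \<bullet> w j + a j < 0} \<xi> = of_bool (\<forall>j. x \<bullet> w j + a j \<ge> 0)"
proof (cases "\<forall>j. x \<bullet> w j + a j \<ge> 0")
  case True
  then have e: "{j. x \<bullet> w j + a j < 0} = {}" by (auto simp: not_less)
  have "\<exists>S. S \<in> C" using cover by blast
  then show ?thesis unfolding e using True by (auto simp: signed_count_no_flip[OF \<xi>])
next
  case False
  then obtain j where j: "x \<bullet> w j + a j < 0" by (auto simp: not_le)
  define U where "U = {j. x \<bullet> w j + a j < 0}"
  \<comment> \<open>The directions \<open>y\<close> in which \<open>x\<close> lies strictly below
    every \<open>\<mu> S\<close>. This open set contains \<open>w j\<close> for the violated index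
    \<open>j\<close>, so by invariance the count may be taken at a generic \<open>\<xi>'\<close>
    inside it.\<close>
  define K where "K = (\<Inter>S\<in>C. {y. (x - \<mu> S) \<bullet> y < 0})"
  have "open K" unfolding K_def using finite_C by (intro open_INT) (auto intro: open_halfspace_lt)
  moreover have "(x - \<mu> S) \<bullet> w j < 0" if "S \<in> C" for S
    using nef[OF that, of j] j by (simp add: inner_diff_left)
  then have "w j \<in> K" by (auto simp: K_def)
  ultimately obtain \<xi>' where \<xi>': "\<xi>' \<in> K" "generic \<xi>'" using generic_exists[of K] by blast
  have "(\<Prod>i\<in>S. flip U (coord w S \<xi>') i) = 0" if S: "S \<in> C" for S
  proof (rule ccontr)
    assume "(\<Prod>i\<in>S. flip U (coord w S \<xi>') i) \<noteq> 0"
    then have nz: "flip U (coord w S \<xi>') i \<noteq> 0" if "i \<in> S" for i using that by auto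
    have "0 \<le> coord w S \<xi>' i * ((x - \<mu> S) \<bullet> w i)" if i: "i \<in> S" for i
    proof -
      have "(x - \<mu> S) \<bullet> w i = x \<bullet> w i + a i" using vertex[OF S i] by (simp add: inner_diff_left)
      then show ?thesis using nz[OF i]
        by (auto simp: flip_def U_def zero_le_mult_iff split: if_splits)
    qed
    then have "0 \<le> (x - \<mu> S) \<bullet> \<xi>'" by (subst inner_eq_coord_sum[OF S]) (rule sum_nonneg)
    then show False using \<xi>'(1) S by (force simp: K_def)
  qed
  then have "(\<Sum>S\<in>C. \<Prod>i\<in>S. flip U (coord w S \<xi>') i) = 0" by (intro sum.neutral ballI)
  then have "signed_count {} U \<xi>' = 0" by (simp add: signed_count_def)
  then show ?thesis using False signed_count_invariant[OF \<xi> \<xi>'(2)] by (simp add: U_def)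
qed

text \<open>Expands \<open>signed_count_nef\<close>: the product for \<open>S\<close> is nonzero
  exactly if the inequalities with index in \<open>S\<close> that \<open>x\<close> violates are
  those with a negative coordinate of \<open>\<xi>\<close>. The result is a decomposition of
  Lawrence-Varchenko type.\<close>

lemma sum_signed_cones:
  assumes \<xi>: "generic \<xi>"
    and vertex: "\<And>S j. S \<in> C \<Longrightarrow> j \<in> S \<Longrightarrow> \<mu> S \<bullet> w j = - a j"
    and nef: "\<And>S j. S \<in> C \<Longrightarrow> \<mu> S \<bullet> w j \<ge> - a j"
  shows "of_bool (\<forall>j. x \<bullet> w j + a j \<ge> 0) =
    (\<Sum>S\<in>C. (-1) ^ card {i \<in> S. coord w S \<xi> i < 0} *
       of_bool (\<forall>i\<in>S. x \<bullet> w i + a i < 0 \<longleftrightarrow> coord w S \<xi> i < 0) :: real)"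
proof -
  define U where "U = {j. x \<bullet> w j + a j < 0}"
  have "(\<Prod>i\<in>S. flip U (coord w S \<xi>) i) = (-1) ^ card {i \<in> S. coord w S \<xi> i < 0} *
       of_bool (\<forall>i\<in>S. i \<in> U \<longleftrightarrow> coord w S \<xi> i < 0)" if S: "S \<in> C" for S
  proof (cases "\<forall>i\<in>S. i \<in> U \<longleftrightarrow> coord w S \<xi> i < 0")
    case True
    then have "flip U (coord w S \<xi>) i = (if coord w S \<xi> i < 0 then - 1 else 1)" if "i \<in> S" for i
      using that \<xi> S unfolding generic_def flip_def by (auto simp: not_less order.order_iff_strict)
    then have "(\<Prod>i\<in>S. flip U (coord w S \<xi>) i) = (\<Prod>i\<in>S. if coord w S \<xi> i < 0 then - 1 else 1)"
      by (intro prod.cong) auto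
    then show ?thesis using True by (simp add: prod.If_cases Int_def)
  next
    case False
    then obtain i where "i \<in> S" "\<not> (i \<in> U \<longleftrightarrow> coord w S \<xi> i < 0)" by blast
    then have "i \<in> S" "flip U (coord w S \<xi>) i = 0" by (auto simp: flip_def)
    then show ?thesis using False by (auto simp: prod_zero_iff)
  qed
  then show ?thesis using signed_count_nef[OF \<xi> vertex nef, where x = x]
    by (simp add: signed_count_def U_def)
qed

end

section \<open>Differences of lattice point counts\<close>

lemma lat_inner: "lat m \<bullet> lat u = real_of_int (pairing m u)"
  by (simp add: inner_vec_def lat_def pairing_def)

lemma lat_add: "lat (m + m') = lat m + lat m'"
  and lat_diff: "lat (m - m') = lat m - lat m'"
  and lat_0: "lat 0 = 0"
  by (simp_all add: lat_def vec_eq_iff)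

lemma lat_inj: "lat m = lat m' \<longleftrightarrow> m = m'"
  by (simp add: lat_def vec_eq_iff)

locale lattice_cones = simplicial_cones "\<lambda>j. lat (v j)" C
  for v :: "'r::finite \<Rightarrow> int ^ 'n" and C +
  assumes finite_points: "finite {m. \<forall>j. 0 \<le> pairing m (v j) + b $ j}"
begin

abbreviation cd :: "'r set \<Rightarrow> real ^ 'n \<Rightarrow> 'r \<Rightarrow> real" where
  "cd \<equiv> coord (\<lambda>j. lat (v j))"

definition points :: "int ^ 'r \<Rightarrow> (int ^ 'n) set" where
  "points b = {m. \<forall>j. 0 \<le> pairing m (v j) + b $ j}"

text \<open>Cartier data of a semi-ample divisor \<open>b\<close>: the equalities make
  \<open>\<mu> S\<close> the local character on the chart of \<open>S\<close>, and the inequalities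
  place it in the polytope of \<open>b\<close>, where it is the vertex belonging to
  \<open>S\<close>. Several \<open>S\<close> may share one vertex.\<close>

definition nef_data :: "int ^ 'r \<Rightarrow> ('r set \<Rightarrow> int ^ 'n) \<Rightarrow> bool" where
  "nef_data b \<mu> \<longleftrightarrow> (\<forall>S\<in>C. (\<forall>j\<in>S. pairing (\<mu> S) (v j) = - b $ j) \<and> (\<forall>j. - b $ j \<le> pairing (\<mu> S) (v j)))"

lemma nef_data_0: "nef_data 0 (\<lambda>_. 0)"
  by (simp add: nef_data_def)

lemma nef_data_add:
  assumes "nef_data a \<mu>" "nef_data b \<nu>"
  shows "nef_data (a + b) (\<lambda>S. \<mu> S + \<nu> S)"
  using assms unfolding nef_data_def by (simp add: pairing_add) (smt (verit, best))

lemma nef_data_sum: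
  "(\<And>i. i \<in> A \<Longrightarrow> nef_data (a i) (\<mu> i)) \<Longrightarrow> nef_data (\<Sum>i\<in>A. a i) (\<lambda>S. \<Sum>i\<in>A. \<mu> i S)"
  by (induction A rule: infinite_finite_induct) (auto simp: nef_data_0 nef_data_add)

context
  fixes \<xi> :: "real ^ 'n"
  assumes \<xi>: "generic \<xi>"
begin

text \<open>The exponential damping makes the sums over the unbounded cones converge for
  \<open>s > 0\<close>, while at \<open>s = 0\<close> all weights are 1 and a sum counts
  points.\<close>

definition wt :: "real \<Rightarrow> int ^ 'n \<Rightarrow> real" where
  "wt s m = exp (- (s * (lat m \<bullet> \<xi>)))"

lemma wt_add: "wt s (m + m') = wt s m * wt s m'"
  by (simp add: wt_def lat_add inner_add_left algebra_simps flip: exp_add)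

lemma wt_0 [simp]: "wt s 0 = 1"
  by (simp add: wt_def lat_0)

lemma wt_sum: "wt s (\<Sum>i\<in>A. m i) = (\<Prod>i\<in>A. wt s (m i))"
  by (induction A rule: infinite_finite_induct) (auto simp: wt_add)

lemma wt_pos: "wt s m > 0"
  by (simp add: wt_def)

text \<open>The half-open cone of \<open>sum_signed_cones\<close> with its apex moved to the origin.
  On it every summand of \<open>lat m \<bullet> \<xi>\<close> in the coordinates of \<open>S\<close>
  is nonnegative.\<close>

definition flipped_cone :: "'r set \<Rightarrow> (int ^ 'n) set" where
  "flipped_cone S = {m. \<forall>i\<in>S. pairing m (v i) < 0 \<longleftrightarrow> cd S \<xi> i < 0}"

definition gen :: "'r set \<Rightarrow> real \<Rightarrow> real" where
  "gen S s = infsum (wt s) (flipped_cone S)"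

definition sgn_cone :: "'r set \<Rightarrow> real" where
  "sgn_cone S = (-1) ^ card {i \<in> S. cd S \<xi> i < 0}"

text \<open>A point of the cone is determined by the absolute values of its pairings with the
  generators, and its weight is a product of powers of the \<open>q i\<close>; so the sum is part of
  a product of geometric series. This is an upper bound only, as the generators of \<open>S\<close>
  need not form a basis of the lattice.\<close>

lemma sum_wt_flipped_cone_le:
  assumes S: "S \<in> C" and s: "s > 0" and F: "finite F" "F \<subseteq> flipped_cone S"
  shows "(\<Sum>m\<in>F. wt s m) \<le> (\<Prod>i\<in>S. 1 / (1 - exp (- (s * \<bar>cd S \<xi> i\<bar>))))"
proof -
  define q where "q i = exp (- (s * \<bar>cd S \<xi> i\<bar>))" for i
  define n where "n m = (\<lambda>i\<in>S. nat \<bar>pairing m (v i)\<bar>)" for m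
  have wt: "wt s m = (\<Prod>i\<in>S. q i ^ n m i)" if m: "m \<in> flipped_cone S" for m
  proof -
    have "cd S \<xi> i * (lat m \<bullet> lat (v i)) = \<bar>cd S \<xi> i\<bar> * real (n m i)" if i: "i \<in> S" for i
    proof -
      have "pairing m (v i) < 0 \<longleftrightarrow> cd S \<xi> i < 0" using m i unfolding flipped_cone_def by blast
      moreover have "real (n m i) = \<bar>real_of_int (pairing m (v i))\<bar>" using i by (simp add: n_def)
      ultimately show ?thesis by (cases "cd S \<xi> i < 0") (simp_all add: lat_inner)
    qed
    then have "lat m \<bullet> \<xi> = (\<Sum>i\<in>S. \<bar>cd S \<xi> i\<bar> * real (n m i))"
      by (subst inner_eq_coord_sum[OF S]) simp
    moreover have "q i ^ k = exp (- (s * (\<bar>cd S \<xi> i\<bar> * real k)))" for i k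
      by (simp add: q_def mult_ac flip: exp_of_nat_mult)
    ultimately show ?thesis
      by (simp only: wt_def sum_distrib_left sum_negf[symmetric] exp_sum[OF finite])
  qed
  have inj: "inj_on n (flipped_cone S)"
  proof (rule inj_onI)
    fix m m' assume m: "m \<in> flipped_cone S" "m' \<in> flipped_cone S" "n m = n m'"
    have "pairing m (v i) = pairing m' (v i)" if i: "i \<in> S" for i
    proof -
      have "\<bar>pairing m (v i)\<bar> = \<bar>pairing m' (v i)\<bar>" using fun_cong[OF m(3), of i] i by (simp add: n_def)
      moreover have "pairing m (v i) < 0 \<longleftrightarrow> pairing m' (v i) < 0"
        using m(1,2) i unfolding flipped_cone_def by blast
      ultimately show ?thesis by linarith
    qed
    then have "lat (m - m') \<bullet> lat (v i) = 0" if "i \<in> S" for i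
      using that unfolding lat_inner by (simp add: pairing_diff)
    then have "lat (m - m') \<bullet> lat (m - m') = 0"
      by (subst inner_eq_coord_sum[OF S]) simp
    then show "m = m'" by (simp add: lat_diff lat_inj)
  qed
  \<comment> \<open>Exceeds every exponent that occurs for the finite set \<open>F\<close>, so that
    a finite box suffices.\<close>
  define K where "K = Suc (\<Sum>m\<in>F. \<Sum>i\<in>S. n m i)"
  have nK: "n m i < K" if "m \<in> F" "i \<in> S" for m i
  proof -
    have "n m i \<le> (\<Sum>i\<in>S. n m i)" using that by (intro member_le_sum) auto
    also have "\<dots> \<le> (\<Sum>m\<in>F. \<Sum>i\<in>S. n m i)" using that F by (intro member_le_sum[where f = "\<lambda>m. \<Sum>i\<in>S. n m i"]) auto
    finally show ?thesis by (simp add: K_def)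
  qed
  have "(\<Sum>m\<in>F. wt s m) = (\<Sum>m\<in>F. \<Prod>i\<in>S. q i ^ n m i)" using F wt by (intro sum.cong) auto
  also have "\<dots> = (\<Sum>f\<in>n ` F. \<Prod>i\<in>S. q i ^ f i)"
    using inj_on_subset[OF inj F(2)] by (simp add: sum.reindex)
  also have "\<dots> \<le> (\<Sum>f\<in>PiE S (\<lambda>_. {..<K}). \<Prod>i\<in>S. q i ^ f i)"
  proof (rule sum_mono2)
    show "finite (PiE S (\<lambda>_. {..<K}))" by (intro finite_PiE) auto
    show "n ` F \<subseteq> PiE S (\<lambda>_. {..<K})" using nK by (auto simp: n_def PiE_iff extensional_def)
  qed (auto simp: q_def intro: prod_nonneg)
  also have "\<dots> = (\<Prod>i\<in>S. \<Sum>k<K. q i ^ k)" by (rule prod_sum_PiE[symmetric]) auto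
  also have "\<dots> \<le> (\<Prod>i\<in>S. 1 / (1 - q i))"
  proof (rule prod_mono)
    fix i assume i: "i \<in> S"
    have "cd S \<xi> i \<noteq> 0" using \<xi> S i by (auto simp: generic_def)
    then have q: "0 < q i" "q i < 1" using s by (auto simp: q_def)
    then have "(\<Sum>k<K. q i ^ k) = (1 - q i ^ K) / (1 - q i)" by (simp add: sum_gp_strict)
    also have "\<dots> \<le> 1 / (1 - q i)" using q by (intro divide_right_mono) auto
    finally show "0 \<le> (\<Sum>k<K. q i ^ k) \<and> (\<Sum>k<K. q i ^ k) \<le> 1 / (1 - q i)"
      using q by (auto intro: sum_nonneg)
  qed
  finally show ?thesis by (simp add: q_def)
qed

lemma wt_summable:
  assumes "S \<in> C" "s > 0"
  shows "wt s summable_on flipped_cone S"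
  by (rule nonneg_bdd_above_summable_on)
    (auto intro!: bdd_aboveI2 sum_wt_flipped_cone_le[OF assms] less_imp_le[OF wt_pos])

lemma gen_bounds:
  assumes "S \<in> C" "s > 0"
  shows "0 \<le> gen S s" "gen S s \<le> (\<Prod>i\<in>S. 1 / (1 - exp (- (s * \<bar>cd S \<xi> i\<bar>))))"
  unfolding gen_def
  by (auto intro!: infsum_nonneg less_imp_le[OF wt_pos] infsum_le_finite_sums wt_summable
      sum_wt_flipped_cone_le assms)

text \<open>Since \<open>\<mu> S\<close> is a lattice point, the cone at this vertex is a translate
  of \<open>flipped_cone S\<close>, and the degree \<open>b\<close> enters only through the factor
  \<open>wt s (\<mu> S)\<close>; the series \<open>gen S s\<close> is the same for all
  degrees.\<close>

lemma sum_wt_points: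
  assumes nef: "nef_data b \<mu>" and s: "s > 0"
  shows "(\<Sum>m\<in>points b. wt s m) = (\<Sum>S\<in>C. sgn_cone S * wt s (\<mu> S) * gen S s)"
proof -
  have fin: "finite (points b)" unfolding points_def by (rule finite_points)
  have ind: "of_bool (m \<in> points b) = (\<Sum>S\<in>C. sgn_cone S * of_bool (m - \<mu> S \<in> flipped_cone S))" for m
  proof -
    have "of_bool (\<forall>j. lat m \<bullet> lat (v j) + real_of_int (b $ j) \<ge> 0) =
     (\<Sum>S\<in>C. (-1) ^ card {i \<in> S. cd S \<xi> i < 0} *
       of_bool (\<forall>i\<in>S. lat m \<bullet> lat (v i) + real_of_int (b $ i) < 0 \<longleftrightarrow> cd S \<xi> i < 0) :: real)"
    proof (rule sum_signed_cones[OF \<xi>, of "\<lambda>S. lat (\<mu> S)"])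
      fix S j assume S: "S \<in> C"
      show "lat (\<mu> S) \<bullet> lat (v j) = - real_of_int (b $ j)" if "j \<in> S"
        using nef S that unfolding nef_data_def lat_inner by simp
      have "- b $ j \<le> pairing (\<mu> S) (v j)" using nef S unfolding nef_data_def by blast
      then show "- real_of_int (b $ j) \<le> lat (\<mu> S) \<bullet> lat (v j)" unfolding lat_inner by linarith
    qed
    moreover have "(\<forall>j. lat m \<bullet> lat (v j) + real_of_int (b $ j) \<ge> 0) \<longleftrightarrow> m \<in> points b"
    proof -
      have "lat m \<bullet> lat (v j) + real_of_int (b $ j) \<ge> 0 \<longleftrightarrow> 0 \<le> pairing m (v j) + b $ j" for j
        unfolding lat_inner by linarith
      then show ?thesis by (simp add: points_def)
    qed
    moreover have "(\<forall>i\<in>S. lat m \<bullet> lat (v i) + real_of_int (b $ i) < 0 \<longleftrightarrow> cd S \<xi> i < 0) \<longleftrightarrow> m - \<mu> S \<in> flipped_cone S"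
      if S: "S \<in> C" for S
    proof -
      have "lat m \<bullet> lat (v i) + real_of_int (b $ i) < 0 \<longleftrightarrow> pairing (m - \<mu> S) (v i) < 0" if i: "i \<in> S" for i
      proof -
        have "pairing (\<mu> S) (v i) = - b $ i" using nef S i unfolding nef_data_def by blast
        then show ?thesis unfolding lat_inner pairing_diff by linarith
      qed
      then show ?thesis by (simp add: flipped_cone_def)
    qed
    ultimately show ?thesis by (simp add: sgn_cone_def)
  qed
  have cone: "((\<lambda>m. sgn_cone S * of_bool (m - \<mu> S \<in> flipped_cone S) * wt s m) has_sum
      sgn_cone S * wt s (\<mu> S) * gen S s) UNIV" if S: "S \<in> C" for S
  proof -
    have "(wt s has_sum gen S s) (flipped_cone S)"
      unfolding gen_def by (rule has_sum_infsum[OF wt_summable[OF S s]])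
    moreover have "((\<lambda>m. of_bool (m \<in> flipped_cone S) * wt s m) has_sum gen S s) UNIV \<longleftrightarrow>
       (wt s has_sum gen S s) (flipped_cone S)"
      by (rule has_sum_cong_neutral) auto
    ultimately have "((\<lambda>m. of_bool (m \<in> flipped_cone S) * wt s m) has_sum gen S s) UNIV" by simp
    then have "((\<lambda>m. of_bool (m - \<mu> S \<in> flipped_cone S) * wt s (m - \<mu> S)) has_sum gen S s) UNIV"
      by (subst has_sum_reindex_bij_witness[where i = "\<lambda>m. m + \<mu> S" and j = "\<lambda>m. m - \<mu> S" and T = UNIV
            and h = "\<lambda>m. of_bool (m \<in> flipped_cone S) * wt s m"]) auto
    from has_sum_cmult_right[OF this, of "sgn_cone S * wt s (\<mu> S)"]
    have "((\<lambda>m. sgn_cone S * wt s (\<mu> S) * (of_bool (m - \<mu> S \<in> flipped_cone S) * wt s (m - \<mu> S)))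
      has_sum sgn_cone S * wt s (\<mu> S) * gen S s) UNIV" .
    moreover have "sgn_cone S * wt s (\<mu> S) * (of_bool (m - \<mu> S \<in> flipped_cone S) * wt s (m - \<mu> S))
      = sgn_cone S * of_bool (m - \<mu> S \<in> flipped_cone S) * wt s m" for m
      using wt_add[of s "\<mu> S" "m - \<mu> S"] by simp
    ultimately show ?thesis by simp
  qed
  have "((\<lambda>m. \<Sum>S\<in>C'. sgn_cone S * of_bool (m - \<mu> S \<in> flipped_cone S) * wt s m) has_sum
      (\<Sum>S\<in>C'. sgn_cone S * wt s (\<mu> S) * gen S s)) UNIV" if "finite C'" "C' \<subseteq> C" for C'
    using that by (induction C' rule: finite_induct) (auto intro!: has_sum_add cone)
  from this[OF finite_C]
  have "((\<lambda>m. of_bool (m \<in> points b) * wt s m) has_sum (\<Sum>S\<in>C. sgn_cone S * wt s (\<mu> S) * gen S s)) UNIV"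
    by (simp only: ind sum_distrib_right order_refl)
  moreover have "((\<lambda>m. of_bool (m \<in> points b) * wt s m) has_sum (\<Sum>m\<in>points b. wt s m)) UNIV \<longleftrightarrow>
      (wt s has_sum (\<Sum>m\<in>points b. wt s m)) (points b)"
    by (rule has_sum_cong_neutral) auto
  ultimately show ?thesis using has_sum_unique has_sum_finite[OF fin] by blast
qed

text \<open>The vertex of a sum of semi-ample divisors belonging to \<open>S\<close> is the sum of
  their vertices, so for each \<open>S\<close> the alternating sum over \<open>A\<close> is the
  expansion of a product.\<close>

lemma sum_wt_points_difference:
  assumes I: "finite I" and nef: "\<And>i. i \<in> I \<Longrightarrow> nef_data (a i) (\<mu> i)" and nef0: "nef_data b \<nu>" and s: "s > 0"
  shows "(\<Sum>A\<in>Pow I. (-1) ^ card A * (\<Sum>m\<in>points (b + sum a A). wt s m)) =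
    (\<Sum>S\<in>C. sgn_cone S * wt s (\<nu> S) * gen S s * (\<Prod>i\<in>I. 1 - wt s (\<mu> i S)))"
proof -
  have "(\<Sum>m\<in>points (b + sum a A). wt s m) =
     (\<Sum>S\<in>C. sgn_cone S * (wt s (\<nu> S) * (\<Prod>i\<in>A. wt s (\<mu> i S))) * gen S s)" if "A \<in> Pow I" for A
  proof -
    have "nef_data (b + sum a A) (\<lambda>S. \<nu> S + (\<Sum>i\<in>A. \<mu> i S))"
      using that nef by (intro nef_data_add[OF nef0] nef_data_sum) auto
    from sum_wt_points[OF this s] show ?thesis by (simp add: wt_add wt_sum)
  qed
  then have "(\<Sum>A\<in>Pow I. (-1) ^ card A * (\<Sum>m\<in>points (b + sum a A). wt s m)) =
    (\<Sum>A\<in>Pow I. \<Sum>S\<in>C. (-1) ^ card A * (sgn_cone S * (wt s (\<nu> S) * (\<Prod>i\<in>A. wt s (\<mu> i S))) * gen S s))"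
    by (simp add: sum_distrib_left)
  also have "\<dots> = (\<Sum>S\<in>C. \<Sum>A\<in>Pow I. (-1) ^ card A * (sgn_cone S * (wt s (\<nu> S) * (\<Prod>i\<in>A. wt s (\<mu> i S))) * gen S s))"
    by (rule sum.swap)
  also have "\<dots> = (\<Sum>S\<in>C. sgn_cone S * wt s (\<nu> S) * gen S s * (\<Prod>i\<in>I. 1 - wt s (\<mu> i S)))"
  proof (rule sum.cong)
    fix S
    have "(\<Prod>i\<in>I. 1 - wt s (\<mu> i S)) = (\<Sum>A\<in>Pow I. (-1) ^ card A * (\<Prod>i\<in>A. wt s (\<mu> i S)))"
      using prod_diff_conv_sum[OF I, of "\<lambda>_. 1" "\<lambda>i. wt s (\<mu> i S)"] by simp
    then show "(\<Sum>A\<in>Pow I. (-1) ^ card A * (sgn_cone S * (wt s (\<nu> S) * (\<Prod>i\<in>A. wt s (\<mu> i S))) * gen S s))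
      = sgn_cone S * wt s (\<nu> S) * gen S s * (\<Prod>i\<in>I. 1 - wt s (\<mu> i S))"
      by (simp add: sum_distrib_left mult_ac)
  qed simp
  finally show ?thesis .
qed

text \<open>The product has a zero of order \<open>card I\<close> at \<open>s = 0\<close>, and \<open>gen\<close> a pole of order at most the dimension.\<close>

lemma difference_term_tendsto_0:
  assumes I: "finite I" "card I > CARD('n)" and S: "S \<in> C"
  shows "((\<lambda>s. sgn_cone S * wt s m * gen S s * (\<Prod>i\<in>I. 1 - wt s (\<mu> i))) \<longlongrightarrow> 0) (at_right 0)"
proof -
  have cardS: "card S = CARD('n)"
  proof -
    have "card S = card ((\<lambda>j. lat (v j)) ` S)" using inj[OF S] by (simp add: card_image)
    also have "\<dots> = dim ((\<lambda>j. lat (v j)) ` S)" using indep[OF S] by (simp add: dim_eq_card_independent)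
    also have "\<dots> = DIM(real ^ 'n)" using span[OF S] by (metis dim_UNIV dim_span)
    finally show ?thesis by simp
  qed
  have diff: "((\<lambda>s. (1 - exp (- (s * y))) / s) \<longlongrightarrow> y) (at_right 0)" for y :: real
  proof -
    have "((\<lambda>s. 1 - exp (- (s * y))) has_real_derivative y) (at 0)"
      by (auto intro!: derivative_eq_intros)
    then have "((\<lambda>s. (1 - exp (- (s * y))) / s) \<longlongrightarrow> y) (at 0)"
      by (simp add: has_field_derivative_iff)
    then show ?thesis by (rule filterlim_at_split[THEN iffD1, THEN conjunct2])
  qed
  have quot: "((\<lambda>s. s / (1 - exp (- (s * y)))) \<longlongrightarrow> inverse y) (at_right 0)" if "y \<noteq> 0" for y :: real
    using tendsto_inverse[OF diff[of y] that] by simp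
  \<comment> \<open>Redistributes the powers of \<open>s\<close>: \<open>CARD('n)\<close> of them
    cancel the pole of the bound on \<open>gen\<close>, each vanishing factor is divided by one, and
    the positive power that remains tends to 0.\<close>
  define B where "B s = wt s m * (\<Prod>i\<in>S. s / (1 - exp (- (s * \<bar>cd S \<xi> i\<bar>)))) *
      (\<Prod>i\<in>I. \<bar>(1 - wt s (\<mu> i)) / s\<bar>) * s ^ (card I - CARD('n))" for s
  have "(B \<longlongrightarrow> exp (- (0 * (lat m \<bullet> \<xi>))) * (\<Prod>i\<in>S. inverse \<bar>cd S \<xi> i\<bar>) * (\<Prod>i\<in>I. \<bar>lat (\<mu> i) \<bullet> \<xi>\<bar>) * 0 ^ (card I - CARD('n))) (at_right 0)"
    unfolding B_def wt_def
  proof (intro tendsto_mult tendsto_prod tendsto_power tendsto_rabs diff quot tendsto_exp tendsto_minus)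
    show "\<bar>cd S \<xi> i\<bar> \<noteq> 0" if "i \<in> S" for i using \<xi> S that by (auto simp: generic_def)
  qed (auto intro!: tendsto_eq_intros)
  then have B0: "(B \<longlongrightarrow> 0) (at_right 0)" using I(2) by (simp add: power_0_left)
  have "eventually (\<lambda>s. norm (sgn_cone S * wt s m * gen S s * (\<Prod>i\<in>I. 1 - wt s (\<mu> i))) \<le> B s) (at_right 0)"
    using eventually_at_right_less[of 0]
  proof eventually_elim
    case (elim s)
    have "\<bar>sgn_cone S\<bar> = 1" by (simp add: sgn_cone_def power_abs)
    then have "norm (sgn_cone S * wt s m * gen S s * (\<Prod>i\<in>I. 1 - wt s (\<mu> i))) =
       wt s m * gen S s * (\<Prod>i\<in>I. \<bar>1 - wt s (\<mu> i)\<bar>)"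
      using wt_pos[of s m] gen_bounds(1)[OF S elim] by (simp add: abs_mult abs_prod)
    also have "\<dots> \<le> wt s m * (\<Prod>i\<in>S. 1 / (1 - exp (- (s * \<bar>cd S \<xi> i\<bar>)))) * (\<Prod>i\<in>I. \<bar>1 - wt s (\<mu> i)\<bar>)"
      using gen_bounds(2)[OF S elim] wt_pos[of s m]
      by (intro mult_right_mono mult_left_mono prod_nonneg) auto
    also have "(\<Prod>i\<in>S. 1 / (1 - exp (- (s * \<bar>cd S \<xi> i\<bar>)))) =
       (\<Prod>i\<in>S. s / (1 - exp (- (s * \<bar>cd S \<xi> i\<bar>)))) / s ^ CARD('n)"
      using elim by (simp add: prod_dividef cardS)
    also have "(\<Prod>i\<in>I. \<bar>1 - wt s (\<mu> i)\<bar>) = (\<Prod>i\<in>I. \<bar>(1 - wt s (\<mu> i)) / s\<bar>) * s ^ card I"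
      using elim by (simp add: prod_dividef abs_divide)
    also have "s ^ card I = s ^ CARD('n) * s ^ (card I - CARD('n))"
      using I(2) by (simp flip: power_add)
    finally show ?case using elim by (simp add: B_def)
  qed
  then show ?thesis by (rule Lim_null_comparison) (rule B0)
qed

end

text \<open>Both sides of \<open>sum_wt_points_difference\<close> are compared as \<open>s\<close>
  tends to 0 from the right: the right side tends to 0, and the left one is a finite exponential sum
  whose value at 0 is the alternating count.\<close>

theorem lattice_point_difference:
  assumes I: "finite I" "card I > CARD('n)"
    and nef: "\<And>i. i \<in> I \<Longrightarrow> nef_data (a i) (\<mu> i)" and nef0: "nef_data b \<nu>"
  shows "(\<Sum>A\<in>Pow I. (-1) ^ card A * int (card (points (b + sum a A)))) = 0"
proof -
  obtain \<xi> where \<xi>: "generic \<xi>" using generic_exists[of UNIV] by auto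
  define L where "L s = (\<Sum>A\<in>Pow I. (-1) ^ card A * (\<Sum>m\<in>points (b + sum a A). wt \<xi> s m))" for s
  define R where "R s = (\<Sum>S\<in>C. sgn_cone \<xi> S * wt \<xi> s (\<nu> S) * gen \<xi> S s * (\<Prod>i\<in>I. 1 - wt \<xi> s (\<mu> i S)))" for s
  have "(R \<longlongrightarrow> (\<Sum>S\<in>C. 0)) (at_right 0)"
    unfolding R_def by (intro tendsto_sum difference_term_tendsto_0[OF \<xi> I])
  moreover have "eventually (\<lambda>s. R s = L s) (at_right 0)"
    using eventually_at_right_less[of 0]
    by eventually_elim (simp add: L_def R_def sum_wt_points_difference[OF \<xi> I(1) nef nef0])
  ultimately have "(L \<longlongrightarrow> 0) (at_right 0)" by (simp add: tendsto_cong)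
  moreover have "(L \<longlongrightarrow> L 0) (at_right 0)"
    unfolding L_def wt_def[OF \<xi>] by (intro tendsto_intros)
  ultimately have "L 0 = 0" using tendsto_unique trivial_limit_at_right_real by blast
  then have "real_of_int (\<Sum>A\<in>Pow I. (-1) ^ card A * int (card (points (b + sum a A)))) = 0"
    by (simp add: L_def wt_def[OF \<xi>])
  then show ?thesis by linarith
qed

end

section \<open>Complete simplicial fans\<close>

lemma convex_cone_hull_finite:
  fixes V :: "'a::real_vector set"
  assumes "finite V"
  shows "convex_cone hull V = {\<Sum>x\<in>V. c x *\<^sub>R x |c. \<forall>x\<in>V. 0 \<le> c x}" (is "_ = ?R")
proof (rule subset_antisym)
  have "convex_cone ?R"
    unfolding convex_cone_iff
  proof (intro conjI ballI allI impI)
    show "0 \<in> ?R" by (auto intro!: exI[of _ "\<lambda>_. 0"])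
    fix x y assume "x \<in> ?R" "y \<in> ?R"
    then obtain c d where "x = (\<Sum>x\<in>V. c x *\<^sub>R x)" "y = (\<Sum>x\<in>V. d x *\<^sub>R x)"
      "\<forall>x\<in>V. 0 \<le> c x" "\<forall>x\<in>V. 0 \<le> d x" by blast
    then show "x + y \<in> ?R"
      by (auto intro!: exI[of _ "\<lambda>x. c x + d x"] simp: scaleR_add_left sum.distrib)
  next
    fix x and a :: real assume "x \<in> ?R" "0 \<le> a"
    then obtain c where "x = (\<Sum>x\<in>V. c x *\<^sub>R x)" "\<forall>x\<in>V. 0 \<le> c x" by blast
    then show "a *\<^sub>R x \<in> ?R" using \<open>0 \<le> a\<close>
      by (auto intro!: exI[of _ "\<lambda>x. a * c x"] simp: scaleR_sum_right)
  qed
  moreover have "V \<subseteq> ?R"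
  proof
    fix y assume "y \<in> V"
    then have "(\<Sum>x\<in>V. (if x = y then 1 else 0) *\<^sub>R x) = y"
      using assms by (simp add: if_distrib[of "\<lambda>c. c *\<^sub>R _"] sum.delta' cong: if_cong)
    then show "y \<in> ?R" by (auto intro!: exI[of _ "\<lambda>x. if x = y then 1 else 0"])
  qed
  ultimately show "convex_cone hull V \<subseteq> ?R" by (intro hull_minimal)
  show "?R \<subseteq> convex_cone hull V"
  proof
    fix y assume "y \<in> ?R"
    then obtain c where c: "\<forall>x\<in>V. 0 \<le> c x" and y: "y = (\<Sum>x\<in>V. c x *\<^sub>R x)" by blast
    have "(\<Sum>x\<in>W. c x *\<^sub>R x) \<in> convex_cone hull V" if "finite W" "W \<subseteq> V" for W
      using that
    proof (induction W rule: finite_induct)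
      case empty
      then show ?case by (simp add: convex_cone_hull_contains_0)
    next
      case (insert x W)
      then have "c x *\<^sub>R x + (\<Sum>x\<in>W. c x *\<^sub>R x) \<in> convex_cone hull V" using c
        by (intro convex_cone_hull_add convex_cone_hull_mul) (auto intro: hull_inc)
      then show ?case using insert.hyps by simp
    qed
    then show "y \<in> convex_cone hull V" using assms y by blast
  qed
qed

lemma convex_cone_hull_mono_subset: "V \<subseteq> convex_cone hull W \<Longrightarrow> convex_cone hull V \<subseteq> convex_cone hull W"
  by (simp add: hull_minimal convex_cone_convex_cone_hull)

text \<open>Compare a point of the ray of \<open>x\<close> with its expression as a combination of
  all of \<open>W\<close>. A positive coefficient at some other \<open>z\<close> would either make
  \<open>x\<close> redundant or put a negative multiple of \<open>z\<close> into the pointed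
  cone.\<close>

lemma extreme_ray_face:
  fixes W :: "'a::real_vector set"
  assumes W: "finite W" and x: "x \<in> W"
    and pointed: "\<And>y. y \<in> convex_cone hull W \<Longrightarrow> - y \<in> convex_cone hull W \<Longrightarrow> y = 0"
    and min: "\<And>z. z \<in> W \<Longrightarrow> z \<notin> convex_cone hull (W - {z})"
  shows "(convex_cone hull {x}) face_of (convex_cone hull W)"
  unfolding face_of_def
proof (intro conjI ballI impI)
  show "convex_cone hull {x} \<subseteq> convex_cone hull W" using x by (intro hull_mono) auto
  show "convex (convex_cone hull {x})" by (rule convex_convex_cone_hull)
  have nz: "z \<noteq> 0" if "z \<in> W" for z using min[OF that] convex_cone_hull_contains_0 by metis
  have *: "a \<in> convex_cone hull {x} \<and> b \<in> convex_cone hull {x}"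
    if a: "a \<in> convex_cone hull W" and b: "b \<in> convex_cone hull W" and y: "y \<in> convex_cone hull {x}"
      and seg: "y \<in> open_segment a b" for a b y
  proof -
    obtain \<alpha> \<beta> where \<alpha>: "a = (\<Sum>z\<in>W. \<alpha> z *\<^sub>R z)" "\<And>z. z \<in> W \<Longrightarrow> 0 \<le> \<alpha> z"
      and \<beta>: "b = (\<Sum>z\<in>W. \<beta> z *\<^sub>R z)" "\<And>z. z \<in> W \<Longrightarrow> 0 \<le> \<beta> z"
      using a b unfolding convex_cone_hull_finite[OF W] by blast
    obtain l where l: "y = l *\<^sub>R x" "0 \<le> l" using y by (auto simp: convex_cone_hull_finite)
    obtain u where u: "0 < u" "u < 1" "y = (1 - u) *\<^sub>R a + u *\<^sub>R b" using seg by (auto simp: in_segment)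
    define \<gamma> where "\<gamma> z = (1 - u) * \<alpha> z + u * \<beta> z" for z
    have \<gamma>: "0 \<le> \<gamma> z" if "z \<in> W" for z using \<alpha>(2)[OF that] \<beta>(2)[OF that] u by (simp add: \<gamma>_def)
    have "y = (\<Sum>z\<in>W. \<gamma> z *\<^sub>R z)"
      by (simp add: u(3) \<alpha>(1) \<beta>(1) \<gamma>_def scaleR_sum_right sum.distrib scaleR_add_left)
    then have eq: "(l - \<gamma> x) *\<^sub>R x = (\<Sum>z\<in>W - {x}. \<gamma> z *\<^sub>R z)"
      using l(1) W x by (simp add: sum.remove[of W x] algebra_simps)
    have zero: "\<gamma> z = 0" if z: "z \<in> W - {x}" for z
    proof (rule ccontr)
      assume "\<gamma> z \<noteq> 0"
      then have pos: "\<gamma> z > 0" using \<gamma>[of z] z by auto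
      show False
      proof (cases "l > \<gamma> x")
        case True
        have "(\<Sum>z\<in>W - {x}. \<gamma> z *\<^sub>R z) \<in> convex_cone hull (W - {x})"
          using \<gamma> W by (subst convex_cone_hull_finite) auto
        then have "(l - \<gamma> x) *\<^sub>R x \<in> convex_cone hull (W - {x})" unfolding eq .
        from convex_cone_hull_mul[OF this, of "inverse (l - \<gamma> x)"] True
        have "inverse (l - \<gamma> x) *\<^sub>R ((l - \<gamma> x) *\<^sub>R x) \<in> convex_cone hull (W - {x})" by (simp del: scaleR_scaleR)
        moreover have "inverse (l - \<gamma> x) *\<^sub>R ((l - \<gamma> x) *\<^sub>R x) = x" using True by simp
        ultimately show False using min[OF x] by metis
      next
        case False
        have eq1: "- (\<gamma> z *\<^sub>R z) = (\<gamma> x - l) *\<^sub>R x + (\<Sum>z\<in>W - {x} - {z}. \<gamma> z *\<^sub>R z)"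
          using eq W z by (simp add: sum.remove[of "W - {x}" z] algebra_simps)
        have "(\<Sum>z\<in>W - {x} - {z}. \<gamma> z *\<^sub>R z) \<in> convex_cone hull (W - {x} - {z})"
          using \<gamma> W by (subst convex_cone_hull_finite) auto
        then have "(\<Sum>z\<in>W - {x} - {z}. \<gamma> z *\<^sub>R z) \<in> convex_cone hull W"
          using hull_mono[of "W - {x} - {z}" W convex_cone] by blast
        moreover have "(\<gamma> x - l) *\<^sub>R x \<in> convex_cone hull W"
          using False x by (intro convex_cone_hull_mul hull_inc) auto
        ultimately have "- (\<gamma> z *\<^sub>R z) \<in> convex_cone hull W"
          unfolding eq1 by (intro convex_cone_hull_add)
        moreover have "\<gamma> z *\<^sub>R z \<in> convex_cone hull W"
          using z pos by (intro convex_cone_hull_mul hull_inc) auto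
        ultimately have "\<gamma> z *\<^sub>R z = 0" using pointed by blast
        then show False using pos nz z by auto
      qed
    qed
    have "\<alpha> z = 0 \<and> \<beta> z = 0" if z: "z \<in> W - {x}" for z
    proof -
      have "(1 - u) * \<alpha> z + u * \<beta> z = 0" "0 \<le> (1 - u) * \<alpha> z" "0 \<le> u * \<beta> z"
        using zero[OF z] \<alpha>(2)[of z] \<beta>(2)[of z] u z by (auto simp: \<gamma>_def)
      then have "(1 - u) * \<alpha> z = 0" "u * \<beta> z = 0" by linarith+
      then show ?thesis using u by simp
    qed
    then have "a = \<alpha> x *\<^sub>R x" "b = \<beta> x *\<^sub>R x"
      unfolding \<alpha>(1) \<beta>(1) using W x by (simp_all add: sum.remove[of W x])
    then show ?thesis using \<alpha>(2)[OF x] \<beta>(2)[OF x] hull_inc[of x "{x}" convex_cone]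
      by (simp add: convex_cone_hull_mul)
  qed
  show "a \<in> convex_cone hull {x}" "b \<in> convex_cone hull {x}"
    if "a \<in> convex_cone hull W" "b \<in> convex_cone hull W" "y \<in> convex_cone hull {x}" "y \<in> open_segment a b" for a b y
    using *[OF that] by blast+
qed

definition cone_rays :: "('r \<Rightarrow> int ^ 'n) \<Rightarrow> (real ^ 'n) set \<Rightarrow> 'r set" where
  "cone_rays v \<sigma> = {j. ray v j \<subseteq> \<sigma>}"

locale complete_simplicial_fan =
  fixes \<Sigma> :: "(real ^ 'n) set set" and v :: "'r::finite \<Rightarrow> int ^ 'n"
  assumes fan: "fan \<Sigma>" and complete: "complete_fan \<Sigma>"
    and generators: "primitive_ray_generators \<Sigma> v" and simplicial: "simplicial_fan \<Sigma> v"
begin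

abbreviation w :: "'r \<Rightarrow> real ^ 'n" where "w \<equiv> \<lambda>j. lat (v j)"

lemma ray_inj: "ray v i = ray v j \<Longrightarrow> i = j"
  using generators unfolding primitive_ray_generators_def bij_betw_def by (auto dest: injD)

lemma ray_in_fan: "ray v j \<in> \<Sigma>"
  using generators unfolding primitive_ray_generators_def bij_betw_def rays_def by auto

lemma w_in_ray: "w j \<in> ray v j"
  by (simp add: ray_def hull_inc)

lemma cone_is_convex_cone:
  assumes "\<sigma> \<in> \<Sigma>"
  shows "convex_cone \<sigma>"
proof -
  have "rational_polyhedral_cone \<sigma>" using fan assms unfolding fan_def by blast
  then obtain V :: "(int ^ 'n) set" where "\<sigma> = convex_cone hull (lat ` V)"
    unfolding rational_polyhedral_cone_def by blast
  then show ?thesis by (simp add: convex_cone_convex_cone_hull)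
qed

text \<open>A generating set of least cardinality is irredundant, so each of its members spans a
  one-dimensional face by \<open>extreme_ray_face\<close>; the fan contains this face, hence it is
  one of the rays.\<close>

lemma cone_generated_by_rays:
  assumes \<sigma>: "\<sigma> \<in> \<Sigma>"
  shows "\<sigma> = convex_cone hull (w ` cone_rays v \<sigma>)"
proof (rule subset_antisym)
  show "convex_cone hull (w ` cone_rays v \<sigma>) \<subseteq> \<sigma>"
    by (rule hull_minimal) (use cone_is_convex_cone[OF \<sigma>] w_in_ray in \<open>auto simp: cone_rays_def\<close>)
  have "rational_polyhedral_cone \<sigma>" and sc: "strongly_convex \<sigma>" using fan \<sigma> unfolding fan_def by blast+
  then obtain V :: "(int ^ 'n) set" where V: "finite V" "\<sigma> = convex_cone hull (lat ` V)"
    unfolding rational_polyhedral_cone_def by blast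
  define Q where "Q W \<longleftrightarrow> finite W \<and> convex_cone hull W = \<sigma>" for W
  have "Q (lat ` V)" using V by (simp add: Q_def)
  then obtain W where W: "Q W" and least: "\<And>W'. Q W' \<Longrightarrow> card W \<le> card W'"
    using ex_has_least_nat[of Q "lat ` V" card] by blast
  have fin: "finite W" and hull: "convex_cone hull W = \<sigma>" using W by (auto simp: Q_def)
  have min: "z \<notin> convex_cone hull (W - {z})" if z: "z \<in> W" for z
  proof
    assume "z \<in> convex_cone hull (W - {z})"
    then have "W \<subseteq> convex_cone hull (W - {z})" by (auto intro: hull_inc)
    then have "convex_cone hull W \<subseteq> convex_cone hull (W - {z})" by (rule convex_cone_hull_mono_subset)
    moreover have "convex_cone hull (W - {z}) \<subseteq> convex_cone hull W" by (intro hull_mono) auto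
    ultimately have "Q (W - {z})" using fin hull by (simp add: Q_def)
    then show False using least[of "W - {z}"] card_Diff1_less[OF fin z] by simp
  qed
  have pointed: "y = 0" if "y \<in> convex_cone hull W" "- y \<in> convex_cone hull W" for y
  proof -
    have "y \<in> \<sigma> \<inter> uminus ` \<sigma>" using that hull by force
    then show ?thesis using sc unfolding strongly_convex_def by simp
  qed
  have "W \<subseteq> convex_cone hull (w ` cone_rays v \<sigma>)"
  proof
    fix x assume x: "x \<in> W"
    have x0: "x \<noteq> 0" using min[OF x] convex_cone_hull_contains_0 by metis
    have "(convex_cone hull {x}) face_of \<sigma>"
      using extreme_ray_face[OF fin x pointed min] hull by simp
    then have "convex_cone hull {x} \<in> \<Sigma>" using fan \<sigma> convex_cone_hull_nonempty[of "{x}"] unfolding fan_def by blast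
    moreover have "dim (convex_cone hull {x}) = 1"
    proof -
      have "convex_cone hull {x} \<subseteq> span {x}"
        by (rule hull_minimal) (auto simp: convex_cone_span span_base)
      then have "dim (convex_cone hull {x}) \<le> dim {x}" by (metis dim_span dim_subset)
      moreover have "dim {x} \<le> dim (convex_cone hull {x})" by (intro dim_subset) (auto intro: hull_inc)
      moreover have "dim {x} = 1" using x0 by (simp add: dim_eq_card_independent)
      ultimately show ?thesis by simp
    qed
    ultimately have "convex_cone hull {x} \<in> rays \<Sigma>" by (simp add: rays_def)
    then obtain j where j: "ray v j = convex_cone hull {x}"
      using generators unfolding primitive_ray_generators_def bij_betw_def by (metis imageE)
    have "convex_cone hull {x} \<subseteq> \<sigma>" unfolding hull[symmetric] using x by (intro hull_mono) auto
    then have "j \<in> cone_rays v \<sigma>" using j by (simp add: cone_rays_def)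
    then have "ray v j \<subseteq> convex_cone hull (w ` cone_rays v \<sigma>)" unfolding ray_def by (intro hull_mono) auto
    then show "x \<in> convex_cone hull (w ` cone_rays v \<sigma>)" unfolding j by (auto intro: hull_inc)
  qed
  then show "\<sigma> \<subseteq> convex_cone hull (w ` cone_rays v \<sigma>)"
    unfolding hull[symmetric] by (rule convex_cone_hull_mono_subset)
qed

lemma w_inj: "inj w"
proof (rule injI)
  fix i j assume "w i = w j"
  then have "ray v i = ray v j" by (simp add: ray_def)
  then show "i = j" by (rule ray_inj)
qed

lemma cone_elem_iff:
  assumes "\<sigma> \<in> \<Sigma>"
  shows "x \<in> \<sigma> \<longleftrightarrow> (\<exists>c. (\<forall>i\<in>cone_rays v \<sigma>. 0 \<le> c i) \<and> x = (\<Sum>i\<in>cone_rays v \<sigma>. c i *\<^sub>R w i))"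
proof -
  have "x \<in> \<sigma> \<longleftrightarrow> (\<exists>c. (\<forall>y\<in>w ` cone_rays v \<sigma>. 0 \<le> c y) \<and> x = (\<Sum>y\<in>w ` cone_rays v \<sigma>. c y *\<^sub>R y))"
    by (subst cone_generated_by_rays[OF assms], subst convex_cone_hull_finite) auto
  also have "\<dots> \<longleftrightarrow> (\<exists>c. (\<forall>i\<in>cone_rays v \<sigma>. 0 \<le> c (w i)) \<and> x = (\<Sum>i\<in>cone_rays v \<sigma>. c (w i) *\<^sub>R w i))"
    using w_inj by (simp add: sum.reindex inj_on_subset)
  also have "\<dots> \<longleftrightarrow> (\<exists>c. (\<forall>i\<in>cone_rays v \<sigma>. 0 \<le> c i) \<and> x = (\<Sum>i\<in>cone_rays v \<sigma>. c i *\<^sub>R w i))"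
  proof
    assume "\<exists>c. (\<forall>i\<in>cone_rays v \<sigma>. 0 \<le> c i) \<and> x = (\<Sum>i\<in>cone_rays v \<sigma>. c i *\<^sub>R w i)"
    then obtain c where "\<forall>i\<in>cone_rays v \<sigma>. 0 \<le> c i" "x = (\<Sum>i\<in>cone_rays v \<sigma>. c i *\<^sub>R w i)" by blast
    then show "\<exists>c. (\<forall>i\<in>cone_rays v \<sigma>. 0 \<le> c (w i)) \<and> x = (\<Sum>i\<in>cone_rays v \<sigma>. c (w i) *\<^sub>R w i)"
      by (intro exI[of _ "\<lambda>y. c (inv w y)"]) (simp add: inv_f_f[OF w_inj])
  next
    assume "\<exists>c. (\<forall>i\<in>cone_rays v \<sigma>. 0 \<le> c (w i)) \<and> x = (\<Sum>i\<in>cone_rays v \<sigma>. c (w i) *\<^sub>R w i)"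
    then obtain c where "\<forall>i\<in>cone_rays v \<sigma>. 0 \<le> c (w i)" "x = (\<Sum>i\<in>cone_rays v \<sigma>. c (w i) *\<^sub>R w i)" by blast
    then show "\<exists>c. (\<forall>i\<in>cone_rays v \<sigma>. 0 \<le> c i) \<and> x = (\<Sum>i\<in>cone_rays v \<sigma>. c i *\<^sub>R w i)"
      by (intro exI[of _ "\<lambda>i. c (w i)"]) simp
  qed
  finally show ?thesis .
qed

definition max_cones :: "'r set set" where
  "max_cones = {cone_rays v \<sigma> |\<sigma>. \<sigma> \<in> \<Sigma> \<and> span (w ` cone_rays v \<sigma>) = UNIV}"

lemma cone_bases: "cone_bases w max_cones"
proof
  fix S assume "S \<in> max_cones"
  then obtain \<sigma> where \<sigma>: "\<sigma> \<in> \<Sigma>" "span (w ` cone_rays v \<sigma>) = UNIV" "S = cone_rays v \<sigma>" by (auto simp: max_cones_def)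
  have "{lat (v j) |j. ray v j \<subseteq> \<sigma>} = w ` S" unfolding \<sigma>(3) cone_rays_def by blast
  then show "independent (w ` S)" using bspec[OF simplicial[unfolded simplicial_fan_def] \<sigma>(1)] by simp
  show "inj_on w S" using w_inj by (rule inj_on_subset) simp
  show "span (w ` S) = UNIV" using \<sigma> by simp
qed

text \<open>The complement of the closed union of the full-dimensional cones is open and covered by
  finitely many cones of lower dimension; these are negligible, so it is empty.\<close>

lemma max_cones_cover:
  obtains \<sigma> where "\<sigma> \<in> \<Sigma>" "x \<in> \<sigma>" "cone_rays v \<sigma> \<in> max_cones"
proof -
  define \<Phi> where "\<Phi> = {\<sigma> \<in> \<Sigma>. cone_rays v \<sigma> \<in> max_cones}"
  have fin: "finite \<Sigma>" using fan unfolding fan_def by blast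
  have "closed \<sigma>" if "\<sigma> \<in> \<Sigma>" for \<sigma>
    by (subst cone_generated_by_rays[OF that]) (intro closed_convex_cone_hull, simp)
  then have "closed (\<Union>\<Phi>)" using fin by (intro closed_Union) (auto simp: \<Phi>_def)
  then have op: "open (- \<Union>\<Phi>)" by (simp add: open_Compl)
  have "negligible \<sigma>" if \<sigma>: "\<sigma> \<in> \<Sigma> - \<Phi>" for \<sigma>
  proof (rule negligible_lowdim)
    have ne: "span (w ` cone_rays v \<sigma>) \<noteq> UNIV" using \<sigma> unfolding \<Phi>_def max_cones_def by blast
    have "\<sigma> \<subseteq> span (w ` cone_rays v \<sigma>)"
    proof -
      have "convex_cone hull (w ` cone_rays v \<sigma>) \<subseteq> span (w ` cone_rays v \<sigma>)"
        by (intro hull_minimal convex_cone_span span_superset)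
      then show ?thesis using cone_generated_by_rays[of \<sigma>] \<sigma> by blast
    qed
    then have "dim \<sigma> \<le> dim (span (w ` cone_rays v \<sigma>))" by (rule dim_subset)
    also have "\<dots> < DIM(real ^ 'n)" using ne by (metis dim_eq_full dim_span dim_subset_UNIV le_neq_implies_less span_span)
    finally show "dim \<sigma> < DIM(real ^ 'n)" .
  qed
  then have "negligible (\<Union>(\<Sigma> - \<Phi>))" using fin by (intro negligible_Union) auto
  moreover have "- \<Union>\<Phi> \<subseteq> \<Union>(\<Sigma> - \<Phi>)" using complete unfolding complete_fan_def by blast
  ultimately have "- \<Union>\<Phi> = {}" using op open_not_negligible negligible_subset by blast
  then have "x \<in> \<Union>\<Phi>" by auto
  then show thesis using that by (auto simp: \<Phi>_def)
qed

lemma cone_rays_Int: "cone_rays v (\<sigma> \<inter> \<tau>) = cone_rays v \<sigma> \<inter> cone_rays v \<tau>"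
  by (auto simp: cone_rays_def)

lemma Int_in_fan: "\<sigma> \<in> \<Sigma> \<Longrightarrow> \<tau> \<in> \<Sigma> \<Longrightarrow> \<sigma> \<inter> \<tau> \<in> \<Sigma>"
proof -
  assume st: "\<sigma> \<in> \<Sigma>" "\<tau> \<in> \<Sigma>"
  have "0 \<in> \<sigma> \<inter> \<tau>" using cone_is_convex_cone st convex_cone_contains_0 by blast
  then have "\<sigma> \<inter> \<tau> \<noteq> {}" by blast
  moreover have "(\<sigma> \<inter> \<tau>) face_of \<sigma>" using fan st unfolding fan_def by blast
  ultimately show ?thesis using fan st unfolding fan_def by blast
qed

lemma nonneg_combination:
  obtains c where "\<And>j. 0 \<le> c j" "x = (\<Sum>j\<in>UNIV. c j *\<^sub>R w j)"
proof -
  obtain \<sigma> where \<sigma>: "\<sigma> \<in> \<Sigma>" "x \<in> \<sigma>" by (rule max_cones_cover)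
  then obtain c where c: "\<forall>i\<in>cone_rays v \<sigma>. 0 \<le> c i" "x = (\<Sum>i\<in>cone_rays v \<sigma>. c i *\<^sub>R w i)"
    using cone_elem_iff by blast
  have "x = (\<Sum>j\<in>UNIV. (if j \<in> cone_rays v \<sigma> then c j else 0) *\<^sub>R w j)"
    unfolding c(2) by (rule sum.mono_neutral_cong_left) auto
  moreover have "0 \<le> (if j \<in> cone_rays v \<sigma> then c j else 0)" for j using c(1) by auto
  ultimately show thesis by (intro that)
qed

text \<open>The rays span the space positively, so the inequalities bound
  \<open>lat m \<bullet> x\<close> from below for every \<open>x\<close>; taking plus and minus the
  unit vectors bounds all coordinates.\<close>

lemma finite_lattice_points: "finite {m. \<forall>j. 0 \<le> pairing m (v j) + b $ j}"
proof -
  have bd: "\<exists>K. \<forall>m. (\<forall>j. 0 \<le> pairing m (v j) + b $ j) \<longrightarrow> lat m \<bullet> x \<ge> - K" for x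
  proof -
    obtain c where c: "\<And>j. 0 \<le> c j" "x = (\<Sum>j\<in>UNIV. c j *\<^sub>R w j)" by (rule nonneg_combination[of x]) (rule that)
    have "lat m \<bullet> x \<ge> - (\<Sum>j\<in>UNIV. c j * real_of_int (b $ j))" if m: "\<forall>j. 0 \<le> pairing m (v j) + b $ j" for m
    proof -
      have "c j * (- real_of_int (b $ j)) \<le> c j * (lat m \<bullet> w j)" for j
        using m[rule_format, of j] c(1) unfolding lat_inner by (intro mult_left_mono) linarith+
      then have "(\<Sum>j\<in>UNIV. c j * (- real_of_int (b $ j))) \<le> (\<Sum>j\<in>UNIV. c j * (lat m \<bullet> w j))" by (rule sum_mono)
      then show ?thesis by (simp add: c(2) inner_sum_right sum_negf)
    qed
    then show ?thesis by blast
  qed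
  obtain K where K: "\<And>x m. (\<forall>j. 0 \<le> pairing m (v j) + b $ j) \<Longrightarrow> lat m \<bullet> x \<ge> - K x"
    using bd by metis
  define L where "L = (\<Sum>i\<in>UNIV. \<bar>K (axis i 1)\<bar> + \<bar>K (- axis i 1)\<bar>)"
  have "\<bar>m $ i\<bar> \<le> \<lceil>L\<rceil>" if m: "\<forall>j. 0 \<le> pairing m (v j) + b $ j" for m i
  proof -
    have "\<bar>K (axis i 1)\<bar> + \<bar>K (- axis i 1)\<bar> \<le> L" unfolding L_def
      by (rule member_le_sum[where f = "\<lambda>i. \<bar>K (axis i 1)\<bar> + \<bar>K (- axis i 1)\<bar>"]) auto
    moreover have "real_of_int (m $ i) \<ge> - K (axis i 1)" "- real_of_int (m $ i) \<ge> - K (- axis i 1)"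
      using K[OF m, of "axis i 1"] K[OF m, of "- axis i 1"] by (simp_all add: inner_axis lat_def)
    ultimately have "\<bar>real_of_int (m $ i)\<bar> \<le> L" by linarith
    then show ?thesis by linarith
  qed
  then have "{m. \<forall>j. 0 \<le> pairing m (v j) + b $ j} \<subseteq> vec_lambda ` (PiE UNIV (\<lambda>_. {- \<lceil>L\<rceil>..\<lceil>L\<rceil>}))"
    by (auto intro!: image_eqI[of _ _ "vec_nth _"] simp: abs_le_iff) (metis minus_le_iff)
  then show ?thesis by (rule finite_subset) (intro finite_imageI finite_PiE, auto)
qed

text \<open>The intersection of two cones is again a cone of the fan and is generated by the common
  rays; uniqueness of coordinates then yields \<open>inter\<close>.\<close>

sublocale lattice_cones v max_cones
proof -
  interpret cone_bases w max_cones by (rule cone_bases)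
  show "lattice_cones v max_cones"
  proof
    fix S S' x i assume S: "S \<in> max_cones" and S': "S' \<in> max_cones"
      and pos: "\<And>i. i \<in> S \<Longrightarrow> 0 \<le> coord w S x i" "\<And>i. i \<in> S' \<Longrightarrow> 0 \<le> coord w S' x i"
      and i: "i \<in> S - S'"
    obtain \<sigma> \<tau> where \<sigma>: "\<sigma> \<in> \<Sigma>" "S = cone_rays v \<sigma>" and \<tau>: "\<tau> \<in> \<Sigma>" "S' = cone_rays v \<tau>"
      using S S' by (auto simp: max_cones_def)
    have "x \<in> \<sigma>" unfolding cone_elem_iff[OF \<sigma>(1)]
      using pos(1) coord_sum[OF S, of x] by (intro exI[of _ "coord w S x"]) (simp flip: \<sigma>(2))
    moreover have "x \<in> \<tau>" unfolding cone_elem_iff[OF \<tau>(1)]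
      using pos(2) coord_sum[OF S', of x] by (intro exI[of _ "coord w S' x"]) (simp flip: \<tau>(2))
    ultimately have "x \<in> \<sigma>" "x \<in> \<tau>" .
    then have "x \<in> \<sigma> \<inter> \<tau>" by blast
    then obtain c where c: "x = (\<Sum>i\<in>S \<inter> S'. c i *\<^sub>R w i)"
      unfolding cone_elem_iff[OF Int_in_fan[OF \<sigma>(1) \<tau>(1)]] cone_rays_Int \<sigma>(2) \<tau>(2) by blast
    have "x = (\<Sum>i\<in>S. (if i \<in> S' then c i else 0) *\<^sub>R w i)"
      unfolding c by (rule sum.mono_neutral_cong_left) auto
    then show "coord w S x i = 0" using coord_eqI[OF S, of i x "\<lambda>i. if i \<in> S' then c i else 0"] i by auto
  next
    fix x
    obtain \<sigma> where \<sigma>: "\<sigma> \<in> \<Sigma>" "x \<in> \<sigma>" "cone_rays v \<sigma> \<in> max_cones" by (rule max_cones_cover)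
    then obtain c where "\<forall>i\<in>cone_rays v \<sigma>. 0 \<le> c i" "x = (\<Sum>i\<in>cone_rays v \<sigma>. c i *\<^sub>R w i)"
      using cone_elem_iff by blast
    then show "\<exists>S\<in>max_cones. \<forall>i\<in>S. 0 \<le> coord w S x i"
      using \<sigma>(3) coord_eqI[OF \<sigma>(3)] by (intro bexI[of _ "cone_rays v \<sigma>"]) auto
  qed (rule finite_lattice_points)
qed

text \<open>As \<open>- lat m\<close> is a nonnegative combination of the ray generators, the
  assumption gives \<open>lat m \<bullet> (- lat m) \<ge> 0\<close>.\<close>

lemma pairing_nonneg_imp_0:
  assumes "\<And>j. 0 \<le> pairing m (v j)"
  shows "m = 0"
proof -
  obtain c where c: "\<And>j. 0 \<le> c j" "- lat m = (\<Sum>j\<in>UNIV. c j *\<^sub>R w j)" by (rule nonneg_combination[of "- lat m"]) (rule that)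
  have "0 \<le> (\<Sum>j\<in>UNIV. c j * (lat m \<bullet> w j))"
    using c(1) assms by (intro sum_nonneg) (simp add: lat_inner)
  also have "\<dots> = lat m \<bullet> (- lat m)" unfolding c(2) by (simp add: inner_sum_right)
  finally have "lat m \<bullet> lat m = 0" using inner_ge_zero[of "lat m"] by (simp del: inner_ge_zero inner_eq_zero_iff)
  then have "lat m = lat 0" by (simp add: lat_0)
  then show ?thesis by (simp add: lat_inj)
qed

lemma char_div_inj: "char_div v m = char_div v m' \<Longrightarrow> m = m'"
proof -
  assume "char_div v m = char_div v m'"
  then have "pairing (m - m') (v j) = 0" for j by (simp add: vec_eq_iff pairing_diff)
  then have "m - m' = 0" using pairing_nonneg_imp_0[of "m - m'"] by simp
  then show ?thesis by simp
qed

text \<open>Homogenisation: a lattice point \<open>m\<close> of the polytope goes to the monomial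
  whose exponent vector is \<open>a\<close> plus the divisor of the character
  \<open>m\<close>.\<close>

lemma bij_betw_points_monoms: "bij_betw (\<lambda>m. THE c. expo c = a + char_div v m) (points a) (monoms v a)"
proof -
  define \<phi> where "\<phi> m = (THE c. expo c = a + char_div v m)" for m
  have \<phi>: "expo (\<phi> m) = a + char_div v m" if "m \<in> points a" for m
  proof -
    have "0 \<le> (a + char_div v m) $ j" for j using that by (simp add: points_def add.commute)
    then obtain c where "expo c = a + char_div v m" by (rule expo_surj)
    then show ?thesis unfolding \<phi>_def by (rule theI) (simp add: \<open>expo c = _\<close> flip: expo_inj)
  qed
  have "\<phi> ` points a = monoms v a"
  proof (intro subset_antisym subsetI)
    fix c assume "c \<in> \<phi> ` points a"
    then obtain m where "m \<in> points a" "c = \<phi> m" by blast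
    then show "c \<in> monoms v a" using \<phi> by (simp add: monoms_def principal_divisors_eq)
  next
    fix c assume "c \<in> monoms v a"
    then obtain m where "expo c - a = char_div v m" by (auto simp: monoms_def principal_divisors_eq)
    then have m: "expo c = a + char_div v m" by (simp add: algebra_simps)
    then have "a $ j + pairing m (v j) = int (Poly_Mapping.lookup c j)" for j
      by (metis char_div_nth expo_nth vector_add_component)
    then have mp: "m \<in> points a" by (simp add: points_def add.commute)
    then have "\<phi> m = c" using \<phi>[OF mp] m by (simp flip: expo_inj)
    then show "c \<in> \<phi> ` points a" using mp by blast
  qed
  moreover have "inj_on \<phi> (points a)"
    by (rule inj_onI) (metis \<phi> add_left_cancel char_div_inj)
  ultimately show ?thesis by (simp add: bij_betw_def \<phi>_def[abs_def])
qed

lemma card_monoms: "card (monoms v a) = card (points a)"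
  using bij_betw_same_card[OF bij_betw_points_monoms] by simp

sublocale cox_grading v
proof
  show "finite (monoms v a)" for a
    using bij_betw_finite[OF bij_betw_points_monoms] finite_lattice_points by (simp add: points_def)
qed

lemma card_polytope: "card (divisor_polytope v a \<inter> range lat) = card (points a)"
proof -
  have "lat m \<bullet> lat (v j) \<ge> - real_of_int (a $ j) \<longleftrightarrow> 0 \<le> pairing m (v j) + a $ j" for m j
    unfolding lat_inner by linarith
  then have "divisor_polytope v a \<inter> range lat = lat ` points a"
    by (auto simp: divisor_polytope_def points_def)
  moreover have "inj_on lat (points a)" by (simp add: inj_on_def lat_inj)
  ultimately show ?thesis by (simp add: card_image)
qed

end

section \<open>Complete intersections\<close>

lemma ideal_gen_superset: "G \<subseteq> ideal_gen G"
  by (rule module.span_superset[OF module_mult])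

lemma ideal_gen_minimal: "G \<subseteq> I \<Longrightarrow> is_ideal I \<Longrightarrow> ideal_gen G \<subseteq> I"
  by (rule module.span_minimal[OF module_mult])

lemma mem_ideal_gen_image:
  fixes F :: "'i \<Rightarrow> 'a::comm_ring_1"
  assumes A: "finite A" and f: "f \<in> ideal_gen (F ` A)"
  obtains c where "f = (\<Sum>i\<in>A. c i * F i)"
proof -
  define J where "J = {x. \<exists>c. x = (\<Sum>i\<in>A. c i * F i)}"
  have "is_ideal J"
    unfolding is_ideal_iff
  proof (intro conjI ballI allI)
    show "0 \<in> J" unfolding J_def mem_Collect_eq by (rule exI[of _ "\<lambda>_. 0"]) simp
    fix x y assume "x \<in> J" "y \<in> J"
    then obtain c d where cd: "x = (\<Sum>i\<in>A. c i * F i)" "y = (\<Sum>i\<in>A. d i * F i)" unfolding J_def by blast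
    show "x + y \<in> J" unfolding J_def mem_Collect_eq
      by (rule exI[of _ "\<lambda>i. c i + d i"]) (simp add: cd distrib_right sum.distrib)
  next
    fix a x assume "x \<in> J"
    then obtain c where c: "x = (\<Sum>i\<in>A. c i * F i)" unfolding J_def by blast
    show "a * x \<in> J" unfolding J_def mem_Collect_eq
      by (rule exI[of _ "\<lambda>i. a * c i"]) (simp add: c sum_distrib_left mult.assoc)
  qed
  moreover have "F ` A \<subseteq> J"
  proof
    fix x assume "x \<in> F ` A"
    then obtain k where k: "k \<in> A" "x = F k" by blast
    show "x \<in> J" unfolding J_def mem_Collect_eq
      by (rule exI[of _ "\<lambda>i. if i = k then 1 else 0"])
        (simp add: k A if_distrib[of "\<lambda>c. c * _"] sum.delta' cong: if_cong)
  qed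
  ultimately have "f \<in> J" using ideal_gen_minimal[of "F ` A" J] f by blast
  then show thesis using that unfolding J_def by blast
qed

lemma zero_set_ideal_gen: "x \<in> zero_set (ideal_gen G) \<longleftrightarrow> (\<forall>g\<in>G. cox_eval g x = 0)"
proof
  assume "x \<in> zero_set (ideal_gen G)"
  then show "\<forall>g\<in>G. cox_eval g x = 0" using ideal_gen_superset unfolding zero_set_def by blast
next
  assume G: "\<forall>g\<in>G. cox_eval g x = 0"
  have "is_ideal {f. cox_eval f x = 0}" by (simp add: is_ideal_iff)
  then have "ideal_gen G \<subseteq> {f. cox_eval f x = 0}" using G by (intro ideal_gen_minimal) auto
  then show "x \<in> zero_set (ideal_gen G)" by (auto simp: zero_set_def)
qed

text \<open>The last coefficient lies in the ideal of the earlier members, because the last member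
  is a nonzerodivisor modulo them. Writing it in their terms shortens the relation, and the
  correction terms are multiples of the last member.\<close>

lemma regular_sequence_syzygy:
  fixes fs :: "'a::comm_ring_1 list"
  assumes reg: "regular_sequence fs" and k: "k \<le> length fs" and syz: "(\<Sum>j<k. g j * fs ! j) = 0" and j: "j < k"
  shows "g j \<in> ideal_gen (set fs)"
  using k syz j
proof (induction k arbitrary: g j)
  case (Suc k)
  have fsk: "set (take k fs) = (\<lambda>i. fs ! i) ` {..<k}" using nth_image[of k fs] Suc.prems(1) by (simp add: atLeast0LessThan)
  have take: "ideal_gen (set (take k fs)) \<subseteq> ideal_gen (set fs)"
    by (intro module.span_mono[OF module_mult] set_take_subset)
  have "g k * fs ! k = - (\<Sum>j<k. g j * fs ! j)" using Suc.prems(2) by (simp add: add_eq_0_iff2 add.commute)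
  also have "\<dots> \<in> ideal_gen (set (take k fs))"
    by (intro ideal_uminus ideal_sum ideal_mult_left ideal_gen_is_ideal)
      (auto simp: fsk intro!: subsetD[OF ideal_gen_superset])
  finally have gk: "g k \<in> ideal_gen (set (take k fs))"
    using reg Suc.prems(1) unfolding regular_sequence_def by (meson Suc_le_lessD)
  obtain h where h: "g k = (\<Sum>i<k. h i * fs ! i)"
    using mem_ideal_gen_image[of "{..<k}" "g k" "\<lambda>i. fs ! i"] gk unfolding fsk by auto
  have "(\<Sum>j<k. (g j + h j * fs ! k) * fs ! j) = 0"
  proof -
    have "(\<Sum>j<k. (g j + h j * fs ! k) * fs ! j) = (\<Sum>j<k. g j * fs ! j) + (\<Sum>j<k. h j * fs ! j) * fs ! k"
      unfolding distrib_right sum.distrib sum_distrib_right by (simp add: mult_ac)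
    then show ?thesis using Suc.prems(2) by (simp add: h)
  qed
  then have IH: "g j + h j * fs ! k \<in> ideal_gen (set fs)" if "j < k" for j
    using Suc.IH[of "\<lambda>j. g j + h j * fs ! k" j] Suc.prems(1) that by simp
  have fk: "h j * fs ! k \<in> ideal_gen (set fs)" for j
    using Suc.prems(1) by (intro ideal_mult_left ideal_gen_is_ideal subsetD[OF ideal_gen_superset]) auto
  show ?case
  proof (cases "j < k")
    case True
    have "g j + h j * fs ! k - h j * fs ! k \<in> ideal_gen (set fs)"
      by (intro ideal_diff ideal_gen_is_ideal IH True fk)
    then show ?thesis by simp
  next
    case False
    then show ?thesis using gk take Suc.prems(3) by (auto simp: less_Suc_eq)
  qed
qed simp

lemma class_le_iff:
  "class_le v (div_class v a) (div_class v b) \<longleftrightarrow> (\<exists>c. div_class v b = div_class v (a + expo c))"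
proof -
  have eff: "effective_classes v = range (\<lambda>c. div_class v (expo c))"
  proof (intro subset_antisym subsetI)
    fix \<alpha> assume "\<alpha> \<in> effective_classes v"
    then obtain c where c: "\<alpha> = div_class v (\<chi> j. int (c j))" by (auto simp: effective_classes_def)
    obtain d where "expo d = (\<chi> j. int (c j))" by (rule expo_surj[of "\<chi> j. int (c j)"]) auto
    then show "\<alpha> \<in> range (\<lambda>c. div_class v (expo c))" using c by (metis rangeI)
  next
    fix \<alpha> assume "\<alpha> \<in> range (\<lambda>c. div_class v (expo c))"
    then show "\<alpha> \<in> effective_classes v" by (auto simp: effective_classes_def expo_def)
  qed
  show ?thesis unfolding class_le_def eff by (auto simp: div_class_plus)
qed

lemma sum_div_class:
  "finite A \<Longrightarrow> A \<noteq> {} \<Longrightarrow> (\<Sum>i\<in>A. div_class v (a i)) = div_class v (\<Sum>i\<in>A. a i)"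
  by (induction A rule: finite_ne_induct) (simp_all add: div_class_plus)

section \<open>Characters, the group action and its orbits\<close>

definition laurent :: "'k::field ^ 'r::finite \<Rightarrow> int ^ 'r \<Rightarrow> 'k" where
  "laurent x z = (\<Prod>j\<in>UNIV. x $ j powi (z $ j))"

lemma laurent_add: "(\<And>j. x $ j \<noteq> 0) \<Longrightarrow> laurent x (y + z) = laurent x y * laurent x z"
  by (simp add: laurent_def power_int_add prod.distrib)

lemma laurent_mult: "laurent (\<chi> j. x $ j * y $ j) z = laurent x z * laurent y z"
  by (simp add: laurent_def power_int_mult_distrib prod.distrib)

lemma laurent_inverse: "laurent (\<chi> j. inverse (x $ j)) z = inverse (laurent x z)"
  by (simp add: laurent_def power_int_inverse prod_inversef[symmetric] comp_def)

lemma laurent_nonzero: "(\<And>j. x $ j \<noteq> 0) \<Longrightarrow> laurent x z \<noteq> 0"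
  by (simp add: laurent_def)

lemma monom_eval_laurent: "monom_eval c x = laurent x (expo c)"
  by (simp add: monom_eval_def laurent_def)

lemma cox_group_iff: "t \<in> cox_group v \<longleftrightarrow> (\<forall>j. t $ j \<noteq> 0) \<and> (\<forall>m. laurent t (char_div v m) = 1)"
  by (simp add: cox_group_def laurent_def)

lemma quot_map_refl: "x \<in> quot_map v x"
proof -
  have "(\<chi> j. 1) \<in> cox_group v" by (simp add: cox_group_iff laurent_def)
  then show ?thesis unfolding quot_map_def by (rule image_eqI[rotated]) (simp add: vec_eq_iff)
qed

lemma quot_map_cong:
  assumes t: "t \<in> cox_group v"
  shows "quot_map v (\<chi> j. t $ j * x $ j) = quot_map v x"
proof (intro subset_antisym subsetI)
  fix y assume "y \<in> quot_map v (\<chi> j. t $ j * x $ j)"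
  then obtain s where s: "s \<in> cox_group v" "y = (\<chi> j. s $ j * (t $ j * x $ j))" by (auto simp: quot_map_def)
  have "(\<chi> j. s $ j * t $ j) \<in> cox_group v" using s(1) t by (simp add: cox_group_iff laurent_mult)
  then show "y \<in> quot_map v x" unfolding quot_map_def by (rule image_eqI[rotated]) (simp add: s(2) mult.assoc)
next
  fix y assume "y \<in> quot_map v x"
  then obtain s where s: "s \<in> cox_group v" "y = (\<chi> j. s $ j * x $ j)" by (auto simp: quot_map_def)
  have i: "(\<chi> j. inverse (t $ j)) \<in> cox_group v" using t by (simp add: cox_group_iff laurent_inverse)
  have "(\<chi> j. s $ j * (\<chi> j. inverse (t $ j)) $ j) \<in> cox_group v"
    using s(1) i by (simp only: cox_group_iff laurent_mult) simp
  then have "(\<chi> j. s $ j * inverse (t $ j)) \<in> cox_group v" by simp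
  then show "y \<in> quot_map v (\<chi> j. t $ j * x $ j)" unfolding quot_map_def
    by (rule image_eqI[rotated]) (use t in \<open>simp add: s(2) vec_eq_iff cox_group_iff\<close>)
qed

text \<open>The exponents of the monomials of a form differ by principal divisors, on which
  \<open>t\<close> takes the value 1, so translation by \<open>t\<close> multiplies the form by one
  constant.\<close>

lemma cox_eval_forms_translate:
  assumes f: "f \<in> forms v a" and t: "t \<in> cox_group v" and z: "cox_eval f x = 0"
  shows "cox_eval f (\<chi> j. t $ j * x $ j) = 0"
proof (cases "Poly_Mapping.keys f = {}")
  case True
  then show ?thesis by (simp add: cox_eval_def)
next
  case False
  then obtain c0 where c0: "c0 \<in> Poly_Mapping.keys f" by blast
  have tn: "\<And>j. t $ j \<noteq> 0" using t by (simp add: cox_group_iff)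
  have eq: "monom_eval c t = monom_eval c0 t" if c: "c \<in> Poly_Mapping.keys f" for c
  proof -
    have "(expo c - a) - (expo c0 - a) \<in> principal_divisors v"
      by (rule principal_diff) (use f c c0 in \<open>simp_all add: mem_forms\<close>)
    then obtain m where m: "expo c = char_div v m + expo c0" by (auto simp: principal_divisors_eq algebra_simps)
    show ?thesis using t tn by (simp add: monom_eval_laurent m laurent_add cox_group_iff)
  qed
  have ev: "cox_eval f y = (\<Sum>c\<in>Poly_Mapping.keys f. Poly_Mapping.lookup f c * monom_eval c y)" for y
    by (simp add: cox_eval_def monom_eval_def)
  have "cox_eval f (\<chi> j. t $ j * x $ j) =
      (\<Sum>c\<in>Poly_Mapping.keys f. monom_eval c0 t * (Poly_Mapping.lookup f c * monom_eval c x))"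
    unfolding ev using eq by (intro sum.cong) (simp_all add: monom_eval_laurent laurent_mult)
  also have "\<dots> = monom_eval c0 t * cox_eval f x" by (simp add: ev sum_distrib_left)
  finally show ?thesis using z by simp
qed

context complete_simplicial_fan
begin

lemma in_cox_domainI:
  fixes x :: "'k::field ^ 'r"
  assumes "\<sigma> \<in> \<Sigma>" "\<And>j. \<not> ray v j \<subseteq> \<sigma> \<Longrightarrow> x $ j \<noteq> 0"
  shows "x \<in> cox_domain \<Sigma> v"
proof -
  have "cox_eval (\<Prod>j | \<not> ray v j \<subseteq> \<sigma>. cox_var j) x \<noteq> 0" using assms(2) by simp
  then show ?thesis using assms(1) unfolding cox_domain_def irrelevant_ideal_def
    by (auto simp: zero_set_ideal_gen)
qed

text \<open>At the point whose coordinates vanish exactly on \<open>S\<close>, which lies over the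
  fixed point of the chart, some section is nonzero. A monomial responsible for this has exponent 0
  on \<open>S\<close>, and its character is the wanted \<open>\<mu> S\<close>.\<close>

lemma semi_ample_nef_data:
  assumes "semi_ample TYPE('k::field) \<Sigma> v (div_class v a)"
  obtains \<mu> where "nef_data a \<mu>"
proof -
  have "\<exists>m. (\<forall>j\<in>S. pairing m (v j) = - a $ j) \<and> (\<forall>j. - a $ j \<le> pairing m (v j))"
    if S: "S \<in> max_cones" for S
  proof -
    obtain \<sigma> where \<sigma>: "\<sigma> \<in> \<Sigma>" "S = cone_rays v \<sigma>" using S by (auto simp: max_cones_def)
    define x :: "'k ^ 'r" where "x = (\<chi> j. if j \<in> S then 0 else 1)"
    have "x \<in> cox_domain \<Sigma> v" by (rule in_cox_domainI[OF \<sigma>(1)]) (auto simp: x_def \<sigma>(2) cone_rays_def)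
    then obtain f where f: "f \<in> forms v a" "cox_eval f x \<noteq> 0" using assms unfolding semi_ample_def by blast
    then obtain c where c: "c \<in> Poly_Mapping.keys f" "monom_eval c x \<noteq> 0"
      unfolding cox_eval_def monom_eval_def by (auto elim!: sum.not_neutral_contains_not_neutral)
    have 0: "Poly_Mapping.lookup c j = 0" if "j \<in> S" for j
      using c(2) that by (auto simp: monom_eval_def x_def)
    obtain m where m: "expo c - a = char_div v m" using f(1) c(1) by (auto simp: mem_forms principal_divisors_eq)
    have "pairing m (v j) = int (Poly_Mapping.lookup c j) - a $ j" for j
      using arg_cong[OF m, of "\<lambda>z. z $ j"] by simp
    then show ?thesis using 0 by (intro exI[of _ m]) simp
  qed
  then have "\<exists>\<mu>. \<forall>S\<in>max_cones. (\<forall>j\<in>S. pairing (\<mu> S) (v j) = - a $ j) \<and> (\<forall>j. - a $ j \<le> pairing (\<mu> S) (v j))"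
    by (intro bchoice) blast
  then show thesis using that unfolding nef_data_def by blast
qed

text \<open>By completeness the only monomial of trivial degree is 1, so the component of degree 0
  of \<open>f\<close> is its constant term; if nonzero, it would be a unit in
  \<open>I\<close>.\<close>

lemma lookup_proper_homogeneous_ideal:
  fixes I :: "('r, 'k::field) cox_ring set"
  assumes I: "is_ideal I" and hom: "\<And>f. f \<in> I \<Longrightarrow> homog_part v 0 f \<in> I" and proper: "I \<noteq> UNIV"
    and f: "f \<in> I"
  shows "cox_eval f 0 = 0"
proof (rule ccontr)
  assume nz: "cox_eval f 0 \<noteq> 0"
  have m0: "monom_eval c (0 :: 'k ^ 'r) = (if c = 0 then 1 else 0)" for c :: "'r \<Rightarrow>\<^sub>0 nat"
    by (auto simp: monom_eval_def poly_mapping_eq_iff fun_eq_iff prod_zero_iff)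
  have key0: "c = 0" if c: "expo c - 0 \<in> principal_divisors v" for c
  proof -
    obtain m where m: "expo c = char_div v m" using c by (auto simp: principal_divisors_eq)
    have "0 \<le> pairing m (v j)" for j using arg_cong[OF m, of "\<lambda>z. z $ j"] by simp
    then have "m = 0" by (rule pairing_nonneg_imp_0)
    then show "c = 0" using m by (simp add: char_div_0 flip: expo_inj)
  qed
  define k where "k = Poly_Mapping.lookup f 0"
  have "homog_part v 0 f = cox_const k"
  proof (rule poly_mapping_eqI)
    fix c
    show "Poly_Mapping.lookup (homog_part v 0 f) c = Poly_Mapping.lookup (cox_const k) c"
      using key0[of c] by (auto simp: lookup_homog_part cox_const_def lookup_single when_def k_def)
  qed
  then have kI: "cox_const k \<in> I" using hom[OF f] by simp
  have "cox_eval f 0 = (\<Sum>c\<in>insert 0 (Poly_Mapping.keys f). Poly_Mapping.lookup f c * monom_eval c 0)"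
    by (rule cox_eval_superset) auto
  also have "\<dots> = k" by (simp add: m0 k_def if_distrib sum.delta' cong: if_cong)
  finally have "k \<noteq> 0" using nz by simp
  then have "cox_const (inverse k) * cox_const k = (1 :: ('r, 'k) cox_ring)"
    by (simp add: cox_const_def mult_single)
  then have "1 \<in> I" using ideal_mult_left[OF I kI, of "cox_const (inverse k)"] by simp
  then have "g \<in> I" for g using ideal_mult_left[OF I, of 1 g] by simp
  then show False using proper by blast
qed

text \<open>
  Writing \<open>F\<close> and the regular sequence \<open>f\<close> in terms of each other, the product of the two
  coefficient matrices is the identity modulo the ideal.  Evaluation at the origin makes it the
  identity, and a nonzero term of the Leibniz expansion gives the matching of degrees.
\<close>

lemma regular_sequence_degrees_unique:
  fixes F f :: "'n \<Rightarrow> ('r, 'k::field) cox_ring"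
  assumes F: "\<And>i. F i \<in> forms v (a i)" and f: "\<And>i. f i \<in> forms v (d i)"
    and gen: "ideal_gen (range F) = I" "ideal_gen (range f) = I" and proper: "I \<noteq> UNIV"
    and syz: "\<forall>g. (\<Sum>i\<in>UNIV. g i * f i) = 0 \<longrightarrow> (\<forall>i. g i \<in> I)"
  obtains p where "p permutes UNIV" "\<And>i. div_class v (a i) = div_class v (d (p i))"
proof -
  have I: "is_ideal I" using ideal_gen_is_ideal[of "range F"] gen(1) by simp
  have hI: "homog_part v 0 g \<in> I" if "g \<in> I" for g
    using homog_part_ideal_gen[of "range F" v g 0] F that gen(1) by blast
  note ev0 = lookup_proper_homogeneous_ideal[OF I hI proper]
  have "\<exists>c. F i = (\<Sum>j\<in>UNIV. c j * f j)" for i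
  proof -
    have "F i \<in> ideal_gen (range f)" using subsetD[OF ideal_gen_superset[of "range F"], of "F i"] gen by simp
    from mem_ideal_gen_image[OF finite this] show ?thesis by blast
  qed
  then have "\<exists>M0. \<forall>i. F i = (\<Sum>j\<in>UNIV. M0 i j * f j)" by (intro choice allI)
  then obtain M0 where M0: "\<And>i. F i = (\<Sum>j\<in>UNIV. M0 i j * f j)" by blast
  \<comment> \<open>Only components of the expected degree are kept; thus a nonzero constant term of
    an entry will force its degree \<open>a i - d j\<close> to be trivial.\<close>
  define M where "M i j = homog_part v (a i - d j) (M0 i j)" for i j
  have M: "F i = (\<Sum>j\<in>UNIV. M i j * f j)" for i
  proof -
    have "F i = homog_part v (a i) (\<Sum>j\<in>UNIV. M0 i j * f j)" by (simp only: M0[symmetric] homog_part_id[OF F])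
    also have "\<dots> = (\<Sum>j\<in>UNIV. M i j * f j)" by (simp add: homog_part_sum homog_part_mult[OF f] M_def)
    finally show ?thesis .
  qed
  have "\<exists>c. f j = (\<Sum>i\<in>UNIV. c i * F i)" for j
  proof -
    have "f j \<in> ideal_gen (range F)" using subsetD[OF ideal_gen_superset[of "range f"], of "f j"] gen by simp
    from mem_ideal_gen_image[OF finite this] show ?thesis by blast
  qed
  then have "\<exists>N. \<forall>j. f j = (\<Sum>i\<in>UNIV. N j i * F i)" by (intro choice allI)
  then obtain N where N: "\<And>j. f j = (\<Sum>i\<in>UNIV. N j i * F i)" by blast
  have NM: "(\<Sum>i\<in>UNIV. cox_eval (N k i) 0 * cox_eval (M i l) 0) = (if k = l then 1 else 0)" for k l
  proof -
    \<comment> \<open>A row of the product matrix minus the identity is a syzygy of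
      \<open>f\<close>, so its entries lie in \<open>I\<close> and vanish at the origin.\<close>
    define g where "g l = (\<Sum>i\<in>UNIV. N k i * M i l) - (if k = l then 1 else 0)" for l
    have "(\<Sum>l\<in>UNIV. (\<Sum>i\<in>UNIV. N k i * M i l) * f l) = (\<Sum>l\<in>UNIV. \<Sum>i\<in>UNIV. N k i * (M i l * f l))"
      by (simp add: sum_distrib_right mult.assoc)
    also have "\<dots> = (\<Sum>i\<in>UNIV. N k i * (\<Sum>l\<in>UNIV. M i l * f l))"
      by (subst sum.swap) (simp add: sum_distrib_left)
    also have "\<dots> = f k" by (simp only: M[symmetric] N[symmetric])
    finally have "(\<Sum>l\<in>UNIV. g l * f l) = 0"
      by (simp add: g_def left_diff_distrib sum_subtractf if_distrib[of "\<lambda>c. c * _"] sum.delta cong: if_cong)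
    then have "cox_eval (g l) 0 = 0" using syz ev0 by blast
    then show ?thesis by (simp add: g_def split: if_splits)
  qed
  define A :: "'k ^ 'n ^ 'n" where "A = (\<chi> i l. cox_eval (M i l) 0)"
  define B :: "'k ^ 'n ^ 'n" where "B = (\<chi> k i. cox_eval (N k i) 0)"
  have "B ** A = mat 1" by (simp add: A_def B_def matrix_matrix_mult_def mat_def vec_eq_iff NM)
  then have "det B * det A = 1" by (metis det_I det_mul)
  then have "det A \<noteq> 0" by auto
  then obtain p where p: "p permutes UNIV" "(\<Prod>i\<in>UNIV. A $ i $ p i) \<noteq> 0"
    unfolding det_def by (auto elim!: sum.not_neutral_contains_not_neutral)
  show thesis
  proof (rule that[OF p(1)])
    fix i
    have "cox_eval (M i (p i)) 0 \<noteq> 0" using p(2) by (simp add: A_def)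
    then obtain c where c: "c \<in> Poly_Mapping.keys (M i (p i))" "monom_eval c (0 :: 'k ^ 'r) \<noteq> 0"
      unfolding cox_eval_def monom_eval_def by (auto elim!: sum.not_neutral_contains_not_neutral)
    have "c = 0" using c(2) by (auto simp: monom_eval_def poly_mapping_eq_iff fun_eq_iff prod_zero_iff)
    then have "expo 0 - (a i - d (p i)) \<in> principal_divisors v"
      using c(1) homog_part_forms[of v "a i - d (p i)" "M0 i (p i)"] unfolding M_def mem_forms by blast
    then have "- (expo 0 - (a i - d (p i))) \<in> principal_divisors v" by (rule principal_uminus)
    then show "div_class v (a i) = div_class v (d (p i))" by (simp add: div_class_eq_iff)
  qed
qed

text \<open>The formula for the regular sequence \<open>fs\<close> involves the degrees of
  \<open>fs\<close>; the permutation from \<open>regular_sequence_degrees_unique\<close> and an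
  enumeration \<open>h\<close> of the index type translate it to the degrees of
  \<open>F\<close>.\<close>

lemma hilbert_function_complete_intersection:
  fixes F :: "'n \<Rightarrow> ('r, 'k::field) cox_ring"
  assumes ci: "complete_intersection v I CARD('n)" and gen: "ideal_gen (range F) = I"
    and F: "\<And>i. F i \<in> forms v (a i)"
  shows "int (hilbert_function v I (div_class v x)) =
    (\<Sum>A\<in>Pow UNIV. (-1) ^ card A * int (card (points (x - sum a A))))"
proof -
  obtain fs where fs: "length fs = CARD('n)" "\<forall>f\<in>set fs. homogeneous v f" "regular_sequence fs"
    "ideal_gen (set fs) = I" using ci unfolding complete_intersection_def by blast
  have "\<exists>d. fs ! i \<in> forms v d" if "i < length fs" for i
    using fs(2) that unfolding homogeneous_def class_group_def by (metis nth_mem rangeE)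
  then obtain d where d: "\<And>i. i < length fs \<Longrightarrow> fs ! i \<in> forms v (d i)" by metis
  obtain h :: "'n \<Rightarrow> nat" where h: "bij_betw h UNIV {..<CARD('n)}"
    using finite_same_card_bij[of "UNIV :: 'n set" "{..<CARD('n)}"] by auto
  have hl: "h i < length fs" for i using h fs(1) by (auto simp: bij_betw_def)
  define f where "f i = fs ! h i" for i
  have "(\<lambda>i. fs ! i) ` (h ` UNIV) = set fs" using h fs(1) by (auto simp: bij_betw_def set_conv_nth)
  then have gf: "ideal_gen (range f) = I" using fs(4) by (simp add: f_def image_image)
  have proper: "I \<noteq> UNIV" using fs(3,4) unfolding regular_sequence_def by blast
  have syz: "g i \<in> I" if g: "(\<Sum>i\<in>UNIV. g i * f i) = 0" for g i
  proof -
    have "(\<Sum>k<length fs. g (inv_into UNIV h k) * fs ! k) = (\<Sum>i\<in>UNIV. g (inv_into UNIV h (h i)) * fs ! h i)"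
      unfolding fs(1) by (rule sum.reindex_bij_betw[OF h, symmetric])
    also have "\<dots> = 0" using g h by (simp add: f_def bij_betw_def)
    finally have "g (inv_into UNIV h (h i)) \<in> I"
      using regular_sequence_syzygy[OF fs(3) order_refl, of "\<lambda>k. g (inv_into UNIV h k)" "h i"] hl fs(4) by simp
    then show ?thesis using h by (simp add: bij_betw_def)
  qed
  have f: "f i \<in> forms v (d (h i))" for i using d[OF hl] by (simp add: f_def)
  obtain p where p: "p permutes UNIV" "\<And>i. div_class v (a i) = div_class v (d (h (p i)))"
    by (rule regular_sequence_degrees_unique[OF F f gen gf proper]) (use syz in blast, rule that)
  have q: "bij_betw (h \<circ> p) UNIV {..<CARD('n)}"
    using h permutes_imp_bij[OF p(1)] by (rule bij_betw_trans[rotated])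
  have "int (hilbert_function v I (div_class v x)) =
     (\<Sum>B\<in>Pow {..<CARD('n)}. (-1) ^ card B * int (card (monoms v (x - sum d B))))"
    using hilbert_function_regular_sequence[OF fs(3) d order_refl, of x] fs(1,4) by simp
  also have "\<dots> = (\<Sum>A\<in>Pow UNIV. (-1) ^ card ((h \<circ> p) ` A) * int (card (monoms v (x - sum d ((h \<circ> p) ` A)))))"
    by (rule sum.reindex_bij_betw[OF bij_betw_Pow[OF q], symmetric])
  also have "\<dots> = (\<Sum>A\<in>Pow UNIV. (-1) ^ card A * int (card (points (x - sum a A))))"
  proof (rule sum.cong)
    fix A :: "'n set"
    have inj: "inj_on (h \<circ> p) A" using q by (meson bij_betw_def inj_on_subset subset_UNIV)
    have "(\<Sum>i\<in>A. a i - d (h (p i))) \<in> principal_divisors v"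
      using p(2) by (induction A rule: infinite_finite_induct) (auto intro: principal_add simp: div_class_eq_iff)
    moreover have "sum d ((h \<circ> p) ` A) = (\<Sum>i\<in>A. d (h (p i)))" by (subst sum.reindex[OF inj]) simp
    ultimately have "div_class v (x - sum d ((h \<circ> p) ` A)) = div_class v (x - sum a A)"
      by (simp only: div_class_eq_iff sum_subtractf) simp
    then have "monoms v (x - sum d ((h \<circ> p) ` A)) = monoms v (x - sum a A)" by (rule monoms_cong)
    then show "(-1) ^ card ((h \<circ> p) ` A) * int (card (monoms v (x - sum d ((h \<circ> p) ` A)))) =
      (-1) ^ card A * int (card (points (x - sum a A)))"
      by (simp only: card_image[OF inj] card_monoms)
  qed simp
  finally show ?thesis .
qed

section \<open>Constancy along the multiples of the sum of the degrees\<close>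

lemma nef_data_multiple: "nef_data b \<mu> \<Longrightarrow> \<exists>\<nu>. nef_data (int k *s b) \<nu>"
proof (induction k)
  case 0
  have "int 0 *s b = 0" by (simp add: vec_eq_iff)
  then show ?case using nef_data_0 by auto
next
  case (Suc k)
  then obtain \<nu> where "nef_data (int k *s b) \<nu>" by blast
  from nef_data_add[OF Suc.prems this] show ?case
    by (auto simp: vec_eq_iff algebra_simps)
qed

text \<open>\<open>D\<close> is the n-fold mixed difference in the directions \<open>a i\<close>.
  With \<open>e\<close> as one more direction the difference has order n + 1 and vanishes; splitting
  it by whether \<open>e\<close> is used gives \<open>D b = D (b + e)\<close> at the multiples
  \<open>b\<close> of \<open>e\<close>.\<close>

lemma alternating_points_constant:
  fixes a :: "'n \<Rightarrow> int ^ 'r"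
  assumes nef: "\<And>i. nef_data (a i) (\<mu> i)"
  defines "e \<equiv> \<Sum>i\<in>UNIV. a i"
  defines "D \<equiv> \<lambda>b. \<Sum>A\<in>Pow UNIV. (-1) ^ card A * int (card (points (b + sum a A)))"
  shows "D (int k *s e) = D 0"
proof (induction k)
  case 0
  have "int 0 *s e = 0" by (simp add: vec_eq_iff)
  then show ?case by simp
next
  case (Suc k)
  \<comment> \<open>The index \<open>None\<close> stands for the additional direction
    \<open>e\<close>.\<close>
  define a' where "a' = case_option e a"
  define \<mu>' where "\<mu>' = case_option (\<lambda>S. \<Sum>i\<in>UNIV. \<mu> i S) \<mu>"
  have ne: "nef_data e (\<lambda>S. \<Sum>i\<in>UNIV. \<mu> i S)" unfolding e_def by (intro nef_data_sum nef)
  then obtain \<nu> where \<nu>: "nef_data (int k *s e) \<nu>" using nef_data_multiple by blast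
  have nef': "nef_data (a' i) (\<mu>' i)" for i using ne nef by (cases i) (auto simp: a'_def \<mu>'_def)
  define f where "f B = (-1) ^ card B * int (card (points (int k *s e + sum a' B)))" for B
  have bij: "bij_betw Some UNIV (range (Some :: 'n \<Rightarrow> 'n option))" by (simp add: bij_betw_def)
  have s: "sum a' (Some ` A) = sum a A" for A by (simp add: sum.reindex a'_def)
  have "(\<Sum>B\<in>Pow (UNIV :: 'n option set). f B) = 0"
    unfolding f_def by (rule lattice_point_difference[OF _ _ nef' \<nu>]) auto
  then have "0 = (\<Sum>B\<in>Pow (range (Some :: 'n \<Rightarrow> 'n option)). f B) + (\<Sum>B\<in>Pow (range (Some :: 'n \<Rightarrow> 'n option)). f (insert None B))"
    unfolding UNIV_option_conv by (subst (asm) sum_Pow_insert) auto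
  also have "(\<Sum>B\<in>Pow (range (Some :: 'n \<Rightarrow> 'n option)). f B) = (\<Sum>A\<in>Pow UNIV. f (Some ` A))"
    by (rule sum.reindex_bij_betw[OF bij_betw_Pow[OF bij], symmetric])
  also have "\<dots> = D (int k *s e)" by (simp add: f_def D_def s card_image)
  also have "(\<Sum>B\<in>Pow (range (Some :: 'n \<Rightarrow> 'n option)). f (insert None B)) = (\<Sum>A\<in>Pow UNIV. f (insert None (Some ` A)))"
    by (rule sum.reindex_bij_betw[OF bij_betw_Pow[OF bij], symmetric])
  also have "\<dots> = (\<Sum>A\<in>Pow UNIV. - ((-1) ^ card A * int (card (points (int (Suc k) *s e + sum a A)))))"
  proof (rule sum.cong)
    fix A :: "'n set"
    have "None \<notin> Some ` A" by auto
    then have "sum a' (insert None (Some ` A)) = e + sum a A" "card (insert None (Some ` A)) = Suc (card A)"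
      by (simp_all add: s card_image) (simp add: a'_def)
    moreover have "int (Suc k) *s e = int k *s e + e" by (simp add: vec_eq_iff algebra_simps)
    ultimately show "f (insert None (Some ` A)) = - ((-1) ^ card A * int (card (points (int (Suc k) *s e + sum a A))))"
      by (simp add: f_def ac_simps)
  qed simp
  also have "\<dots> = - D (int (Suc k) *s e)" by (simp add: D_def sum_negf)
  finally show ?case using Suc.IH by simp
qed

text \<open>Passing to complements of subsets writes the Hilbert function in degree
  \<open>b + e\<close> as a sign times \<open>D b\<close>, where only semi-ample degrees occur if
  \<open>b\<close> is a multiple of \<open>e\<close>. Hence the multiples start with
  \<open>e\<close> itself, the case \<open>b = 0\<close>.\<close>

lemma hilbert_function_multiples_constant:
  fixes F :: "'n \<Rightarrow> ('r, 'k::field) cox_ring"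
  assumes ci: "complete_intersection v I CARD('n)" and gen: "ideal_gen (range F) = I"
    and F: "\<And>i. F i \<in> forms v (a i)" and nef: "\<And>i. nef_data (a i) (\<mu> i)"
  shows "hilbert_function v I (div_class v (int (Suc k) *s (\<Sum>i\<in>UNIV. a i))) =
    hilbert_function v I (div_class v (\<Sum>i\<in>UNIV. a i))"
proof -
  define e where "e = (\<Sum>i\<in>UNIV. a i)"
  define D where "D b = (\<Sum>A\<in>Pow (UNIV :: 'n set). (-1) ^ card A * int (card (points (b + sum a A))))" for b
  have bij: "bij_betw uminus (Pow (UNIV :: 'n set)) (Pow UNIV)"
    by (rule bij_betwI[of _ _ _ uminus]) auto
  have H: "int (hilbert_function v I (div_class v (b + e))) = (-1) ^ CARD('n) * D b" for b
  proof -
    have "int (hilbert_function v I (div_class v (b + e))) =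
       (\<Sum>A\<in>Pow (UNIV :: 'n set). (-1) ^ card (- A) * int (card (points (b + e - sum a (- A)))))"
      unfolding hilbert_function_complete_intersection[OF ci gen F]
      by (rule sum.reindex_bij_betw[OF bij, symmetric])
    also have "\<dots> = (\<Sum>A\<in>Pow (UNIV :: 'n set). (-1) ^ CARD('n) * ((-1) ^ card A * int (card (points (b + sum a A)))))"
    proof (rule sum.cong)
      fix A :: "'n set"
      have "sum a A + sum a (- A) = e" unfolding e_def
        by (subst sum.union_disjoint[symmetric]) auto
      then have 1: "b + e - sum a (- A) = b + sum a A" by (simp add: algebra_simps)
      have "card A + card (- A) = CARD('n)"
        by (subst card_Un_disjoint[symmetric]) auto
      then have "CARD('n) + card A = card (- A) + 2 * card A" by simp
      then have "(-1 :: int) ^ CARD('n) * (-1) ^ card A = (-1) ^ (card (- A) + 2 * card A)"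
        by (metis power_add)
      also have "\<dots> = (-1) ^ card (- A)" by (simp add: power_add)
      finally show "(-1) ^ card (- A) * int (card (points (b + e - sum a (- A)))) =
         (-1) ^ CARD('n) * ((-1) ^ card A * int (card (points (b + sum a A))))"
        by (simp add: 1 mult.assoc[symmetric])
    qed simp
    finally show ?thesis by (simp add: D_def sum_distrib_left)
  qed
  have D: "D (int k *s e) = D 0" unfolding D_def e_def by (rule alternating_points_constant[OF nef])
  have eq: "int (Suc k) *s e = int k *s e + e" by (simp add: vec_eq_iff algebra_simps)
  have "int (hilbert_function v I (div_class v (int (Suc k) *s e))) = (-1) ^ CARD('n) * D 0"
    unfolding eq H D ..
  also have "\<dots> = int (hilbert_function v I (div_class v e))" using H[of 0] by simp
  finally show ?thesis by (simp only: e_def of_nat_eq_iff)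
qed

end

section \<open>Points in the torus\<close>

locale torus_points = complete_simplicial_fan \<Sigma> v
  for \<Sigma> :: "(real ^ 'n) set set" and v :: "'r::finite \<Rightarrow> int ^ 'n" +
  fixes Y :: "('k::alg_closed_field ^ 'r) set set" and I :: "('r, 'k) cox_ring set"
  assumes finite_Y: "finite Y" and Y_torus: "Y \<subseteq> dense_torus v" and defining: "defining_ideal \<Sigma> v Y I"
begin

lemma radical_I: "radical_ideal I"
  and sat_I: "saturated (irrelevant_ideal \<Sigma> v) I"
  and Y_eq: "Y = quot_map v ` (cox_domain \<Sigma> v \<inter> zero_set I)"
  using defining by (simp_all add: defining_ideal_def)

lemma ideal_I: "is_ideal I"
  using radical_I by (simp add: radical_ideal_def)

lemmas subspace_I = ideal_subspace[OF ideal_I]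

text \<open>A zero of \<open>I\<close> outside \<open>cox_domain\<close> is a zero of the irrelevant
  ideal, so \<open>f * b\<close> vanishes on all zeros of \<open>I\<close> for every
  \<open>b\<close> in that ideal. The Nullstellensatz and saturation, with exponent 1, then give
  \<open>f \<in> I\<close>.\<close>

lemma mem_I_iff: "f \<in> I \<longleftrightarrow> (\<forall>x\<in>cox_domain \<Sigma> v \<inter> zero_set I. cox_eval f x = 0)"
proof
  show "\<forall>x\<in>cox_domain \<Sigma> v \<inter> zero_set I. cox_eval f x = 0" if "f \<in> I"
    using that by (auto simp: zero_set_def)
  assume f: "\<forall>x\<in>cox_domain \<Sigma> v \<inter> zero_set I. cox_eval f x = 0"
  have "f * b \<in> I" if b: "b \<in> irrelevant_ideal \<Sigma> v" for b
  proof (rule nullstellensatz[OF radical_I])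
    fix x assume "x \<in> zero_set I"
    then show "cox_eval (f * b) x = 0"
      using f b by (cases "x \<in> cox_domain \<Sigma> v") (auto simp: cox_domain_def zero_set_def)
  qed
  then have "\<exists>k. \<forall>b :: nat \<Rightarrow> ('r, 'k) cox_ring. (\<forall>i<k. b i \<in> irrelevant_ideal \<Sigma> v) \<longrightarrow> f * (\<Prod>i<k. b i) \<in> I"
    by (intro exI[of _ 1]) simp
  then show "f \<in> I" using sat_I unfolding saturated_def by blast
qed

text \<open>The orbit of \<open>x\<close> contains a point of the torus, and the group acts by
  nonzero factors.\<close>

lemma zeros_in_torus:
  assumes "x \<in> cox_domain \<Sigma> v \<inter> zero_set I"
  shows "x $ j \<noteq> 0"
proof -
  have "quot_map v x \<in> dense_torus v" using assms Y_eq Y_torus by blast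
  then obtain x0 where x0: "\<And>j. x0 $ j \<noteq> 0" "quot_map v x = quot_map v x0" by (auto simp: dense_torus_def)
  then obtain t where "t \<in> cox_group v" "x = (\<chi> j. t $ j * x0 $ j)"
    using quot_map_refl[of x v] by (auto simp: quot_map_def)
  then show ?thesis using x0(1) by (simp add: cox_group_iff)
qed

lemma monomial_nonzerodivisor: "Poly_Mapping.single c 1 * f \<in> I \<Longrightarrow> f \<in> I"
  unfolding mem_I_iff using zeros_in_torus by (auto simp: monom_eval_def)

lemma hilbert_function_le:
  "hilbert_function v I (div_class v a) \<le> hilbert_function v I (div_class v (a + expo c))"
  by (rule hilbert_function_mono[OF subspace_I, of "Poly_Mapping.single c 1"])
    (use monomial_nonzerodivisor in auto)

section \<open>Separation of the points of Y and the values of the Hilbert function\<close>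

definition rep :: "('k ^ 'r) set \<Rightarrow> 'k ^ 'r" where
  "rep y = (SOME x. x \<in> cox_domain \<Sigma> v \<inter> zero_set I \<and> quot_map v x = y)"

lemma rep:
  assumes "y \<in> Y"
  shows "rep y \<in> cox_domain \<Sigma> v \<inter> zero_set I" "quot_map v (rep y) = y"
proof -
  have "\<exists>x. x \<in> cox_domain \<Sigma> v \<inter> zero_set I \<and> quot_map v x = y" using assms Y_eq by auto
  from someI_ex[OF this] show "rep y \<in> cox_domain \<Sigma> v \<inter> zero_set I" "quot_map v (rep y) = y"
    by (simp_all add: rep_def)
qed

lemma rep_nonzero: "y \<in> Y \<Longrightarrow> rep y $ j \<noteq> 0"
  by (rule zeros_in_torus[OF rep(1)])

text \<open>The vanishing of a form is constant along orbits, so one representative per orbit is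
  enough.\<close>

lemma form_mem_I_iff:
  assumes f: "f \<in> forms v a"
  shows "f \<in> I \<longleftrightarrow> (\<forall>y\<in>Y. cox_eval f (rep y) = 0)"
proof
  show "\<forall>y\<in>Y. cox_eval f (rep y) = 0" if "f \<in> I" using that rep(1) mem_I_iff by blast
  assume z: "\<forall>y\<in>Y. cox_eval f (rep y) = 0"
  show "f \<in> I" unfolding mem_I_iff
  proof
    fix x assume x: "x \<in> cox_domain \<Sigma> v \<inter> zero_set I"
    then have y: "quot_map v x \<in> Y" using Y_eq by blast
    have "x \<in> quot_map v (rep (quot_map v x))" using quot_map_refl[of x v] rep(2)[OF y] by simp
    then obtain t where t: "t \<in> cox_group v" "x = (\<chi> j. t $ j * rep (quot_map v x) $ j)"
      by (auto simp: quot_map_def)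
    show "cox_eval f x = 0"
      by (subst t(2)) (intro cox_eval_forms_translate[OF f t(1)] z[rule_format, OF y])
  qed
qed

text \<open>The coordinatewise quotient of representatives of different orbits is outside the group,
  so some character takes different values at them; the binomial built from this character and its
  value at the second point separates the two.\<close>

lemma separating_form:
  assumes y: "y \<in> Y" "y' \<in> Y" "y \<noteq> y'"
  shows "\<exists>c f. f \<in> forms v (expo c) \<and> cox_eval f (rep y) \<noteq> 0 \<and> cox_eval f (rep y') = 0"
proof -
  define x x' where "x = rep y" and "x' = rep y'"
  have nz: "\<And>j. x $ j \<noteq> 0" "\<And>j. x' $ j \<noteq> 0" using rep_nonzero y by (auto simp: x_def x'_def)
  define t where "t = (\<chi> j. x' $ j * (\<chi> j. inverse (x $ j)) $ j)"
  have "t \<notin> cox_group v"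
  proof
    assume t: "t \<in> cox_group v"
    have "x' = (\<chi> j. t $ j * x $ j)" using nz by (simp add: t_def vec_eq_iff)
    then have "quot_map v x' = quot_map v x" using quot_map_cong[OF t, of x] by simp
    then show False using y rep(2) by (simp add: x_def x'_def)
  qed
  then obtain m where "laurent t (char_div v m) \<noteq> 1" using nz by (auto simp: cox_group_iff t_def)
  then have ne: "laurent x (char_div v m) \<noteq> laurent x' (char_div v m)"
    unfolding t_def laurent_mult laurent_inverse using laurent_nonzero[of x "char_div v m"] nz by auto
  \<comment> \<open>The least exponent vector that clears the negative exponents of the character;
    \<open>c\<close> and \<open>d\<close> then have the same degree and differ by the character
    \<open>m\<close>.\<close>
  define z :: "int ^ 'r" where "z = (\<chi> j. max 0 (- pairing m (v j)))"
  obtain c where c: "expo c = z" by (rule expo_surj[of z]) (auto simp: z_def)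
  obtain d where d: "expo d = z + char_div v m" by (rule expo_surj[of "z + char_div v m"]) (auto simp: z_def)
  define l where "l = laurent x' (char_div v m)"
  define f :: "('r, 'k) cox_ring" where "f = Poly_Mapping.single d 1 - Poly_Mapping.single c l"
  have "Poly_Mapping.single d (1 :: 'k) \<in> forms v (expo c)"
    by (rule forms_single) (simp add: c d principal_divisors_eq)
  moreover have "Poly_Mapping.single c l \<in> forms v (expo c)" by (rule forms_single) simp
  ultimately have "f \<in> forms v (expo c)" unfolding f_def by (rule cox.subspace_diff[OF forms_subspace])
  moreover have "cox_eval f x = laurent x z * (laurent x (char_div v m) - l)"
    using nz by (simp add: f_def monom_eval_laurent c d laurent_add algebra_simps)
  then have "cox_eval f x \<noteq> 0" using ne nz laurent_nonzero[of x z] by (simp add: l_def)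
  moreover have "cox_eval f x' = 0"
    using nz by (simp add: f_def monom_eval_laurent c d laurent_add l_def)
  ultimately show ?thesis unfolding x_def x'_def by blast
qed

text \<open>Lagrange interpolation: the product of the forms that separate \<open>y\<close> from the
  other points has a degree depending on \<open>y\<close>; monomials, which vanish nowhere on the
  torus, bring all products to one degree.\<close>

lemma separating_forms:
  obtains a g where "\<And>y. y \<in> Y \<Longrightarrow> g y \<in> forms v a"
    "\<And>y y'. y \<in> Y \<Longrightarrow> y' \<in> Y \<Longrightarrow> cox_eval (g y) (rep y') \<noteq> 0 \<longleftrightarrow> y' = y"
proof -
  obtain c f where cf: "\<And>y y'. y \<in> Y \<Longrightarrow> y' \<in> Y \<Longrightarrow> y \<noteq> y' \<Longrightarrow>
      f y y' \<in> forms v (expo (c y y')) \<and> cox_eval (f y y') (rep y) \<noteq> 0 \<and> cox_eval (f y y') (rep y') = 0"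
    using separating_form by metis
  have f: "f y y' \<in> forms v (expo (c y y'))" "cox_eval (f y y') (rep y) \<noteq> 0" "cox_eval (f y y') (rep y') = 0"
    if "y \<in> Y" "y' \<in> Y" "y \<noteq> y'" for y y'
    using cf[OF that] by simp_all
  define g0 where "g0 y = (\<Prod>y'\<in>Y - {y}. f y y')" for y
  define A where "A y = (\<Sum>y'\<in>Y - {y}. c y y')" for y
  have expo_sum: "expo (sum h B) = (\<Sum>b\<in>B. expo (h b))" for h and B :: "('k ^ 'r) set set"
    by (induction B rule: infinite_finite_induct) (auto simp: expo_add)
  \<comment> \<open>\<open>A z\<close> represents the degree of \<open>g0 z\<close>; the degrees
    belonging to the other points are supplied as a monomial.\<close>
  define g where "g y = Poly_Mapping.single (\<Sum>z\<in>Y - {y}. A z) 1 * g0 y" for y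
  have "g y \<in> forms v (expo (\<Sum>z\<in>Y. A z))" if y: "y \<in> Y" for y
  proof -
    have "g0 y \<in> forms v (\<Sum>y'\<in>Y - {y}. expo (c y y'))"
      unfolding g0_def using f(1) y by (intro forms_prod) auto
    then have "g0 y \<in> forms v (expo (A y))" by (simp add: A_def expo_sum)
    then have "g y \<in> forms v (expo (\<Sum>z\<in>Y - {y}. A z) + expo (A y))"
      unfolding g_def by (intro forms_mult forms_single) auto
    moreover have "(\<Sum>z\<in>Y - {y}. A z) + A y = (\<Sum>z\<in>Y. A z)"
      using y finite_Y by (simp add: sum.remove[of Y y] add.commute)
    ultimately show ?thesis by (metis expo_add)
  qed
  moreover have "cox_eval (g y) (rep y') \<noteq> 0 \<longleftrightarrow> y' = y" if y: "y \<in> Y" "y' \<in> Y" for y y'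
  proof -
    have "monom_eval e (rep y') \<noteq> 0" for e using rep_nonzero[OF y(2)] by (simp add: monom_eval_def)
    then have "cox_eval (g y) (rep y') \<noteq> 0 \<longleftrightarrow> (\<forall>z\<in>Y - {y}. cox_eval (f y z) (rep y') \<noteq> 0)"
      using finite_Y by (simp add: g_def g0_def prod_zero_iff)
    also have "\<dots> \<longleftrightarrow> y' = y"
      using f(2,3) y by (metis DiffE DiffI insertCI insertE singletonD)
    finally show ?thesis .
  qed
  ultimately show thesis by (rule that)
qed

text \<open>The forms \<open>g y\<close> are an interpolation basis: every form agrees modulo
  \<open>I\<close> with the combination that has the same values at the representatives.\<close>

lemma hilbert_function_separated:
  assumes g: "\<And>y. y \<in> Y \<Longrightarrow> g y \<in> forms v a"
    and sep: "\<And>y y'. y \<in> Y \<Longrightarrow> y' \<in> Y \<Longrightarrow> cox_eval (g y) (rep y') \<noteq> 0 \<longleftrightarrow> y' = y"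
  shows "hilbert_function v I (div_class v a) = card Y"
proof -
  have inj: "inj_on g Y" by (rule inj_onI) (metis sep)
  have sum_g: "(\<Sum>e\<in>g ` Y. cox_const (c e) * e) = (\<Sum>y\<in>Y. cox_const (c (g y)) * g y)" for c
    by (simp add: sum.reindex[OF inj])
  have ev: "cox_eval (\<Sum>y\<in>Y. cox_const (c y) * g y) (rep y') = c y' * cox_eval (g y') (rep y')" if y': "y' \<in> Y" for c y'
  proof -
    have "cox_eval (\<Sum>y\<in>Y. cox_const (c y) * g y) (rep y') = (\<Sum>y\<in>Y. if y = y' then c y' * cox_eval (g y') (rep y') else 0)"
      unfolding cox_eval_sum cox_eval_mult cox_eval_const by (rule sum.cong) (use sep[OF _ y'] in auto)
    then show ?thesis using finite_Y y' by (simp add: sum.delta')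
  qed
  have "basis_modulo I (forms v a) (g ` Y)"
    unfolding basis_modulo_iff indep_modulo_def
  proof (intro conjI ballI allI impI)
    show "finite (g ` Y)" using finite_Y by simp
    show "g ` Y \<subseteq> forms v a" using g by blast
    fix f :: "('r, 'k) cox_ring" assume f: "f \<in> forms v a"
    define c where "c e = cox_eval f (rep (inv_into Y g e)) / cox_eval e (rep (inv_into Y g e))" for e
    define h where "h = f - (\<Sum>e\<in>g ` Y. cox_const (c e) * e)"
    have "h \<in> forms v a" unfolding h_def
      using f g by (intro cox.subspace_diff[OF forms_subspace] cox.subspace_sum[OF forms_subspace]
          cox.subspace_scale[OF forms_subspace]) auto
    moreover have "cox_eval h (rep y) = 0" if y: "y \<in> Y" for y
      using sep[OF y y] ev[OF y, of "\<lambda>y. c (g y)"] unfolding h_def sum_g cox_eval_diff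
      by (simp add: c_def inv_into_f_f[OF inj y])
    ultimately have "h \<in> I" using form_mem_I_iff by blast
    then show "\<exists>c. f - (\<Sum>e\<in>g ` Y. cox_const (c e) * e) \<in> I"
      unfolding h_def by (rule exI[of _ c])
  next
    fix c e assume c: "(\<Sum>e\<in>g ` Y. cox_const (c e) * e) \<in> I" and e: "e \<in> g ` Y"
    then obtain y where y: "y \<in> Y" "e = g y" by blast
    have "cox_eval (\<Sum>y\<in>Y. cox_const (c (g y)) * g y) (rep y) = 0"
      using c rep(1)[OF y(1)] unfolding sum_g mem_I_iff by blast
    then show "c e = 0" using ev[OF y(1), of "\<lambda>y. c (g y)"] sep[OF y(1) y(1)] y(2) by simp
  qed
  then show ?thesis using hilbert_function_eq[OF subspace_I] card_image[OF inj] by simp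
qed

text \<open>A separating family multiplied by a monomial is again separating.\<close>

lemma hilbert_function_stable:
  obtains a where "\<And>c. hilbert_function v I (div_class v (a + expo c)) = card Y"
proof -
  obtain a g where g: "\<And>y. y \<in> Y \<Longrightarrow> g y \<in> forms v a"
    and sep: "\<And>y y'. y \<in> Y \<Longrightarrow> y' \<in> Y \<Longrightarrow> cox_eval (g y) (rep y') \<noteq> 0 \<longleftrightarrow> y' = y"
    by (rule separating_forms) blast
  have "hilbert_function v I (div_class v (a + expo c)) = card Y" for c
  proof (rule hilbert_function_separated)
    show "g y * Poly_Mapping.single c 1 \<in> forms v (a + expo c)" if "y \<in> Y" for y
      by (intro forms_mult g that forms_single) simp
    fix y y' assume y: "y \<in> Y" "y' \<in> Y"
    have "monom_eval c (rep y') \<noteq> 0" using rep_nonzero[OF y(2)] by (simp add: monom_eval_def)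
    then show "cox_eval (g y * Poly_Mapping.single c 1) (rep y') \<noteq> 0 \<longleftrightarrow> y' = y" using sep[OF y] by simp
  qed
  then show thesis by (rule that)
qed

text \<open>Every degree lies below one in which the points are separated, as the positive and the
  negative part of \<open>b - a\<close> show.\<close>

lemma hilbert_function_le_card: "hilbert_function v I (div_class v a) \<le> card Y"
proof -
  obtain b where b: "\<And>c. hilbert_function v I (div_class v (b + expo c)) = card Y" by (rule hilbert_function_stable) blast
  obtain c where c: "expo c = (\<chi> j. max 0 (b $ j - a $ j))" by (rule expo_surj[of "\<chi> j. max 0 (b $ j - a $ j)"]) auto
  obtain d where d: "expo d = (\<chi> j. max 0 (a $ j - b $ j))" by (rule expo_surj[of "\<chi> j. max 0 (a $ j - b $ j)"]) auto
  have "a + expo c = b + expo d" by (auto simp: c d vec_eq_iff max_def)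
  then show ?thesis using hilbert_function_le[of a c] b[of d] by simp
qed

text \<open>The component of degree \<open>a\<close> of a combination of generators only involves
  cofactors of degree \<open>a - d\<close>, and such a degree has no monomial, as \<open>d\<close>
  is not below \<open>a\<close>.\<close>

lemma hilbert_function_below_generators:
  assumes G: "ideal_gen G = I" "\<And>g. g \<in> G \<Longrightarrow> homogeneous v g"
    and below: "\<And>g d. g \<in> G \<Longrightarrow> g \<in> forms v d \<Longrightarrow> \<not> class_le v (div_class v d) (div_class v a)"
  shows "hilbert_function v I (div_class v a) = card (points a)"
proof -
  have hp: "homog_part v a f = 0" if f: "f \<in> ideal_gen G" for f :: "('r, 'k) cox_ring"
  proof (rule module.span_induct_alt[OF module_mult f, where h = "\<lambda>f. homog_part v a f = 0"])
    fix c g y :: "('r, 'k) cox_ring" assume g: "g \<in> G" and y: "homog_part v a y = 0"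
    then obtain d where d: "g \<in> forms v d" using G(2) unfolding homogeneous_def class_group_def by blast
    have "homog_part v (a - d) c = 0"
    proof (rule poly_mapping_eqI)
      fix e
      have "expo e - (a - d) \<notin> principal_divisors v"
      proof
        assume "expo e - (a - d) \<in> principal_divisors v"
        from principal_uminus[OF this] have "div_class v a = div_class v (d + expo e)"
          by (simp add: div_class_eq_iff algebra_simps)
        then show False using below[OF g d] class_le_iff by blast
      qed
      then show "Poly_Mapping.lookup (homog_part v (a - d) c) e = Poly_Mapping.lookup 0 e"
        by (simp add: lookup_homog_part)
    qed
    then show "homog_part v a (c * g + y) = 0" using y by (simp add: homog_part_add homog_part_mult[OF d])
  qed simp
  have "I \<inter> forms v a \<subseteq> {0}"
  proof
    fix f assume f: "f \<in> I \<inter> forms v a"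
    then have "homog_part v a f = 0" "homog_part v a f = f" using hp[of f] G(1) homog_part_id[of f v a] by auto
    then show "f \<in> {0}" by simp
  qed
  then show ?thesis using hilbert_function_free[OF subspace_I] card_monoms by simp
qed

text \<open>
  If no section of degree \<open>a i\<close> involved the variable \<open>j\<close>, then the zeros of \<open>I\<close> would be
  stable under setting this coordinate to \<open>0\<close> and would leave the torus.
\<close>

lemma variable_occurs:
  fixes F :: "'i \<Rightarrow> ('r, 'k) cox_ring"
  assumes gen: "ideal_gen (range F) = I" and F: "\<And>i. F i \<in> forms v (a i)" and proper: "I \<noteq> UNIV"
  shows "\<exists>i. \<exists>c\<in>monoms v (a i). Poly_Mapping.lookup c j > 0"
proof (rule ccontr)
  assume none: "\<not> ?thesis"
  have 0: "Poly_Mapping.lookup c j = 0" if "c \<in> Poly_Mapping.keys (F i)" for c i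
  proof -
    have "c \<in> monoms v (a i)" using that F[of i] by (simp add: mem_forms monoms_def)
    then have "\<exists>i. \<exists>c\<in>monoms v (a i). 0 < Poly_Mapping.lookup c j" if "0 < Poly_Mapping.lookup c j"
      using that by (intro exI[of _ i] bexI[of _ c])
    then show ?thesis using none by auto
  qed
  obtain x where x: "x \<in> cox_domain \<Sigma> v \<inter> zero_set I" using mem_I_iff proper by blast
  define x' where "x' = (\<chi> i. if i = j then 0 else x $ i)"
  have "monom_eval c x' = monom_eval c x" if "c \<in> Poly_Mapping.keys (F i)" for c i
    unfolding monom_eval_def using 0[OF that] by (intro prod.cong) (auto simp: x'_def)
  then have "cox_eval (F i) x' = cox_eval (F i) x" for i
    unfolding cox_eval_def monom_eval_def[symmetric] by (intro sum.cong) auto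
  then have "x' \<in> zero_set I" using x unfolding gen[symmetric] by (simp add: zero_set_ideal_gen)
  \<comment> \<open>Only the coordinate \<open>j\<close> vanishes, and the ray \<open>j\<close> is
    itself a cone of the fan.\<close>
  moreover have "x' \<in> cox_domain \<Sigma> v"
    by (rule in_cox_domainI[OF ray_in_fan[of j]]) (use zeros_in_torus[OF x] in \<open>auto simp: x'_def\<close>)
  ultimately have "x' $ j \<noteq> 0" by (intro zeros_in_torus) auto
  then show False by (simp add: x'_def)
qed

text \<open>For each \<open>j\<close> some monomial in the degree of the sum involves the variable
  \<open>j\<close>: multiply a monomial of degree \<open>a i\<close> from
  \<open>variable_occurs\<close> by monomials of the other degrees. The product over all
  \<open>j\<close> involves every variable, so its powers dominate any \<open>b\<close>.\<close>

lemma multiple_dominates: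
  fixes F :: "'n \<Rightarrow> ('r, 'k) cox_ring"
  assumes gen: "ideal_gen (range F) = I" and F: "\<And>i. F i \<in> forms v (a i)" and proper: "I \<noteq> UNIV"
    and nef: "\<And>i. nef_data (a i) (\<mu> i)"
  obtains k c where "div_class v (int (Suc k) *s (\<Sum>i\<in>UNIV. a i)) = div_class v (b + expo c)"
proof -
  define e where "e = (\<Sum>i\<in>UNIV. a i)"
  have pos: "\<exists>z. (\<forall>l. 0 \<le> z $ l) \<and> 0 < z $ j \<and> z - e \<in> principal_divisors v" for j
  proof -
    obtain i c where c: "c \<in> monoms v (a i)" "Poly_Mapping.lookup c j > 0"
      using variable_occurs[OF gen F proper] by blast
    obtain S where S: "S \<in> max_cones" using cover by blast
    \<comment> \<open>The vertex \<open>\<mu> k S\<close> provides an effective divisor, that is a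
      monomial, of degree \<open>a k\<close>.\<close>
    define u where "u k = a k + char_div v (\<mu> k S)" for k
    have u0: "0 \<le> u k $ l" for k l
    proof -
      have "- a k $ l \<le> pairing (\<mu> k S) (v l)" using nef[of k] S unfolding nef_data_def by blast
      then show ?thesis by (simp add: u_def)
    qed
    define z where "z = expo c + (\<Sum>k\<in>UNIV - {i}. u k)"
    have e: "e = a i + (\<Sum>k\<in>UNIV - {i}. a k)" unfolding e_def by (rule sum.remove) auto
    have "z - e = (expo c - a i) + (\<Sum>k\<in>UNIV - {i}. char_div v (\<mu> k S))"
      unfolding z_def e u_def by (simp add: sum.distrib)
    moreover have char: "char_div v m \<in> principal_divisors v" for m by (simp add: principal_divisors_eq)
    have "(\<Sum>k\<in>K. char_div v (\<mu> k S)) \<in> principal_divisors v" for K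
      by (induction K rule: infinite_finite_induct) (auto intro!: principal_add char)
    ultimately have "z - e \<in> principal_divisors v" using c(1) by (simp add: monoms_def principal_add)
    moreover have "0 \<le> z $ l" for l unfolding z_def using u0 by (auto simp: sum_component intro!: add_nonneg_nonneg sum_nonneg)
    moreover have "0 < z $ j" unfolding z_def using u0 c(2)
      by (auto simp: sum_component intro!: add_pos_nonneg sum_nonneg)
    ultimately show ?thesis by blast
  qed
  then obtain z where z: "\<And>j l. 0 \<le> z j $ l" "\<And>j. 0 < z j $ j" "\<And>j. z j - e \<in> principal_divisors v" by metis
  define s where "s = (\<Sum>j\<in>UNIV. z j)"
  have s1: "1 \<le> s $ j" for j
  proof -
    have "z j $ j \<le> (\<Sum>i\<in>UNIV. z i $ j)" using z(1) by (intro member_le_sum) auto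
    then show ?thesis using z(2)[of j] by (simp add: s_def sum_component)
  qed
  have mult: "int n *s d \<in> principal_divisors v" if "d \<in> principal_divisors v" for n d
  proof (induction n)
    case 0
    have "int 0 *s d = 0" by (simp add: vec_eq_iff)
    then show ?case by simp
  next
    case (Suc n)
    have eq: "int (Suc n) *s d = int n *s d + d" by (simp add: vec_eq_iff algebra_simps)
    show ?case unfolding eq by (rule principal_add[OF Suc that])
  qed
  have "(\<Sum>j\<in>K. z j - e) \<in> principal_divisors v" for K
    by (induction K rule: infinite_finite_induct) (auto intro!: principal_add z(3))
  moreover have "(\<Sum>j\<in>UNIV. z j - e) $ i = (s - int CARD('r) *s e) $ i" for i
    by (simp only: sum_component vector_minus_component vector_smult_component sum_subtractf s_def) simp
  then have "(\<Sum>j\<in>UNIV. z j - e) = s - int CARD('r) *s e" by (simp add: vec_eq_iff)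
  ultimately have sPD: "s - int CARD('r) *s e \<in> principal_divisors v" by metis
  \<comment> \<open>At least every coefficient of \<open>b\<close>; the successor keeps the multiple
    \<open>N * CARD('r)\<close> positive, so that it has the form \<open>Suc k\<close>.\<close>
  define N where "N = Suc (nat (\<Sum>j\<in>UNIV. \<bar>b $ j\<bar>))"
  have N: "b $ j \<le> int N * s $ j" for j
  proof -
    have "\<bar>b $ j\<bar> \<le> (\<Sum>j\<in>UNIV. \<bar>b $ j\<bar>)" by (rule member_le_sum) auto
    then have "b $ j \<le> int N" by (simp add: N_def)
    also have "int N \<le> int N * s $ j" using mult_left_mono[OF s1[of j], of "int N"] by simp
    finally show ?thesis .
  qed
  obtain c where c: "expo c = int N *s s - b" by (rule expo_surj[of "int N *s s - b"]) (use N in auto)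
  obtain k where k: "N * CARD('r) = Suc k" unfolding N_def by (cases "CARD('r)") auto
  have "int N *s (s - int CARD('r) *s e) \<in> principal_divisors v"
    by (rule mult[OF sPD])
  then have "- (int N *s (s - int CARD('r) *s e)) \<in> principal_divisors v" by (rule principal_uminus)
  also have "- (int N *s (s - int CARD('r) *s e)) = int (Suc k) *s e - (b + expo c)"
    unfolding k[symmetric] by (simp add: c vec_eq_iff algebra_simps)
  finally have "div_class v (int (Suc k) *s e) = div_class v (b + expo c)" by (simp add: div_class_eq_iff)
  then show thesis using that unfolding e_def by blast
qed

text \<open>At a large multiple of the sum the value is \<open>card Y\<close>; constancy brings it
  back to the sum itself, and monotonicity with the bound \<open>card Y\<close> carries it to the
  degrees above.\<close>

lemma hilbert_function_complete_intersection_eq_card: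
  fixes F :: "'n \<Rightarrow> ('r, 'k) cox_ring"
  assumes ci: "complete_intersection v I CARD('n)" and gen: "ideal_gen (range F) = I"
    and F: "\<And>i. F i \<in> forms v (a i)" and nef: "\<And>i. nef_data (a i) (\<mu> i)"
  shows "hilbert_function v I (div_class v ((\<Sum>i\<in>UNIV. a i) + expo c)) = card Y"
proof -
  have proper: "I \<noteq> UNIV" using ci unfolding complete_intersection_def regular_sequence_def by blast
  obtain b where b: "\<And>c. hilbert_function v I (div_class v (b + expo c)) = card Y" by (rule hilbert_function_stable) blast
  obtain k d where "div_class v (int (Suc k) *s (\<Sum>i\<in>UNIV. a i)) = div_class v (b + expo d)"
    by (rule multiple_dominates[OF gen F proper nef])
  then have "hilbert_function v I (div_class v (\<Sum>i\<in>UNIV. a i)) = card Y"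
    using hilbert_function_multiples_constant[OF ci gen F nef, of k] b[of d] by simp
  then show ?thesis using hilbert_function_le[of "\<Sum>i\<in>UNIV. a i" c]
      hilbert_function_le_card[of "(\<Sum>i\<in>UNIV. a i) + expo c"] by simp
qed

end

section \<open>Translation of the three claims from representing divisors to classes\<close>

theorem corollary3p18:
  fixes \<Sigma> :: "(real ^ 'n) set set"
    and v :: "'r::finite \<Rightarrow> int ^ 'n"
    and Y :: "('k::alg_closed_field ^ 'r) set set"
    and I :: "('r, 'k) cox_ring set"
  assumes "fan \<Sigma>"
    and "complete_fan \<Sigma>"
    and "primitive_ray_generators \<Sigma> v"
    and "simplicial_fan \<Sigma> v"
    and "torsion_free_class_group v"
    and "closed_subvariety \<Sigma> v Y"
    and "finite Y"
    and "Y \<subseteq> dense_torus v"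
    and "defining_ideal \<Sigma> v Y I"
  shows
    "(\<forall>G. minimal_generators v I G \<longrightarrow>
        (\<forall>\<alpha>\<in>class_group v.
           (\<forall>g\<in>G. \<forall>\<delta>\<in>class_group v. g \<in> graded_part v \<delta> \<longrightarrow> \<not> class_le v \<delta> \<alpha>) \<longrightarrow>
           (\<forall>a\<in>\<alpha>. hilbert_function v I \<alpha> = card (divisor_polytope v a \<inter> range lat))))
     \<and>
     (\<forall>\<alpha>\<in>effective_classes v. \<forall>\<alpha>'\<in>class_group v.
        class_le v \<alpha> \<alpha>' \<longrightarrow> hilbert_function v I \<alpha> \<le> hilbert_function v I \<alpha>')
     \<and>
     (\<forall>(F :: 'n \<Rightarrow> ('r, 'k) cox_ring) \<delta>.
        complete_intersection v I CARD('n) \<longrightarrow>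
        ideal_gen (range F) = I \<longrightarrow>
        (\<forall>i. F i \<in> graded_part v (\<delta> i) \<and> semi_ample TYPE('k) \<Sigma> v (\<delta> i)) \<longrightarrow>
        (\<forall>\<alpha>\<in>class_group v. class_le v (\<Sum>i\<in>UNIV. \<delta> i) \<alpha> \<longrightarrow>
           hilbert_function v I \<alpha> = card Y))"
proof -
  interpret torus_points \<Sigma> v Y I
    using assms by unfold_locales
  show ?thesis
  proof (intro conjI allI impI ballI)
    fix G \<alpha> a
    assume G: "minimal_generators v I G" and \<alpha>: "\<alpha> \<in> class_group v" and a: "a \<in> \<alpha>"
      and below: "\<forall>g\<in>G. \<forall>\<delta>\<in>class_group v. g \<in> graded_part v \<delta> \<longrightarrow> \<not> class_le v \<delta> \<alpha>"
    obtain b where "\<alpha> = div_class v b" using \<alpha> by (auto simp: class_group_def)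
    then have \<alpha>_eq: "\<alpha> = div_class v a" using div_class_mem a by blast
    have "hilbert_function v I (div_class v a) = card (points a)"
    proof (rule hilbert_function_below_generators)
      show "ideal_gen G = I" "\<And>g. g \<in> G \<Longrightarrow> homogeneous v g"
        using G by (auto simp: minimal_generators_def)
      show "\<not> class_le v (div_class v d) (div_class v a)" if "g \<in> G" "g \<in> forms v d" for g d
        using below that unfolding \<alpha>_eq class_group_def by blast
    qed
    then show "hilbert_function v I \<alpha> = card (divisor_polytope v a \<inter> range lat)"
      by (simp add: \<alpha>_eq card_polytope)
  next
    fix \<alpha> \<alpha>' assume "\<alpha> \<in> effective_classes v" "\<alpha>' \<in> class_group v" and le: "class_le v \<alpha> \<alpha>'"
    then obtain a b where ab: "\<alpha> = div_class v a" "\<alpha>' = div_class v b"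
      by (auto simp: effective_classes_def class_group_def)
    then obtain c where "\<alpha>' = div_class v (a + expo c)" using le class_le_iff by blast
    then show "hilbert_function v I \<alpha> \<le> hilbert_function v I \<alpha>'" using hilbert_function_le[of a c] ab(1) by simp
  next
    fix F :: "'n \<Rightarrow> ('r, 'k) cox_ring" and \<delta> \<alpha>
    assume ci: "complete_intersection v I CARD('n)" and gen: "ideal_gen (range F) = I"
      and F: "\<forall>i. F i \<in> graded_part v (\<delta> i) \<and> semi_ample TYPE('k) \<Sigma> v (\<delta> i)"
      and \<alpha>: "\<alpha> \<in> class_group v" "class_le v (\<Sum>i\<in>UNIV. \<delta> i) \<alpha>"
    have "\<forall>i. \<exists>a. \<delta> i = div_class v a" using F unfolding semi_ample_def by blast
    then obtain a where a: "\<And>i. \<delta> i = div_class v (a i)" by metis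
    have "\<exists>\<mu>. nef_data (a i) \<mu>" for i
      using semi_ample_nef_data[where ?'k = 'k, of "a i"] F a by metis
    then obtain \<mu> where \<mu>: "\<And>i. nef_data (a i) (\<mu> i)" by metis
    have Fa: "F i \<in> forms v (a i)" for i using F a by metis
    have "(\<Sum>i\<in>UNIV. \<delta> i) = div_class v (\<Sum>i\<in>UNIV. a i)" unfolding a by (rule sum_div_class) auto
    moreover obtain b where "\<alpha> = div_class v b" using \<alpha>(1) by (auto simp: class_group_def)
    ultimately obtain c where "\<alpha> = div_class v ((\<Sum>i\<in>UNIV. a i) + expo c)" using \<alpha>(2) class_le_iff by metis
    then show "hilbert_function v I \<alpha> = card Y"
      using hilbert_function_complete_intersection_eq_card[OF ci gen Fa \<mu>, of c] by simp
  qed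
qed

end
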